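(* For all $(u_h,\lambda_h)\in \mathcal W_h$, the bilinear form $\boldsymbol B$ satisfies $$\sup_{(v_h,\mu_h)\in\mathcal W_h\setminus\{0\}}\frac{\boldsymbol B[(u_h,\lambda_h),(v_h,\mu_h)]}{\|(v_h,\mu_h)\|_{\mathcal W_h}}\ \ge\ \frac16\,\|(u_h,\lambda_h)\|_{\mathcal W_h}.$$ Hence the following discrete problem is well-posed: find $(u_h,\lambda_h)\in\mathcal W_h$ such that $$\boldsymbol B[(u_h,\lambda_h),(v_h,\mu_h)]=(f,v_h)_\Omega+\langle g,\mu_h\rangle_\gamma\qquad\forall\,(v_h,\mu_h)\in\mathcal W_h,$$ where $f\in L^2(\Omega)$ and $g\in H^{1/2}(\gamma)$ are given.
   Context: Setting. $\omega\subset\mathbb R^2$ is an open bounded domain with Lipschitz continuous polygonal boundary $\gamma$, the union of $N$ straight segments $\gamma_1,\dots,\gamma_N$. $\Omega\supset\overline\omega$ is a larger bounded (polygonal) domain. $H^{1/2}(\gamma)$ is the space of traces on $\gamma$ of functions in $H^1(\omega)$, with norm $\|\cdot\|_{\frac12,\gamma}$; $H^{-1/2}(\gamma)$ is its dual, with dual norm $\|\cdot\|_{-\frac12,\gamma}$, and $\langle\cdot,\cdot\rangle_\gamma$ is the duality pairing, equal to $\int_\gamma \mu v\,ds$ for $L^2(\gamma)$ functions. $(\cdot,\cdot)_D$ and $\|\cdot\|_{0,D}$ are the $L^2(D)$ inner product and norm, and $|v|_{1,\Omega}=\|\nabla v\|_{0,\Omega}$. Meshes. $\mathcal T_h$ is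 a member of a regular (shape-regular) family of conforming triangulations of $\overline\Omega$ by triangles $K$ of diameter $h_K$, with $h=\max_{K}h_K$. $\gamma_h$ is the partition of $\gamma$ induced by $\mathcal T_h$: the collection of edges $e$ whose end points are the intersections of $\gamma$ with the edges of $\mathcal T_h$, plus the angular points (corners) of $\gamma$. $\gamma_{\tilde h}$ is a partition of $\gamma$ into straight edges $\tilde e$ (each contained in some $\gamma_j$), whose vertices are also vertices of $\gamma_h$, and such that $3h\le|\tilde e|\le Ch$ for all $\tilde e\in\gamma_{\tilde h}$, with $C>0$ a constant independent of $h$. Spaces. $V_h=\{v_h\in C^0(\overline\Omega)\cap H^1_0(\Omega): v_h|_K\in\mathbb P_1(K)\ \forall K\in\mathcal T_h\}$, $\Lambda_h=\{q_h\in L^2(\gamma): q_h|_e\in\mathbb P_0(e)\ \forall e\in\gamma_h\}$, $\mathcal W_h=V_h\times\Lambda_h$. $C_s>0$ is a fixed constant. $\tilde P$ is, on each $\tilde e\in\gamma_{\tilde h}$, the $L^2(\tilde e)$-orthogonal projection onto constants: $\tilde P\xi|_{\tilde e}=|\tilde e|^{-1}\int_{\tilde e}\xi\,ds$. Bilinear form: $$\boldsymbol B[(u_h,\lambda_h),(v_h,\mu_h)]=(\nabla u_h,\nabla v_h)_\Omega-\langle\lambda_h,v_h\rangle_\gamma+\langle\mu_h,u_h\rangle_\gamma+\sum_{\tilde e\in\gamma_{\tilde h}}C_s|\tilde e|\,(\lambda_h-\tilde P\lambda_h,\mu_h-\tilde P\mu_h)_{\tilde e}.$$ The constant $\beta$: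 $\beta>0$ denotes a constant (independent of $h$; such a constant exists) for which, for all $\mu_h\in\Lambda_h$, $$\beta\|\mu_h\|_{-\frac12,\gamma}\le \sup_{v_h\in V_h\setminus\{0\}}\frac{-\langle\mu_h,v_h\rangle_\gamma}{|v_h|_{1,\Omega}}+\Big\{\sum_{\tilde e\in\gamma_{\tilde h}} C_s|\tilde e|\|\mu_h-\tilde P\mu_h\|_{0,\tilde e}^2\Big\}^{\frac12}.$$ Mesh-dependent norm: $$\|(v_h,\mu_h)\|_{\mathcal W_h}^2=|v_h|_{1,\Omega}^2+\beta^2\|\mu_h\|_{-\frac12,\gamma}^2+\sum_{\tilde e\in\gamma_{\tilde h}}C_s|\tilde e|\,\|\mu_h-\tilde P\mu_h\|_{0,\tilde e}^2.$$ "Well-posed" means that the discrete problem has a unique solution for every such $f,g$, depending continuously on the data. *)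

theory Defs
  imports "HOL-Analysis.Analysis"
begin

type_synonym plane = "real^2"


section \<open>Square-integrable functions\<close>

text \<open>Elements of \<open>L\<^sup>2\<close> are represented by functions; identification is up to \<open>AE\<close> equality.\<close>

definition L2 :: "'a measure \<Rightarrow> ('a \<Rightarrow> real) set" where
  "L2 M = {f \<in> borel_measurable M. integrable M (\<lambda>x. (f x)\<^sup>2)}"

definition L2_inner :: "'a measure \<Rightarrow> ('a \<Rightarrow> real) \<Rightarrow> ('a \<Rightarrow> real) \<Rightarrow> real" where
  "L2_inner M f g = (LINT x|M. f x * g x)"

definition L2_norm :: "'a measure \<Rightarrow> ('a \<Rightarrow> real) \<Rightarrow> real" where
  "L2_norm M f = sqrt (LINT x|M. (f x)\<^sup>2)"


section \<open>Sobolev spaces on an open subset of the plane\<close>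

definition partial :: "2 \<Rightarrow> (plane \<Rightarrow> real) \<Rightarrow> plane \<Rightarrow> real" where
  "partial i \<phi> x = frechet_derivative \<phi> (at x) (axis i 1)"

text \<open>\<open>C\<^sup>\<infinity>\<close> on the whole plane: the largest class of everywhere differentiable functions that is
  closed under partial differentiation.\<close>

coinductive smooth :: "(plane \<Rightarrow> real) \<Rightarrow> bool" where
  "(\<And>x. \<phi> differentiable (at x)) \<Longrightarrow> (\<And>i. smooth (partial i \<phi>)) \<Longrightarrow> smooth \<phi>"

definition test_functions :: "plane set \<Rightarrow> (plane \<Rightarrow> real) set" where
  "test_functions U =
     {\<phi>. smooth \<phi> \<and> compact (closure {x. \<phi> x \<noteq> 0}) \<and> closure {x. \<phi> x \<noteq> 0} \<subseteq> U}"

definition has_weak_gradient :: "plane set \<Rightarrow> (plane \<Rightarrow> real) \<Rightarrow> (plane \<Rightarrow> plane) \<Rightarrow> bool" where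
  "has_weak_gradient U u G \<longleftrightarrow>
     (\<forall>i. (\<lambda>x. G x $ i) \<in> L2 (lebesgue_on U)) \<and>
     (\<forall>\<phi>\<in>test_functions U. \<forall>i.
        (LINT x|lebesgue_on U. u x * partial i \<phi> x) = - (LINT x|lebesgue_on U. G x $ i * \<phi> x))"

definition H1 :: "plane set \<Rightarrow> (plane \<Rightarrow> real) set" where
  "H1 U = {u \<in> L2 (lebesgue_on U). \<exists>G. has_weak_gradient U u G}"

text \<open>The weak gradient is unique up to null sets, so all integrals below are independent of the
  choice.\<close>

definition weak_gradient :: "plane set \<Rightarrow> (plane \<Rightarrow> real) \<Rightarrow> plane \<Rightarrow> plane" where
  "weak_gradient U u = (SOME G. has_weak_gradient U u G)"

definition grad_inner :: "plane set \<Rightarrow> (plane \<Rightarrow> real) \<Rightarrow> (plane \<Rightarrow> real) \<Rightarrow> real" where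
  "grad_inner U u v = (LINT x|lebesgue_on U. weak_gradient U u x \<bullet> weak_gradient U v x)"

definition H1_seminorm :: "plane set \<Rightarrow> (plane \<Rightarrow> real) \<Rightarrow> real" where
  "H1_seminorm U u = sqrt (LINT x|lebesgue_on U. (norm (weak_gradient U u x))\<^sup>2)"

definition H1_norm :: "plane set \<Rightarrow> (plane \<Rightarrow> real) \<Rightarrow> real" where
  "H1_norm U u = sqrt ((L2_norm (lebesgue_on U) u)\<^sup>2 + (H1_seminorm U u)\<^sup>2)"

definition H10 :: "plane set \<Rightarrow> (plane \<Rightarrow> real) set" where
  "H10 U = {u \<in> H1 U. \<exists>\<phi>. (\<forall>n. \<phi> n \<in> test_functions U) \<and>
              (\<lambda>n::nat. H1_norm U (\<lambda>x. \<phi> n x - u x)) \<longlonglongrightarrow> 0}"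


section \<open>Polygonal domains and arc length\<close>

text \<open>A segment is given by the pair of its end points.\<close>

definition segments :: "(plane \<times> plane) set \<Rightarrow> plane set" where
  "segments \<Gamma> = (\<Union>(a, b)\<in>\<Gamma>. closed_segment a b)"

definition lipschitz_boundary :: "plane set \<Rightarrow> bool" where
  "lipschitz_boundary U \<longleftrightarrow>
     (\<forall>x\<in>frontier U. \<exists>e n (\<psi> :: real \<Rightarrow> real) L r s.
        norm e = 1 \<and> norm n = 1 \<and> e \<bullet> n = 0 \<and> L-lipschitz_on UNIV \<psi> \<and> r > 0 \<and> s > 0 \<and>
        (\<forall>y. \<bar>(y - x) \<bullet> e\<bar> < r \<and> \<bar>(y - x) \<bullet> n\<bar> < s \<longrightarrow>
             (y \<in> U \<longleftrightarrow> \<psi> ((y - x) \<bullet> e) < (y - x) \<bullet> n)))"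

definition bounded_domain :: "plane set \<Rightarrow> bool" where
  "bounded_domain U \<longleftrightarrow> U \<noteq> {} \<and> open U \<and> connected U \<and> bounded U"

definition polygonal_domain :: "plane set \<Rightarrow> bool" where
  "polygonal_domain U \<longleftrightarrow> bounded_domain U \<and> (\<exists>\<Gamma>. finite \<Gamma> \<and> frontier U = segments \<Gamma>)"

text \<open>\<open>\<Gamma>\<close> lists the sides of the boundary. Sides meet only at common end points, and never in
  a straight angle, so that their end points are exactly the angular points of the boundary.\<close>

definition lipschitz_polygonal_domain :: "plane set \<Rightarrow> (plane \<times> plane) set \<Rightarrow> bool" where
  "lipschitz_polygonal_domain U \<Gamma> \<longleftrightarrow>
     bounded_domain U \<and> lipschitz_boundary U \<and>
     finite \<Gamma> \<and> frontier U = segments \<Gamma> \<and>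
     (\<forall>(a, b)\<in>\<Gamma>. a \<noteq> b) \<and>
     (\<forall>(a, b)\<in>\<Gamma>. \<forall>(c, d)\<in>\<Gamma>. (a, b) \<noteq> (c, d) \<longrightarrow>
        closed_segment a b \<inter> closed_segment c d \<subseteq> {a, b} \<inter> {c, d} \<and>
        (closed_segment a b \<inter> closed_segment c d \<noteq> {} \<longrightarrow> \<not> collinear {a, b, c, d}))"

definition corners :: "(plane \<times> plane) set \<Rightarrow> plane set" where
  "corners \<Gamma> = fst ` \<Gamma> \<union> snd ` \<Gamma>"

definition segment_measure :: "plane \<Rightarrow> plane \<Rightarrow> plane measure" where
  "segment_measure a b =
     distr (density lborel (\<lambda>t::real. ennreal (dist a b) * indicator {0..1} t)) borel (linepath a b)"

text \<open>The arc length measure \<open>ds\<close>, as a measure on the points of \<open>segments \<Gamma>\<close>.\<close>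

definition arclength :: "(plane \<times> plane) set \<Rightarrow> plane measure" where
  "arclength \<Gamma> =
     restrict_space
       (measure_of UNIV (sets borel) (\<lambda>A. \<Sum>(a, b)\<in>\<Gamma>. emeasure (segment_measure a b) A))
       (segments \<Gamma>)"

lemma emeasure_segment_measure_closed_segment:
  "emeasure (segment_measure a b) (closed_segment a b) = ennreal (dist a b)"
proof -
  have [measurable]: "linepath a b \<in> borel_measurable borel"
    by (intro borel_measurable_continuous_onI continuous_on_linepath)
  have cs: "closed_segment a b \<in> sets borel"
    by (simp add: borel_closed closed_segment)
  have "emeasure (segment_measure a b) (closed_segment a b)
      = (\<integral>\<^sup>+t. ennreal (dist a b) * indicator {0..1} t
             * indicator (linepath a b -` closed_segment a b) t \<partial>lborel)"
    unfolding segment_measure_def using cs measurable_sets_borel[of "linepath a b" borel]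
    by (subst emeasure_distr) (auto simp: emeasure_density)
  also have "\<dots> = (\<integral>\<^sup>+t. ennreal (dist a b) * indicator {0..1} (t::real) \<partial>lborel)"
    by (rule nn_integral_cong) (auto simp: indicator_def linepath_in_path split: if_splits)
  also have "\<dots> = ennreal (dist a b)"
    by (simp add: nn_integral_cmult)
  finally show ?thesis .
qed

lemma emeasure_arclength:
  assumes "finite \<Gamma>" "A \<in> sets borel" "A \<subseteq> segments \<Gamma>"
  shows "emeasure (arclength \<Gamma>) A = (\<Sum>(a, b)\<in>\<Gamma>. emeasure (segment_measure a b) A)"
proof -
  let ?\<mu> = "\<lambda>A. \<Sum>(a, b)\<in>\<Gamma>. emeasure (segment_measure a b) A"
  let ?N = "measure_of UNIV (sets (borel :: plane measure)) ?\<mu>"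
  have sN: "sets ?N = sets borel" "space ?N = UNIV"
    using sets.sigma_sets_eq[of "borel :: plane measure"] by simp_all
  have "countably_additive (sets (borel :: plane measure)) ?\<mu>"
  proof (rule countably_additiveI)
    fix B :: "nat \<Rightarrow> plane set"
    assume B: "range B \<subseteq> sets borel" "disjoint_family B"
    have "(\<Sum>i. ?\<mu> (B i)) = (\<Sum>(a, b)\<in>\<Gamma>. \<Sum>i. emeasure (segment_measure a b) (B i))"
      by (subst suminf_sum) (auto simp: case_prod_beta)
    also have "\<dots> = ?\<mu> (\<Union>i. B i)"
      using B by (intro sum.cong refl) (auto simp: segment_measure_def intro!: suminf_emeasure)
    finally show "(\<Sum>i. ?\<mu> (B i)) = ?\<mu> (\<Union>i. B i)" .
  qed
  then have eN: "emeasure ?N A = ?\<mu> A"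
    using assms sets.sigma_algebra_axioms[of "borel :: plane measure"]
    by (intro emeasure_measure_of_sigma) (auto simp: positive_def split_beta)
  have "segments \<Gamma> \<in> sets borel"
    using assms(1) unfolding segments_def
    by (intro sets.finite_UN) (auto simp: borel_closed closed_segment)
  then show ?thesis
    unfolding arclength_def using sN assms eN by (simp add: emeasure_restrict_space)
qed


section \<open>The trace spaces on the boundary\<close>

text \<open>The graph of the trace operator, the continuous extension of the restriction of smooth
  functions to the boundary.\<close>

definition is_trace ::
  "plane set \<Rightarrow> (plane \<times> plane) set \<Rightarrow> (plane \<Rightarrow> real) \<Rightarrow> (plane \<Rightarrow> real) \<Rightarrow> bool" where
  "is_trace \<omega> \<Gamma> u q \<longleftrightarrow>
     u \<in> H1 \<omega> \<and> q \<in> L2 (arclength \<Gamma>) \<and>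
     (\<exists>\<phi>. (\<forall>n. smooth (\<phi> n)) \<and>
          (\<lambda>n::nat. H1_norm \<omega> (\<lambda>x. \<phi> n x - u x)) \<longlonglongrightarrow> 0 \<and>
          (\<lambda>n. L2_norm (arclength \<Gamma>) (\<lambda>x. \<phi> n x - q x)) \<longlonglongrightarrow> 0)"

definition Hhalf :: "plane set \<Rightarrow> (plane \<times> plane) set \<Rightarrow> (plane \<Rightarrow> real) set" where
  "Hhalf \<omega> \<Gamma> = {q. \<exists>u. is_trace \<omega> \<Gamma> u q}"

definition Hhalf_norm :: "plane set \<Rightarrow> (plane \<times> plane) set \<Rightarrow> (plane \<Rightarrow> real) \<Rightarrow> real" where
  "Hhalf_norm \<omega> \<Gamma> q = Inf {H1_norm \<omega> u |u. is_trace \<omega> \<Gamma> u q}"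

text \<open>The dual norm of a linear functional \<open>F\<close> on \<open>H\<^sup>1\<^sup>/\<^sup>2\<close>; it is finite exactly if
  \<open>F\<close> is continuous.\<close>

definition Hmhalf_norm ::
  "plane set \<Rightarrow> (plane \<times> plane) set \<Rightarrow> ((plane \<Rightarrow> real) \<Rightarrow> real) \<Rightarrow> ereal" where
  "Hmhalf_norm \<omega> \<Gamma> F =
     (SUP q\<in>{q \<in> Hhalf \<omega> \<Gamma>. \<not> (AE x in arclength \<Gamma>. q x = 0)}.
        ereal \<bar>F q\<bar> / ereal (Hhalf_norm \<omega> \<Gamma> q))"

text \<open>The duality pairing for \<open>\<mu> \<in> L\<^sup>2\<close>, so that \<open>pairing \<Gamma> \<mu>\<close> is the functional on
  \<open>H\<^sup>1\<^sup>/\<^sup>2\<close> represented by \<open>\<mu>\<close>.\<close>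

definition pairing :: "(plane \<times> plane) set \<Rightarrow> (plane \<Rightarrow> real) \<Rightarrow> (plane \<Rightarrow> real) \<Rightarrow> real" where
  "pairing \<Gamma> \<mu> v = (LINT x|arclength \<Gamma>. \<mu> x * v x)"


section \<open>Meshes\<close>

text \<open>The library notion \<^const>\<open>triangulation\<close> provides finiteness and conformity.\<close>

definition mesh :: "plane set \<Rightarrow> plane set set \<Rightarrow> bool" where
  "mesh \<Omega> \<T> \<longleftrightarrow> triangulation \<T> \<and> (\<forall>K\<in>\<T>. 2 simplex K) \<and> \<Union>\<T> = closure \<Omega>"

definition mesh_size :: "plane set set \<Rightarrow> real" where
  "mesh_size \<T> = Max (diameter ` \<T>)"

definition incircle_diameter :: "plane set \<Rightarrow> real" where
  "incircle_diameter K = 2 * Sup {r. r \<ge> 0 \<and> (\<exists>x. cball x r \<subseteq> K)}"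

definition regular_family :: "plane set \<Rightarrow> 'i set \<Rightarrow> ('i \<Rightarrow> plane set set) \<Rightarrow> bool" where
  "regular_family \<Omega> I \<T> \<longleftrightarrow>
     (\<forall>i\<in>I. mesh \<Omega> (\<T> i)) \<and>
     (\<exists>\<sigma>>0. \<forall>i\<in>I. \<forall>K\<in>\<T> i. diameter K \<le> \<sigma> * incircle_diameter K)"

text \<open>The intersection of a side with a mesh edge is empty, a point, or (if they overlap) a
  segment; its extreme points are the points it contributes to the induced partition.\<close>

definition induced_vertices :: "(plane \<times> plane) set \<Rightarrow> plane set set \<Rightarrow> plane set" where
  "induced_vertices \<Gamma> \<T> =
     {x. \<exists>(a, b)\<in>\<Gamma>. \<exists>K\<in>\<T>. \<exists>E. E edge_of K \<and> x extreme_point_of (closed_segment a b \<inter> E)}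
     \<union> corners \<Gamma>"

definition induced_partition :: "(plane \<times> plane) set \<Rightarrow> plane set set \<Rightarrow> plane set set" where
  "induced_partition \<Gamma> \<T> =
     {closed_segment p q |p q.
        p \<noteq> q \<and> p \<in> induced_vertices \<Gamma> \<T> \<and> q \<in> induced_vertices \<Gamma> \<T> \<and>
        open_segment p q \<inter> induced_vertices \<Gamma> \<T> = {} \<and>
        (\<exists>(a, b)\<in>\<Gamma>. closed_segment p q \<subseteq> closed_segment a b)}"

text \<open>The length of a straight edge \<open>e\<close> is \<^term>\<open>diameter e\<close>.\<close>

definition coarse_partition ::
  "(plane \<times> plane) set \<Rightarrow> plane set set \<Rightarrow> real \<Rightarrow> plane set set \<Rightarrow> bool" where
  "coarse_partition \<Gamma> \<T> C \<E> \<longleftrightarrow>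
     finite \<E> \<and> \<Union>\<E> = segments \<Gamma> \<and>
     (\<forall>e\<in>\<E>. (\<exists>p q. p \<noteq> q \<and> e = closed_segment p q \<and>
                     p \<in> induced_vertices \<Gamma> \<T> \<and> q \<in> induced_vertices \<Gamma> \<T>) \<and>
              (\<exists>(a, b)\<in>\<Gamma>. e \<subseteq> closed_segment a b)) \<and>
     (\<forall>e\<in>\<E>. \<forall>e'\<in>\<E>. e \<noteq> e' \<longrightarrow> rel_interior e \<inter> rel_interior e' = {}) \<and>
     (\<forall>e\<in>\<E>. 3 * mesh_size \<T> \<le> diameter e \<and> diameter e \<le> C * mesh_size \<T>)"


section \<open>The discrete spaces and the stabilised bilinear form\<close>

text \<open>Functions in \<open>Vh\<close> are identified if they agree on the closure of \<open>\<Omega>\<close>, functions in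
  \<open>Lh\<close> if they agree almost everywhere with respect to arc length.\<close>

definition Vh :: "plane set \<Rightarrow> plane set set \<Rightarrow> (plane \<Rightarrow> real) set" where
  "Vh \<Omega> \<T> =
     {v \<in> H10 \<Omega>. continuous_on (closure \<Omega>) v \<and>
        (\<forall>K\<in>\<T>. \<exists>a c. \<forall>x\<in>K. v x = a \<bullet> x + c)}"

definition Lh :: "(plane \<times> plane) set \<Rightarrow> plane set set \<Rightarrow> (plane \<Rightarrow> real) set" where
  "Lh \<Gamma> \<T> =
     {q \<in> L2 (arclength \<Gamma>). \<forall>e\<in>induced_partition \<Gamma> \<T>.
        \<exists>c. AE x in arclength \<Gamma>. x \<in> e \<longrightarrow> q x = c}"

definition Wh ::
  "plane set \<Rightarrow> (plane \<times> plane) set \<Rightarrow> plane set set \<Rightarrow> ((plane \<Rightarrow> real) \<times> (plane \<Rightarrow> real)) set" where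
  "Wh \<Omega> \<Gamma> \<T> = Vh \<Omega> \<T> \<times> Lh \<Gamma> \<T>"

definition Wh_eq ::
  "plane set \<Rightarrow> (plane \<times> plane) set \<Rightarrow> (plane \<Rightarrow> real) \<times> (plane \<Rightarrow> real)
     \<Rightarrow> (plane \<Rightarrow> real) \<times> (plane \<Rightarrow> real) \<Rightarrow> bool" where
  "Wh_eq \<Omega> \<Gamma> = (\<lambda>(u, l) (v, \<mu>).
     (\<forall>x\<in>closure \<Omega>. u x = v x) \<and> (AE x in arclength \<Gamma>. l x = \<mu> x))"

definition Vh_nonzero :: "plane set \<Rightarrow> plane set set \<Rightarrow> (plane \<Rightarrow> real) set" where
  "Vh_nonzero \<Omega> \<T> = {v \<in> Vh \<Omega> \<T>. \<exists>x\<in>closure \<Omega>. v x \<noteq> 0}"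

definition Wh_nonzero ::
  "plane set \<Rightarrow> (plane \<times> plane) set \<Rightarrow> plane set set \<Rightarrow> ((plane \<Rightarrow> real) \<times> (plane \<Rightarrow> real)) set" where
  "Wh_nonzero \<Omega> \<Gamma> \<T> = {w \<in> Wh \<Omega> \<Gamma> \<T>. \<not> Wh_eq \<Omega> \<Gamma> w (\<lambda>_. 0, \<lambda>_. 0)}"

text \<open>The constant value of the projection \<open>P\<close> on the edge \<open>e\<close>.\<close>

definition edge_mean :: "(plane \<times> plane) set \<Rightarrow> plane set \<Rightarrow> (plane \<Rightarrow> real) \<Rightarrow> real" where
  "edge_mean \<Gamma> e \<xi> = (LINT x:e|arclength \<Gamma>. \<xi> x) / diameter e"

definition stab ::
  "(plane \<times> plane) set \<Rightarrow> plane set set \<Rightarrow> real \<Rightarrow> (plane \<Rightarrow> real) \<Rightarrow> (plane \<Rightarrow> real) \<Rightarrow> real" where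
  "stab \<Gamma> \<E> Cs l \<mu> =
     (\<Sum>e\<in>\<E>. Cs * diameter e *
        (LINT x:e|arclength \<Gamma>. (l x - edge_mean \<Gamma> e l) * (\<mu> x - edge_mean \<Gamma> e \<mu>)))"

definition Bform ::
  "plane set \<Rightarrow> (plane \<times> plane) set \<Rightarrow> plane set set \<Rightarrow> real
     \<Rightarrow> (plane \<Rightarrow> real) \<times> (plane \<Rightarrow> real) \<Rightarrow> (plane \<Rightarrow> real) \<times> (plane \<Rightarrow> real) \<Rightarrow> real" where
  "Bform \<Omega> \<Gamma> \<E> Cs = (\<lambda>(u, l) (v, \<mu>).
     grad_inner \<Omega> u v - pairing \<Gamma> l v + pairing \<Gamma> \<mu> u + stab \<Gamma> \<E> Cs l \<mu>)"

definition Wh_norm ::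
  "plane set \<Rightarrow> plane set \<Rightarrow> (plane \<times> plane) set \<Rightarrow> plane set set \<Rightarrow> real \<Rightarrow> real
     \<Rightarrow> (plane \<Rightarrow> real) \<times> (plane \<Rightarrow> real) \<Rightarrow> real" where
  "Wh_norm \<omega> \<Omega> \<Gamma> \<E> Cs \<beta> = (\<lambda>(v, \<mu>).
     sqrt ((H1_seminorm \<Omega> v)\<^sup>2
           + \<beta>\<^sup>2 * (real_of_ereal (Hmhalf_norm \<omega> \<Gamma> (pairing \<Gamma> \<mu>)))\<^sup>2
           + stab \<Gamma> \<E> Cs \<mu> \<mu>))"

definition discrete_solution ::
  "plane set \<Rightarrow> (plane \<times> plane) set \<Rightarrow> plane set set \<Rightarrow> plane set set \<Rightarrow> real
     \<Rightarrow> (plane \<Rightarrow> real) \<Rightarrow> (plane \<Rightarrow> real) \<Rightarrow> (plane \<Rightarrow> real) \<times> (plane \<Rightarrow> real) \<Rightarrow> bool" where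
  "discrete_solution \<Omega> \<Gamma> \<T> \<E> Cs f g w \<longleftrightarrow>
     w \<in> Wh \<Omega> \<Gamma> \<T> \<and>
     (\<forall>(v, \<mu>)\<in>Wh \<Omega> \<Gamma> \<T>.
        Bform \<Omega> \<Gamma> \<E> Cs w (v, \<mu>) = L2_inner (lebesgue_on \<Omega>) f v + pairing \<Gamma> g \<mu>)"

text \<open>The last conjunct is continuous dependence on the data; the problem being linear, it is
  expressed by a Lipschitz bound.\<close>

definition discrete_well_posed ::
  "plane set \<Rightarrow> plane set \<Rightarrow> (plane \<times> plane) set \<Rightarrow> plane set set \<Rightarrow> plane set set
     \<Rightarrow> real \<Rightarrow> real \<Rightarrow> bool" where
  "discrete_well_posed \<omega> \<Omega> \<Gamma> \<T> \<E> Cs \<beta> \<longleftrightarrow>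
     (\<forall>f\<in>L2 (lebesgue_on \<Omega>). \<forall>g\<in>Hhalf \<omega> \<Gamma>.
        (\<exists>w. discrete_solution \<Omega> \<Gamma> \<T> \<E> Cs f g w) \<and>
        (\<forall>w w'. discrete_solution \<Omega> \<Gamma> \<T> \<E> Cs f g w \<and> discrete_solution \<Omega> \<Gamma> \<T> \<E> Cs f g w'
           \<longrightarrow> Wh_eq \<Omega> \<Gamma> w w')) \<and>
     (\<exists>M\<ge>0. \<forall>f\<in>L2 (lebesgue_on \<Omega>). \<forall>f'\<in>L2 (lebesgue_on \<Omega>). \<forall>g\<in>Hhalf \<omega> \<Gamma>. \<forall>g'\<in>Hhalf \<omega> \<Gamma>.
        \<forall>u l u' l'.
          discrete_solution \<Omega> \<Gamma> \<T> \<E> Cs f g (u, l) \<and> discrete_solution \<Omega> \<Gamma> \<T> \<E> Cs f' g' (u', l')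
          \<longrightarrow> Wh_norm \<omega> \<Omega> \<Gamma> \<E> Cs \<beta> (\<lambda>x. u x - u' x, \<lambda>x. l x - l' x)
              \<le> M * (L2_norm (lebesgue_on \<Omega>) (\<lambda>x. f x - f' x) + Hhalf_norm \<omega> \<Gamma> (\<lambda>x. g x - g' x)))"

end

theory Submission
  imports Defs "HOL-Library.Function_Algebras" "HOL-Computational_Algebra.Polynomial"
begin

text \<open>Stability. Let \<open>m\<close> be the supremum of \<open>B[w, z] / \<parallel>z\<parallel>\<close> over \<open>z\<close>, for a fixed \<open>w = (u, l)\<close>, and let \<open>A\<close>, \<open>N\<close>, \<open>S\<close>
be the three parts of the norm of \<open>w\<close>: the energy of \<open>u\<close>, \<open>\<beta>\<close> times the dual norm of \<open>l\<close>, and the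
stabilisation seminorm of \<open>l\<close>. Two kinds of test functions give all that is needed. The choice
\<open>z = w\<close> cancels the skew part of the form and gives \<open>A\<^sup>2 + S\<^sup>2 \<le> m \<parallel>w\<parallel>\<close>. The choice \<open>z = (v, 0)\<close> gives
\<open>- \<langle>l, v\<rangle> \<le> (m + A) |v|\<close> for every \<open>v\<close>, so that the assumed inequality for \<open>\<beta>\<close> yields \<open>N \<le> m + A + S\<close>. These
two bounds force \<open>\<parallel>w\<parallel>\<^sup>2 \<le> 2 m\<^sup>2 + 5 m \<parallel>w\<parallel>\<close>, hence \<open>\<parallel>w\<parallel> \<le> 6 m\<close> (lemma \<open>norm_le_six_B_bound\<close>). No function \<open>v\<close> that
attains the supremum in the inequality for \<open>\<beta>\<close> has to be constructed.

Well-posedness. The inf-sup bound makes the homogeneous problem uniquely solvable. The transposed form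
is the same form after a change of sign of both multipliers (\<open>B_flip\<close>), so it is nondegenerate as well,
and existence is linear algebra in a space that is finite-dimensional modulo functions that
vanish almost everywhere (\<open>finite_dimensional_solvability\<close>). Continuous dependence is the inf-sup bound
applied to a difference of solutions, with the Poincare inequality for \<open>f\<close> and the definition of the dual
norm for \<open>g\<close>.

What has to be supplied for this is that the norm of \<open>W\<^sub>h\<close> is a norm, and that
the forms are bilinear although a weak gradient is an arbitrary choice up to null sets. Both rest on one
fact, the fundamental lemma of the calculus of variations in the form of
\<open>integral_test_functions_zero_imp_AE_zero\<close>. It is stated for a general Borel measure, so that it
applies to Lebesgue measure, where it makes weak gradients unique, and to arc length, where it shows that a
multiplier which annihilates all smooth functions vanishes. On the side of \<open>V\<^sub>h\<close>, definiteness is the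
Poincare inequality. The dual norm of a discrete multiplier is finite because \<open>V\<^sub>h\<close> with the
energy inner product is a finite-dimensional inner product space, in which the pairing has a Riesz
representative (\<open>pairing_Riesz_representative\<close>).\<close>

section \<open>Linear functionals on finite-dimensional spaces\<close>

text \<open>Weak gradients are chosen by description, so the functionals of interest are linear only on a
subspace; hence linearity relative to a set.\<close>

definition linear_on :: "'a::real_vector set \<Rightarrow> ('a \<Rightarrow> real) \<Rightarrow> bool" where
  "linear_on W F \<longleftrightarrow>
     (\<forall>x\<in>W. \<forall>y\<in>W. F (x + y) = F x + F y) \<and> (\<forall>c. \<forall>x\<in>W. F (c *\<^sub>R x) = c * F x)"

lemma linear_on_add: "linear_on W F \<Longrightarrow> x \<in> W \<Longrightarrow> y \<in> W \<Longrightarrow> F (x + y) = F x + F y"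
  by (simp add: linear_on_def)

lemma linear_on_scale: "linear_on W F \<Longrightarrow> x \<in> W \<Longrightarrow> F (c *\<^sub>R x) = c * F x"
  by (simp add: linear_on_def)

lemma linear_on_diff:
  assumes "linear_on W F" "subspace W" "x \<in> W" "y \<in> W"
  shows "F (x - y) = F x - F y"
  using linear_on_add[OF assms(1,3), of "(-1) *\<^sub>R y"] linear_on_scale[OF assms(1,4), of "-1"]
    subspace_scale[OF assms(2,4), of "-1"] by simp

lemma linear_on_subset: "linear_on W F \<Longrightarrow> V \<subseteq> W \<Longrightarrow> linear_on V F"
  unfolding linear_on_def by blast

lemma linear_on_plus: "linear_on X F \<Longrightarrow> linear_on X H \<Longrightarrow> linear_on X (\<lambda>z. F z + H z)"
  and linear_on_minus: "linear_on X F \<Longrightarrow> linear_on X H \<Longrightarrow> linear_on X (\<lambda>z. F z - H z)"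
  by (auto simp: linear_on_def algebra_simps)

lemma linear_on_sum:
  assumes "linear_on W F" "subspace W" "finite S" "\<And>s. s \<in> S \<Longrightarrow> f s \<in> W"
  shows "F (\<Sum>s\<in>S. c s *\<^sub>R f s) = (\<Sum>s\<in>S. c s * F (f s))"
  using assms(3,4)
proof (induction S)
  case empty
  then show ?case
    using linear_on_scale[OF assms(1) subspace_0[OF assms(2)], of 0] by simp
next
  case (insert s S)
  have "(\<Sum>s\<in>S. c s *\<^sub>R f s) \<in> W"
    using insert.prems by (intro subspace_sum[OF assms(2)] subspace_scale[OF assms(2)]) auto
  then show ?case
    using insert linear_on_add[OF assms(1), of "c s *\<^sub>R f s"] linear_on_scale[OF assms(1)]
      subspace_scale[OF assms(2)] by simp
qed

lemma subspace_kernel: "subspace W \<Longrightarrow> linear_on W F \<Longrightarrow> subspace {w \<in> W. F w = 0}"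
  using linear_on_scale[of W F 0 0] by (auto simp: subspace_def linear_on_def)

text \<open>Finitely many coordinate functionals bound the dimension modulo their common kernel. By induction, at
most one vector per functional is needed: pass to the kernel of one functional, and add one vector on which it
does not vanish. The quotient space itself never has to be formed.\<close>

lemma finitely_spanned_modulo_kernel:
  assumes "finite J" "subspace W" "\<And>i. i \<in> J \<Longrightarrow> linear_on W (T i)"
  shows "\<exists>S. finite S \<and> S \<subseteq> W \<and> (\<forall>w\<in>W. \<exists>s\<in>span S. \<forall>i\<in>J. T i (w - s) = 0)"
  using assms
proof (induction J arbitrary: W)
  case empty
  show ?case by (rule exI[of _ "{}"]) auto
next
  case (insert i J W)
  define W' where "W' = {w \<in> W. T i w = 0}"
  have lin: "linear_on W (T i)" and sub: "subspace W'"
    using insert.prems subspace_kernel[of W "T i"] by (auto simp: W'_def)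
  have "\<exists>S. finite S \<and> S \<subseteq> W' \<and> (\<forall>w\<in>W'. \<exists>s\<in>span S. \<forall>j\<in>J. T j (w - s) = 0)"
    using insert.prems by (intro insert.IH[OF sub]) (auto simp: W'_def intro: linear_on_subset)
  then obtain S where S: "finite S" "S \<subseteq> W'" "\<And>w. w \<in> W' \<Longrightarrow> \<exists>s\<in>span S. \<forall>j\<in>J. T j (w - s) = 0"
    by blast
  have span: "span S \<subseteq> W'" using S(2) sub by (rule span_minimal)
  show ?case
  proof (cases "\<exists>w\<in>W. T i w \<noteq> 0")
    case False
    then have "W' = W" by (auto simp: W'_def)
    moreover have "T i (w - s) = 0" if "w \<in> W" "s \<in> span S" for w s
      using that span subspace_diff[OF insert.prems(1)] False \<open>W' = W\<close> by blast
    ultimately show ?thesis using S by (intro exI[of _ S]) fastforce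
  next
    case True
    then obtain w0 where w0: "w0 \<in> W" "T i w0 \<noteq> 0" by blast
    have "\<exists>s\<in>span (insert w0 S). \<forall>j\<in>insert i J. T j (w - s) = 0" if w: "w \<in> W" for w
    proof -
      define c where "c = T i w / T i w0"
      have c: "w - c *\<^sub>R w0 \<in> W'"
        using w w0 linear_on_diff[OF lin insert.prems(1), of w "c *\<^sub>R w0"] linear_on_scale[OF lin w0(1)]
          subspace_scale[OF insert.prems(1), of w0] subspace_diff[OF insert.prems(1), of w]
        by (auto simp: W'_def c_def)
      then obtain s where s: "s \<in> span S" "\<forall>j\<in>J. T j (w - c *\<^sub>R w0 - s) = 0" using S(3) by blast
      have "T i (w - c *\<^sub>R w0 - s) = 0"
        using subspace_diff[OF sub c] s(1) span by (auto simp: W'_def)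
      moreover have "c *\<^sub>R w0 + s \<in> span (insert w0 S)"
        using s(1) span_mono[of S "insert w0 S"]
        by (intro span_add span_scale) (auto intro: span_base)
      ultimately show ?thesis using s(2)
        by (intro bexI[of _ "c *\<^sub>R w0 + s"]) (auto simp: algebra_simps)
    qed
    then show ?thesis using S(1,2) w0(1) by (intro exI[of _ "insert w0 S"]) (auto simp: W'_def)
  qed
qed

text \<open>The annihilator lemma: a functional which vanishes on the common kernel of finitely many others is a
linear combination of them. As before, restrict to the kernel of one functional and fix its coefficient by means of a
vector outside that kernel.\<close>

lemma functional_in_span:
  assumes "finite S" "subspace W" "\<And>s. s \<in> S \<Longrightarrow> linear_on W (F s)" "linear_on W l"
    "\<And>z. z \<in> W \<Longrightarrow> (\<forall>s\<in>S. F s z = 0) \<Longrightarrow> l z = 0"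
  shows "\<exists>c. \<forall>z\<in>W. l z = (\<Sum>s\<in>S. c s * F s z)"
  using assms
proof (induction S arbitrary: W)
  case empty
  then show ?case by auto
next
  case (insert i S W)
  define W' where "W' = {w \<in> W. F i w = 0}"
  have lin: "linear_on W (F i)" and sub: "subspace W'"
    using insert.prems subspace_kernel[of W "F i"] by (auto simp: W'_def)
  have "\<exists>c. \<forall>z\<in>W'. l z = (\<Sum>s\<in>S. c s * F s z)"
    using insert.prems by (intro insert.IH[OF sub]) (auto simp: W'_def intro: linear_on_subset)
  then obtain c where c: "\<And>z. z \<in> W' \<Longrightarrow> l z = (\<Sum>s\<in>S. c s * F s z)" by blast
  show ?case
  proof (cases "\<exists>w\<in>W. F i w \<noteq> 0")
    case False
    then have "l z = (\<Sum>s\<in>insert i S. c s * F s z)" if "z \<in> W" for z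
      using insert.hyps that c[of z] by (simp add: W'_def)
    then show ?thesis by blast
  next
    case True
    then obtain w0 where w0: "w0 \<in> W" "F i w0 \<noteq> 0" by blast
    define d where "d = (l w0 - (\<Sum>s\<in>S. c s * F s w0)) / F i w0"
    have "l z = (\<Sum>s\<in>insert i S. (c(i := d)) s * F s z)" if z: "z \<in> W" for z
    proof -
      define r where "r = F i z / F i w0"
      have rw: "r *\<^sub>R w0 \<in> W" using w0(1) insert.prems(1) by (simp add: subspace_scale)
      have dif: "G (z - r *\<^sub>R w0) = G z - r * G w0" if "linear_on W G" for G
        using linear_on_diff[OF that insert.prems(1) z rw] linear_on_scale[OF that w0(1)] by simp
      have "z - r *\<^sub>R w0 \<in> W'"
        using z rw w0(2) insert.prems(1) dif[OF lin] by (auto simp: W'_def subspace_diff r_def)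
      then have "l z - r * l w0 = (\<Sum>s\<in>S. c s * (F s z - r * F s w0))"
        using c[of "z - r *\<^sub>R w0"] dif[OF insert.prems(3)] dif[OF insert.prems(2)] by simp
      also have "\<dots> = (\<Sum>s\<in>S. c s * F s z) - r * (\<Sum>s\<in>S. c s * F s w0)"
        by (simp add: sum_subtractf sum_distrib_left algebra_simps)
      finally have "l z = (\<Sum>s\<in>S. c s * F s z) + d * F i z"
        using w0(2) by (simp add: d_def r_def field_simps)
      moreover have "(\<Sum>s\<in>S. (c(i := d)) s * F s z) = (\<Sum>s\<in>S. c s * F s z)"
        using insert.hyps by (intro sum.cong) auto
      ultimately show ?thesis using insert.hyps by simp
    qed
    then show ?thesis by blast
  qed
qed

text \<open>Existence from nondegeneracy in the second argument. The coordinates \<open>T\<close> separate points modulo the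
radical of \<open>B\<close>, so finitely many functionals \<open>B s\<close> have the same common kernel as all functionals \<open>B w\<close>; the
functional \<open>l\<close> vanishes there, so it is a combination of the \<open>B s\<close>, and the same combination of the vectors \<open>s\<close> solves the
equation.\<close>

lemma finite_dimensional_solvability:
  assumes W: "subspace W" and J: "finite J" "\<And>i. i \<in> J \<Longrightarrow> linear_on W (T i)"
    and B1: "\<And>z. z \<in> W \<Longrightarrow> linear_on W (\<lambda>w. B w z)" and B2: "\<And>w. w \<in> W \<Longrightarrow> linear_on W (B w)"
    and rad: "\<And>w z. w \<in> W \<Longrightarrow> z \<in> W \<Longrightarrow> (\<forall>i\<in>J. T i w = 0) \<Longrightarrow> B w z = 0"
    and l: "linear_on W l" "\<And>z. z \<in> W \<Longrightarrow> (\<forall>w\<in>W. B w z = 0) \<Longrightarrow> l z = 0"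
  shows "\<exists>w\<in>W. \<forall>z\<in>W. B w z = l z"
proof -
  obtain S where S: "finite S" "S \<subseteq> W" "\<And>w. w \<in> W \<Longrightarrow> \<exists>s\<in>span S. \<forall>i\<in>J. T i (w - s) = 0"
    using finitely_spanned_modulo_kernel[of J W T] W J by auto
  have "\<exists>c. \<forall>z\<in>W. l z = (\<Sum>s\<in>S. c s * B s z)"
  proof (rule functional_in_span[OF S(1) W _ l(1)])
    show "linear_on W (B s)" if "s \<in> S" for s using that S(2) B2 by blast
    fix z assume z: "z \<in> W" "\<forall>s\<in>S. B s z = 0"
    have sp: "span S \<subseteq> {w \<in> W. B w z = 0}"
      using S(2) z subspace_kernel[OF W B1] by (intro span_minimal) auto
    have "B w z = 0" if w: "w \<in> W" for w
    proof -
      obtain s where s: "s \<in> span S" "\<forall>i\<in>J. T i (w - s) = 0" using S(3)[OF w] by blast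
      then have "s \<in> W" "B s z = 0" using sp by auto
      then show ?thesis
        using rad[of "w - s" z] s w z W linear_on_diff[OF B1[OF z(1)] W w] by (auto simp: subspace_diff)
    qed
    then show "l z = 0" using l(2) z by blast
  qed
  then obtain c where c: "\<forall>z\<in>W. l z = (\<Sum>s\<in>S. c s * B s z)" by blast
  have "(\<Sum>s\<in>S. c s *\<^sub>R s) \<in> W"
    using S(2) W by (intro subspace_sum subspace_scale) auto
  moreover have "B (\<Sum>s\<in>S. c s *\<^sub>R s) z = l z" if "z \<in> W" for z
    using linear_on_sum[OF B1[OF that] W S(1), of "\<lambda>s. s" c] S(2) c that by auto
  ultimately show ?thesis by blast
qed

section \<open>Real functions as vectors\<close>

instantiation "fun" :: (type, scaleR) scaleR
begin

definition scaleR_fun_def: "c *\<^sub>R f = (\<lambda>x. c *\<^sub>R f x)"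
instance ..

end

instance "fun" :: (type, real_vector) real_vector
  by standard (simp_all add: scaleR_fun_def fun_eq_iff scaleR_add_right scaleR_add_left)

lemma scaleR_fun_apply [simp]: "(c *\<^sub>R f) x = c *\<^sub>R f x"
  by (simp add: scaleR_fun_def)

text \<open>The two lemmas that follow translate between the pointwise lambda terms of the function spaces and the vector space
operations.\<close>

lemma subspace_lincombI:
  fixes W :: "('a \<Rightarrow> real) set"
  assumes "(\<lambda>x. 0) \<in> W" "\<And>f g a b. f \<in> W \<Longrightarrow> g \<in> W \<Longrightarrow> (\<lambda>x. a * f x + b * g x) \<in> W"
  shows "subspace W"
  unfolding subspace_def
proof (intro conjI ballI allI)
  show "0 \<in> W" using assms(1) by (simp add: zero_fun_def)
  show "f + g \<in> W" if "f \<in> W" "g \<in> W" for f g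
    using assms(2)[OF that, of 1 1] by (simp add: plus_fun_def)
  show "c *\<^sub>R f \<in> W" if "f \<in> W" for c f
    using assms(2)[OF that that, of c 0] by (simp add: scaleR_fun_def)
qed

lemma subspace_lincomb:
  fixes W :: "('a \<Rightarrow> real) set"
  assumes "subspace W" "f \<in> W" "g \<in> W"
  shows "(\<lambda>x. a * f x + b * g x) \<in> W"
proof -
  have "a *\<^sub>R f + b *\<^sub>R g \<in> W" using assms by (intro subspace_add subspace_scale)
  then show ?thesis by (simp add: plus_fun_def)
qed

section \<open>Positive semidefinite bilinear forms\<close>

text \<open>Definiteness is deliberately absent: all inner products below are degenerate on functions that vanish almost
everywhere, and only their Cauchy-Schwarz and triangle inequalities are used.\<close>

definition semi_inner :: "'a::real_vector set \<Rightarrow> ('a \<Rightarrow> 'a \<Rightarrow> real) \<Rightarrow> bool" where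
  "semi_inner W b \<longleftrightarrow> subspace W \<and> (\<forall>y\<in>W. linear_on W (\<lambda>x. b x y)) \<and>
     (\<forall>x\<in>W. \<forall>y\<in>W. b x y = b y x) \<and> (\<forall>x\<in>W. b x x \<ge> 0)"

lemma semi_inner_linear_right:
  assumes "semi_inner W b" "x \<in> W"
  shows "linear_on W (b x)"
proof -
  have l: "linear_on W (\<lambda>y. b y x)" and s: "\<And>y. y \<in> W \<Longrightarrow> b x y = b y x"
    and W: "subspace W" using assms by (auto simp: semi_inner_def)
  show ?thesis using l W unfolding linear_on_def by (auto simp: s subspace_add subspace_scale)
qed

lemma semi_inner_square_expand:
  assumes "semi_inner W b" "x \<in> W" "y \<in> W"
  shows "b (x + c *\<^sub>R y) (x + c *\<^sub>R y) = b x x + 2 * c * b x y + c\<^sup>2 * b y y"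
proof -
  have W: "subspace W" and l: "\<And>y. y \<in> W \<Longrightarrow> linear_on W (\<lambda>x. b x y)"
    and s: "\<And>x y. x \<in> W \<Longrightarrow> y \<in> W \<Longrightarrow> b x y = b y x"
    using assms(1) by (auto simp: semi_inner_def)
  have cy: "c *\<^sub>R y \<in> W" and xy: "x + c *\<^sub>R y \<in> W" using W assms by (auto simp: subspace_add subspace_scale)
  have r: "b z (x + c *\<^sub>R y) = b z x + c * b z y" if "z \<in> W" for z
    using linear_on_add[OF semi_inner_linear_right[OF assms(1) that] assms(2) cy]
      linear_on_scale[OF semi_inner_linear_right[OF assms(1) that] assms(3)] by simp
  have "b (x + c *\<^sub>R y) (x + c *\<^sub>R y) = b x (x + c *\<^sub>R y) + c * b y (x + c *\<^sub>R y)"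
    using linear_on_add[OF l[OF xy] assms(2) cy] linear_on_scale[OF l[OF xy] assms(3)] by simp
  then show ?thesis
    using r assms s[of y x] by (simp add: power2_eq_square algebra_simps)
qed

text \<open>The quadratic polynomial \<open>c \<mapsto> b (x + c y) (x + c y)\<close> is nonnegative. If \<open>b y y = 0\<close> it is affine and must be
constant; otherwise it is evaluated at its minimum.\<close>

lemma semi_inner_Cauchy_Schwarz:
  assumes "semi_inner W b" "x \<in> W" "y \<in> W"
  shows "\<bar>b x y\<bar> \<le> sqrt (b x x) * sqrt (b y y)"
proof -
  have ge: "0 \<le> b x x + 2 * c * b x y + c\<^sup>2 * b y y" for c
    using semi_inner_square_expand[OF assms, of c] assms
    by (metis semi_inner_def subspace_add subspace_scale)
  have nn: "b x x \<ge> 0" "b y y \<ge> 0" using assms by (auto simp: semi_inner_def)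
  have "(b x y)\<^sup>2 \<le> b x x * b y y"
  proof (cases "b y y = 0")
    case True
    have "b x y = 0"
    proof (rule ccontr)
      assume "b x y \<noteq> 0"
      then show False using ge[of "- (b x x + 1) / (2 * b x y)"] True by (simp add: field_simps)
    qed
    then show ?thesis using True by simp
  next
    case False
    then have "0 \<le> (b x x + 2 * (- b x y / b y y) * b x y + (- b x y / b y y)\<^sup>2 * b y y) * b y y"
      using ge[of "- b x y / b y y"] nn(2) by (intro mult_nonneg_nonneg)
    also have "\<dots> = b x x * b y y - (b x y)\<^sup>2"
      using False by (simp add: field_simps power2_eq_square)
    finally show ?thesis by simp
  qed
  then show ?thesis
    by (metis real_sqrt_abs real_sqrt_le_mono real_sqrt_mult)
qed

lemma semi_inner_triangle:
  assumes "semi_inner W b" "x \<in> W" "y \<in> W"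
  shows "sqrt (b (x + y) (x + y)) \<le> sqrt (b x x) + sqrt (b y y)"
proof (rule real_le_lsqrt)
  have nn: "b x x \<ge> 0" "b y y \<ge> 0" using assms by (auto simp: semi_inner_def)
  then show "0 \<le> sqrt (b x x) + sqrt (b y y)" by simp
  have "b (x + y) (x + y) = b x x + 2 * b x y + b y y"
    using semi_inner_square_expand[OF assms, of 1] by simp
  also have "\<dots> \<le> b x x + 2 * (sqrt (b x x) * sqrt (b y y)) + b y y"
    using semi_inner_Cauchy_Schwarz[OF assms] by simp
  also have "\<dots> = (sqrt (b x x) + sqrt (b y y))\<^sup>2"
    using nn by (simp add: power2_sum)
  finally show "b (x + y) (x + y) \<le> (sqrt (b x x) + sqrt (b y y))\<^sup>2" .
qed

lemma semi_inner_add: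
  assumes "semi_inner W b" "semi_inner W c"
  shows "semi_inner W (\<lambda>x y. b x y + c x y)"
  using assms by (auto simp: semi_inner_def linear_on_def algebra_simps)

lemma semi_inner_sum:
  assumes "finite S" "subspace W" "\<And>e. e \<in> S \<Longrightarrow> semi_inner W (b e)"
  shows "semi_inner W (\<lambda>x y. \<Sum>e\<in>S. b e x y)"
  using assms(1,3)
proof (induction S)
  case empty
  then show ?case using assms(2) by (simp add: semi_inner_def linear_on_def)
next
  case (insert e S)
  then show ?case using semi_inner_add[of W "b e" "\<lambda>x y. \<Sum>e\<in>S. b e x y"] by simp
qed

lemma semi_inner_subset: "semi_inner W b \<Longrightarrow> subspace V \<Longrightarrow> V \<subseteq> W \<Longrightarrow> semi_inner V b"
  unfolding semi_inner_def linear_on_def by blast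

lemma semi_inner_pullback:
  assumes b: "semi_inner V b" and W: "subspace W" and c: "0 \<le> (c::real)"
    and T: "\<And>x. x \<in> W \<Longrightarrow> T x \<in> V" "\<And>x y. x \<in> W \<Longrightarrow> y \<in> W \<Longrightarrow> T (x + y) = T x + T y"
      "\<And>r x. x \<in> W \<Longrightarrow> T (r *\<^sub>R x) = r *\<^sub>R T x"
  shows "semi_inner W (\<lambda>x y. c * b (T x) (T y))"
  using b c T W unfolding semi_inner_def linear_on_def by (auto simp: algebra_simps)

lemma semi_inner_norm_scale:
  assumes "semi_inner W b" "x \<in> W"
  shows "sqrt (b (c *\<^sub>R x) (c *\<^sub>R x)) = \<bar>c\<bar> * sqrt (b x x)"
proof -
  have W: "subspace W" and l: "\<And>y. y \<in> W \<Longrightarrow> linear_on W (\<lambda>x. b x y)"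
    using assms(1) by (auto simp: semi_inner_def)
  have "b (c *\<^sub>R x) (c *\<^sub>R x) = c\<^sup>2 * b x x"
    using linear_on_scale[OF l assms(2), of "c *\<^sub>R x" c] linear_on_scale[OF semi_inner_linear_right[OF assms] assms(2), of c]
      subspace_scale[OF W assms(2)] by (simp add: power2_eq_square mult.assoc)
  then show ?thesis by (simp add: real_sqrt_mult)
qed

lemma semi_inner_norm_lincomb:
  assumes "semi_inner W b" "x \<in> W" "y \<in> W"
  shows "sqrt (b (c *\<^sub>R x + d *\<^sub>R y) (c *\<^sub>R x + d *\<^sub>R y)) \<le> \<bar>c\<bar> * sqrt (b x x) + \<bar>d\<bar> * sqrt (b y y)"
proof -
  have W: "subspace W" using assms(1) by (auto simp: semi_inner_def)
  show ?thesis
    using semi_inner_triangle[OF assms(1) subspace_scale[OF W assms(2), of c] subspace_scale[OF W assms(3), of d]]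
      semi_inner_norm_scale[OF assms(1,2), of c] semi_inner_norm_scale[OF assms(1,3), of d] by simp
qed

lemma semi_inner_norm_le_diff:
  assumes "semi_inner W b" "x \<in> W" "y \<in> W"
  shows "sqrt (b x x) \<le> sqrt (b (x - y) (x - y)) + sqrt (b y y)"
proof -
  have "x - y \<in> W" using assms subspace_diff by (auto simp: semi_inner_def)
  then show ?thesis using semi_inner_triangle[OF assms(1) _ assms(3), of "x - y"] by simp
qed

lemma semi_inner_norm_minus:
  assumes "semi_inner W b" "x \<in> W" "y \<in> W"
  shows "sqrt (b (x - y) (x - y)) = sqrt (b (y - x) (y - x))"
proof -
  have "y - x \<in> W" using assms subspace_diff by (auto simp: semi_inner_def)
  then show ?thesis using semi_inner_norm_scale[OF assms(1), of "y - x" "-1"] by simp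
qed

text \<open>Both \<open>H10\<close> and the trace relation are closures with respect to a seminorm. This lemma is the step that makes
such closures linear.\<close>

lemma semi_inner_lincomb_tendsto:
  fixes W :: "('a \<Rightarrow> real) set"
  assumes b: "semi_inner W b" and W: "\<And>n. \<phi> n \<in> W" "\<And>n. \<psi> n \<in> W" "u \<in> W" "v \<in> W"
    and lim: "(\<lambda>n::nat. sqrt (b (\<lambda>x. \<phi> n x - u x) (\<lambda>x. \<phi> n x - u x))) \<longlonglongrightarrow> 0"
      "(\<lambda>n::nat. sqrt (b (\<lambda>x. \<psi> n x - v x) (\<lambda>x. \<psi> n x - v x))) \<longlonglongrightarrow> 0"
  shows "(\<lambda>n. sqrt (b (\<lambda>x. c * \<phi> n x + d * \<psi> n x - (c * u x + d * v x))
                     (\<lambda>x. c * \<phi> n x + d * \<psi> n x - (c * u x + d * v x)))) \<longlonglongrightarrow> 0"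
proof (rule Lim_null_comparison)
  let ?N = "\<lambda>x. sqrt (b x x)"
  have S: "subspace W" using b by (simp add: semi_inner_def)
  show "(\<lambda>n. \<bar>c\<bar> * ?N (\<lambda>x. \<phi> n x - u x) + \<bar>d\<bar> * ?N (\<lambda>x. \<psi> n x - v x)) \<longlonglongrightarrow> 0"
    using tendsto_add[OF tendsto_mult_left[OF lim(1), of "\<bar>c\<bar>"] tendsto_mult_left[OF lim(2), of "\<bar>d\<bar>"]] by simp
  show "\<forall>\<^sub>F n in sequentially. norm (?N (\<lambda>x. c * \<phi> n x + d * \<psi> n x - (c * u x + d * v x)))
      \<le> \<bar>c\<bar> * ?N (\<lambda>x. \<phi> n x - u x) + \<bar>d\<bar> * ?N (\<lambda>x. \<psi> n x - v x)"
  proof (intro always_eventually allI)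
    fix n
    have mem: "\<phi> n - u \<in> W" "\<psi> n - v \<in> W" using W S by (auto intro: subspace_diff)
    have eq: "c *\<^sub>R (\<phi> n - u) + d *\<^sub>R (\<psi> n - v) = (\<lambda>x. c * \<phi> n x + d * \<psi> n x - (c * u x + d * v x))"
      by (auto simp: algebra_simps)
    have "c *\<^sub>R (\<phi> n - u) + d *\<^sub>R (\<psi> n - v) \<in> W"
      using mem S by (intro subspace_add subspace_scale)
    then have nn: "0 \<le> b (c *\<^sub>R (\<phi> n - u) + d *\<^sub>R (\<psi> n - v)) (c *\<^sub>R (\<phi> n - u) + d *\<^sub>R (\<psi> n - v))"
      using b by (simp add: semi_inner_def)
    show "norm (?N (\<lambda>x. c * \<phi> n x + d * \<psi> n x - (c * u x + d * v x)))
        \<le> \<bar>c\<bar> * ?N (\<lambda>x. \<phi> n x - u x) + \<bar>d\<bar> * ?N (\<lambda>x. \<psi> n x - v x)"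
      using semi_inner_norm_lincomb[OF b mem, of c d, unfolded eq, unfolded fun_diff_def] nn[unfolded eq]
      by simp
  qed
qed

section \<open>The algebra of smooth functions\<close>

lemma partial_eqI: "(f has_derivative D) (at x) \<Longrightarrow> partial i f x = D (axis i 1)"
  unfolding partial_def by (metis frechet_derivative_at)

lemma smooth_differentiable: "smooth f \<Longrightarrow> f differentiable (at x)"
  and smooth_partial: "smooth f \<Longrightarrow> smooth (partial i f)"
  by (auto elim: smooth.cases)

lemma smooth_continuous: "smooth f \<Longrightarrow> continuous_on A f"
  by (meson continuous_at_imp_continuous_on differentiable_imp_continuous_within smooth_differentiable)

lemma partial_add:
  assumes "f differentiable (at x)" "g differentiable (at x)"
  shows "partial i (\<lambda>x. f x + g x) x = partial i f x + partial i g x"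
proof -
  have "((\<lambda>x. f x + g x) has_derivative (\<lambda>h. frechet_derivative f (at x) h + frechet_derivative g (at x) h)) (at x)"
    using assms by (intro has_derivative_add) (auto simp: frechet_derivative_works[symmetric])
  from partial_eqI[OF this] show ?thesis by (simp add: partial_def)
qed

lemma partial_mult:
  assumes "f differentiable (at x)" "g differentiable (at x)"
  shows "partial i (\<lambda>x. f x * g x) x = f x * partial i g x + partial i f x * g x"
proof -
  have "((\<lambda>x. f x * g x) has_derivative
      (\<lambda>h. f x * frechet_derivative g (at x) h + frechet_derivative f (at x) h * g x)) (at x)"
    using assms by (intro has_derivative_mult) (auto simp: frechet_derivative_works[symmetric])
  from partial_eqI[OF this] show ?thesis by (simp add: partial_def)
qed

text \<open>Products of smooth functions are not directly amenable to coinduction, since differentiation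
turns a product into a sum of products. The closure of the smooth functions under sums and products is stable
under differentiation, and so it is contained in the largest such class.\<close>

inductive smooth_closure :: "(plane \<Rightarrow> real) \<Rightarrow> bool" where
  base: "smooth f \<Longrightarrow> smooth_closure f"
| add: "smooth_closure f \<Longrightarrow> smooth_closure g \<Longrightarrow> smooth_closure (\<lambda>x. f x + g x)"
| mult: "smooth_closure f \<Longrightarrow> smooth_closure g \<Longrightarrow> smooth_closure (\<lambda>x. f x * g x)"

lemma smooth_closure_closed:
  assumes "smooth_closure f"
  shows "(\<forall>x. f differentiable (at x)) \<and> (\<forall>i. smooth_closure (partial i f))"
  using assms
proof induction
  case (base f)
  then show ?case by (auto intro: smooth_differentiable smooth_partial smooth_closure.base)
next
  case (add f g)
  then have "partial i (\<lambda>x. f x + g x) = (\<lambda>x. partial i f x + partial i g x)" for i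
    by (auto simp: partial_add)
  then show ?case using add by (auto intro: smooth_closure.add)
next
  case (mult f g)
  then have "partial i (\<lambda>x. f x * g x) = (\<lambda>x. f x * partial i g x + partial i f x * g x)" for i
    by (auto simp: partial_mult)
  then show ?case using mult by (auto intro!: smooth_closure.add intro: smooth_closure.mult)
qed

lemma smooth_closure_imp_smooth: "smooth_closure f \<Longrightarrow> smooth f"
  by (coinduction arbitrary: f rule: smooth.coinduct) (use smooth_closure_closed in blast)

lemma smooth_add: "smooth f \<Longrightarrow> smooth g \<Longrightarrow> smooth (\<lambda>x. f x + g x)"
  and smooth_mult: "smooth f \<Longrightarrow> smooth g \<Longrightarrow> smooth (\<lambda>x. f x * g x)"
  by (auto intro!: smooth_closure_imp_smooth smooth_closure.add smooth_closure.mult intro: smooth_closure.base)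

lemma partial_const: "partial i (\<lambda>x. c) = (\<lambda>x. 0)"
  by (auto intro!: partial_eqI[where D = "\<lambda>h. 0", THEN trans] derivative_eq_intros)

text \<open>The constants form a class closed under differentiation, so coinduction applies.\<close>

lemma smooth_const: "smooth (\<lambda>x. c)"
proof -
  have "\<exists>c. (\<lambda>x. c) = (\<lambda>x::plane. c::real)" for c by blast
  then have "\<exists>d. (\<lambda>x::plane. c) = (\<lambda>x. d)" by blast
  then show ?thesis
    by (coinduction arbitrary: c rule: smooth.coinduct) (auto simp: partial_const)
qed

lemma partial_coord: "partial i (\<lambda>x. x $ j) = (\<lambda>x. axis i 1 $ j)"
proof
  fix x :: plane
  have "((\<lambda>x. x $ j) has_derivative (\<lambda>h. h $ j)) (at x)"
    by (rule bounded_linear_imp_has_derivative) (rule bounded_linear_vec_nth)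
  then show "partial i (\<lambda>x. x $ j) x = axis i 1 $ j" by (rule partial_eqI)
qed

lemma smooth_coord: "smooth (\<lambda>x. x $ j)"
proof (rule smooth.intros)
  show "(\<lambda>x. x $ j) differentiable (at x)" for x :: plane
    by (rule bounded_linear_imp_differentiable) (rule bounded_linear_vec_nth)
qed (simp add: partial_coord smooth_const)

lemma smooth_scale: "smooth f \<Longrightarrow> smooth (\<lambda>x. c * f x)"
  by (intro smooth_mult smooth_const)

section \<open>Smooth bumps\<close>

text \<open>For \<open>p = 1\<close> this is the classical flat function \<open>exp (- 1 / t)\<close>, extended by zero. The polynomial factor
makes the family closed under differentiation.\<close>

definition flat_exp :: "real poly \<Rightarrow> real \<Rightarrow> real" where
  "flat_exp p t = (if t > 0 then poly p (1 / t) * exp (- (1 / t)) else 0)"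

lemma poly_over_exp_tendsto_0: "((\<lambda>s. poly p s / exp s) \<longlongrightarrow> (0::real)) at_top"
proof -
  have "((\<lambda>s. \<Sum>i\<le>degree p. coeff p i * (s ^ i / exp s)) \<longlongrightarrow> (\<Sum>i\<le>degree p. coeff p i * 0)) at_top"
    by (intro tendsto_sum tendsto_mult tendsto_const tendsto_power_div_exp_0)
  then show ?thesis by (simp add: poly_altdef sum_divide_distrib)
qed

text \<open>For \<open>t > 0\<close> the chain rule gives \<open>1 / t\<^sup>2 * (p - p') (1 / t) exp (- 1 / t)\<close>. At \<open>0\<close> the difference quotient is a
polynomial in \<open>1 / t\<close> times \<open>exp (- 1 / t)\<close>, which tends to zero.\<close>

lemma flat_exp_has_derivative:
  "(flat_exp p has_real_derivative flat_exp ([:0, 0, 1:] * (p - pderiv p)) t) (at t)"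
proof -
  consider "t > 0" | "t < 0" | "t = 0" by linarith
  then show ?thesis
  proof cases
    case 1
    have "((\<lambda>t. poly p (1 / t) * exp (- (1 / t))) has_real_derivative
        flat_exp ([:0, 0, 1:] * (p - pderiv p)) t) (at t)"
      using 1 by (auto intro!: derivative_eq_intros simp: flat_exp_def field_simps power2_eq_square)
    then show ?thesis
      by (rule has_field_derivative_transform_within_open[of _ _ _ "{0<..}"]) (use 1 in \<open>auto simp: flat_exp_def\<close>)
  next
    case 2
    have "((\<lambda>t. 0) has_real_derivative flat_exp ([:0, 0, 1:] * (p - pderiv p)) t) (at t)"
      using 2 by (auto simp: flat_exp_def)
    then show ?thesis
      by (rule has_field_derivative_transform_within_open[of _ _ _ "{..<0}"]) (use 2 in \<open>auto simp: flat_exp_def\<close>)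
  next
    case 3
    have "((\<lambda>h. poly (pCons 0 p) (inverse h) / exp (inverse h)) \<longlongrightarrow> 0) (at_right (0::real))"
      by (rule filterlim_compose[OF poly_over_exp_tendsto_0 filterlim_inverse_at_top_right])
    then have "((\<lambda>h. flat_exp p h / h) \<longlongrightarrow> 0) (at_right 0)"
      by (rule Lim_transform_eventually)
        (auto simp: eventually_at_right_field flat_exp_def exp_minus divide_simps intro!: exI[of _ 1])
    moreover have "((\<lambda>h. flat_exp p h / h) \<longlongrightarrow> 0) (at_left 0)"
      by (rule Lim_transform_eventually[OF tendsto_const])
        (auto simp: eventually_at_left_field flat_exp_def intro!: exI[of _ "-1"])
    ultimately have "((\<lambda>h. flat_exp p h / h) \<longlongrightarrow> 0) (at 0)"
      by (simp add: filterlim_at_split)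
    then show ?thesis using 3 by (simp add: has_field_derivative_iff flat_exp_def)
  qed
qed

lemma smooth_flat: "smooth (\<lambda>x. flat_exp p (s * x $ j + d))"
proof -
  have D: "((\<lambda>x::plane. k * flat_exp p (s * x $ j + d)) has_derivative
      (\<lambda>h. k * (flat_exp ([:0, 0, 1:] * (p - pderiv p)) (s * x $ j + d) * (s * h $ j)))) (at x)" for k p x
  proof -
    have "((\<lambda>x::plane. s * x $ j + d) has_derivative (\<lambda>h. s * h $ j)) (at x)"
      by (auto intro!: derivative_eq_intros bounded_linear_imp_has_derivative bounded_linear_vec_nth)
    from has_derivative_compose[OF this
        flat_exp_has_derivative[of p "s * x $ j + d", unfolded has_field_derivative_def]]
    show ?thesis by (intro has_derivative_mult_right) simp
  qed
  have "\<exists>k q. (\<lambda>x::plane. flat_exp p (s * x $ j + d)) = (\<lambda>x. k * flat_exp q (s * x $ j + d))"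
    by (rule exI[of _ 1]) auto
  then show ?thesis
  proof (rule smooth.coinduct[of "\<lambda>f. \<exists>k q. f = (\<lambda>x. k * flat_exp q (s * x $ j + d))"])
    fix f :: "plane \<Rightarrow> real" assume "\<exists>k q. f = (\<lambda>x. k * flat_exp q (s * x $ j + d))"
    then obtain k q where f: "f = (\<lambda>x. k * flat_exp q (s * x $ j + d))" by blast
    have "f differentiable (at x)" for x unfolding f differentiable_def using D by blast
    moreover have "partial i f = (\<lambda>x. (k * s * axis i 1 $ j) * flat_exp ([:0, 0, 1:] * (q - pderiv q)) (s * x $ j + d))" for i
      unfolding f by (rule ext, subst partial_eqI[OF D]) simp
    ultimately show "\<exists>\<phi>. f = \<phi> \<and> (\<forall>x. \<phi> differentiable at x) \<and>
      (\<forall>i. (\<exists>k q. partial i \<phi> = (\<lambda>x. k * flat_exp q (s * x $ j + d))) \<or> smooth (partial i \<phi>))"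
      by (intro exI[of _ f]) blast
  qed
qed

text \<open>The nonzero set is the open box with corners \<open>a\<close>, \<open>b\<close>. The factor \<open>Suc n\<close> steepens the profile: since
\<open>exp (- 1 / (n t))\<close> tends to one for \<open>t > 0\<close>, the bumps tend to the indicator function of the box.\<close>

definition bump :: "plane \<Rightarrow> plane \<Rightarrow> nat \<Rightarrow> plane \<Rightarrow> real" where
  "bump a b n x =
     flat_exp 1 (Suc n * (x $ 1 - a $ 1)) * flat_exp 1 (Suc n * (b $ 1 - x $ 1)) *
     (flat_exp 1 (Suc n * (x $ 2 - a $ 2)) * flat_exp 1 (Suc n * (b $ 2 - x $ 2)))"

lemma flat_exp_1_range: "0 \<le> flat_exp 1 t" "flat_exp 1 t \<le> 1"
  by (auto simp: flat_exp_def)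

lemma flat_exp_1_eq_0_iff: "flat_exp 1 t = 0 \<longleftrightarrow> t \<le> 0"
  by (auto simp: flat_exp_def)

lemma bump_range: "0 \<le> bump a b n x" "bump a b n x \<le> 1"
  unfolding bump_def by (auto intro!: mult_nonneg_nonneg mult_le_one flat_exp_1_range)

lemma bump_nonzero_iff: "bump a b n x \<noteq> 0 \<longleftrightarrow> x \<in> box a b"
proof -
  have *: "real (Suc n) * t \<le> 0 \<longleftrightarrow> t \<le> 0" for t by (simp add: mult_le_0_iff)
  show ?thesis unfolding bump_def mem_box_cart forall_2 mult_eq_0_iff flat_exp_1_eq_0_iff *
    by auto
qed

lemma smooth_bump: "smooth (bump a b n)"
proof -
  have "smooth (\<lambda>x. flat_exp 1 (Suc n * (x $ j - c)))" "smooth (\<lambda>x. flat_exp 1 (Suc n * (c - x $ j)))" for j :: 2 and c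
    using smooth_flat[of 1 "real (Suc n)" j "- real (Suc n) * c"]
      smooth_flat[of 1 "- real (Suc n)" j "real (Suc n) * c"]
    by (simp_all only: right_diff_distrib) (simp_all add: algebra_simps)
  then show ?thesis unfolding bump_def[abs_def] by (intro smooth_mult)
qed

lemma flat_exp_1_tendsto: "(\<lambda>n. flat_exp 1 (real (Suc n) * t)) \<longlonglongrightarrow> (if t > 0 then 1 else 0)"
proof (cases "t > 0")
  case True
  have "(\<lambda>n. exp (- (1 / t * inverse (real (Suc n))))) \<longlonglongrightarrow> exp (- (1 / t * 0))"
    by (intro tendsto_intros LIMSEQ_inverse_real_of_nat)
  then show ?thesis using True by (simp add: flat_exp_def divide_inverse mult.commute)
next
  case False
  then have "flat_exp 1 (real (Suc n) * t) = 0" for n by (simp add: flat_exp_1_eq_0_iff mult_le_0_iff)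
  then show ?thesis using False by simp
qed

lemma bump_tendsto_indicator: "(\<lambda>n. bump a b n x) \<longlonglongrightarrow> indicator (box a b) x"
proof -
  have "(\<lambda>n. bump a b n x) \<longlonglongrightarrow>
      (if x $ 1 - a $ 1 > 0 then 1 else 0) * (if b $ 1 - x $ 1 > 0 then 1 else 0) *
      ((if x $ 2 - a $ 2 > 0 then 1 else 0) * (if b $ 2 - x $ 2 > 0 then 1 else 0))"
    unfolding bump_def by (intro tendsto_mult flat_exp_1_tendsto)
  moreover have "(if x $ 1 - a $ 1 > 0 then 1 else 0) * (if b $ 1 - x $ 1 > 0 then 1 else 0) *
      ((if x $ 2 - a $ 2 > 0 then 1 else 0) * (if b $ 2 - x $ 2 > 0 then 1 else 0)) =
      (indicator (box a b) x :: real)"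
    by (auto simp: indicator_def mem_box_cart forall_2)
  ultimately show ?thesis by simp
qed

lemma bump_test_function: "cbox a b \<subseteq> U \<Longrightarrow> bump a b n \<in> test_functions U"
proof -
  assume U: "cbox a b \<subseteq> U"
  have "{x. bump a b n x \<noteq> 0} = box a b" by (auto simp: bump_nonzero_iff)
  moreover have "closure (box a b) \<subseteq> cbox a b"
    by (rule closure_minimal) (auto simp: box_subset_cbox)
  ultimately show ?thesis using U smooth_bump
    by (auto simp: test_functions_def bounded_box)
qed

section \<open>The fundamental lemma of the calculus of variations\<close>

lemma test_functionsD:
  assumes "\<phi> \<in> test_functions U"
  shows "smooth \<phi>" "compact (closure {x. \<phi> x \<noteq> 0})" "closure {x. \<phi> x \<noteq> 0} \<subseteq> U"
  using assms by (auto simp: test_functions_def)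

lemma test_functionsI:
  assumes "smooth \<psi>" "\<And>x. x \<notin> K \<Longrightarrow> \<psi> x = 0" "compact K" "K \<subseteq> U"
  shows "\<psi> \<in> test_functions U"
proof -
  have sub: "closure {x. \<psi> x \<noteq> 0} \<subseteq> K"
    using assms(2,3) by (intro closure_minimal) (auto intro: compact_imp_closed)
  then have "compact (closure {x. \<psi> x \<noteq> 0})"
    using assms(3) compact_Int_closed[of K "closure {x. \<psi> x \<noteq> 0}"] by (simp add: Int_absorb1)
  then show ?thesis using sub assms(1,4) by (auto simp: test_functions_def)
qed

lemma test_functions_support:
  assumes "\<phi> \<in> test_functions U"
  shows "\<exists>K. compact K \<and> K \<subseteq> U \<and> (\<forall>x. x \<notin> K \<longrightarrow> \<phi> x = 0)"
  using test_functionsD[OF assms] closure_subset[of "{x. \<phi> x \<noteq> 0}"]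
  by (intro exI[of _ "closure {x. \<phi> x \<noteq> 0}"]) auto

lemma test_functions_zero_outside: "\<phi> \<in> test_functions U \<Longrightarrow> x \<notin> U \<Longrightarrow> \<phi> x = 0"
  using test_functions_support[of \<phi> U] by auto

text \<open>The boxes whose closure lies in \<open>U\<close> are those that carry a bump supported in \<open>U\<close>. They generate the Borel sets of
\<open>U\<close> because every open subset is a countable union of them, by the Lindelof property.\<close>

lemma sets_restrict_borel_eq_boxes:
  fixes U :: "plane set"
  assumes "open U"
  shows "sets (restrict_space borel U) = sigma_sets U {box a b |a b. cbox a b \<subseteq> U}"
    and "\<exists>F. countable F \<and> F \<subseteq> {box a b |a b. cbox a b \<subseteq> U} \<and> \<Union>F = U"
proof -
  let ?E = "{box a b |a b. cbox a b \<subseteq> U}"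
  have E: "?E \<subseteq> Pow U" using box_subset_cbox by fastforce
  have cover: "\<exists>F. countable F \<and> F \<subseteq> ?E \<and> \<Union>F = V" if V: "open V" "V \<subseteq> U" for V
  proof -
    let ?F = "{box a b |a b. cbox a b \<subseteq> V}"
    have "x \<in> \<Union>?F" if "x \<in> V" for x
    proof -
      obtain e where e: "e > 0" "cball x e \<subseteq> V"
        using V(1) \<open>x \<in> V\<close> open_contains_cball by blast
      obtain a b where ab: "x \<in> box a b" "box a b \<subseteq> ball x e"
        using rational_boxes[OF e(1)] by blast
      then have "cbox a b = closure (box a b)" by (subst closure_box) auto
      also have "\<dots> \<subseteq> cball x e" using ab(2) by (intro closure_minimal) auto
      finally show ?thesis using ab(1) e(2) by blast
    qed
    then have "\<Union>?F = V" using box_subset_cbox by fastforce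
    moreover obtain F where "F \<subseteq> ?F" "countable F" "\<Union>F = \<Union>?F"
      using Lindelof[of ?F] by (auto simp: open_box)
    moreover have "?F \<subseteq> ?E" using V(2) by blast
    ultimately have "countable F \<and> F \<subseteq> ?E \<and> \<Union>F = V" by simp
    then show ?thesis ..
  qed
  show "\<exists>F. countable F \<and> F \<subseteq> ?E \<and> \<Union>F = U" using cover assms by blast
  let ?S = "sigma U ?E"
  have sp: "space ?S = U" "sets ?S = sigma_sets U ?E" using E by (auto simp: sets_measure_of space_measure_of)
  have id: "(\<lambda>x. x) \<in> measurable ?S (restrict_space borel U)"
  proof (rule measurable_restrict_space2)
    show "(\<lambda>x. x) \<in> space ?S \<rightarrow> U" using sp by auto
    show "(\<lambda>x. x) \<in> borel_measurable ?S"
    proof (rule borel_measurableI)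
      fix S :: "plane set" assume "open S"
      then obtain F where F: "countable F" "F \<subseteq> ?E" "\<Union>F = S \<inter> U"
        using cover[of "S \<inter> U"] assms by blast
      have "\<Union>F \<in> sigma_sets U ?E"
        using F(1,2) sp(2) by (metis (no_types, lifting) sets.countable_Union sigma_sets.Basic subset_iff)
      then show "(\<lambda>x. x) -` S \<inter> space ?S \<in> sets ?S" using F sp by simp
    qed
  qed
  have "A \<in> sigma_sets U ?E" if "A \<in> sets (restrict_space borel U)" for A
  proof -
    have "A \<subseteq> U" using sets.sets_into_space[OF that] by (simp add: space_restrict_space)
    then have "(\<lambda>x. x) -` A \<inter> space ?S = A" using sp by auto
    then show ?thesis using measurable_sets[OF id that] sp by simp
  qed
  moreover have "?E \<subseteq> sets (restrict_space borel U)"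
    using assms box_subset_cbox by (fastforce simp: sets_restrict_space_iff)
  then have "sigma_sets U ?E \<subseteq> sets (restrict_space borel U)"
    using sets.sigma_sets_subset[of ?E "restrict_space borel U"] by (simp add: space_restrict_space)
  ultimately show "sets (restrict_space borel U) = sigma_sets U ?E" by blast
qed

lemma Int_stable_boxes: "Int_stable {box a b |a b :: plane. cbox a b \<subseteq> U}"
proof (rule Int_stableI, clarify)
  fix a b c d :: plane assume "cbox a b \<subseteq> U" "cbox c d \<subseteq> U"
  moreover define p q where "p = (\<chi> i. max (a $ i) (c $ i))" and "q = (\<chi> i. min (b $ i) (d $ i))"
  then have "box a b \<inter> box c d = box p q" "cbox p q \<subseteq> cbox a b"
    by (auto simp: mem_box_cart)
  ultimately show "\<exists>p q. box a b \<inter> box c d = box p q \<and> cbox p q \<subseteq> U" by blast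
qed

text \<open>Rewrites a vanishing integral over a set as the agreement there of two finite measures, whose densities are the
positive and the negative part; measures can be compared on a generator of the sigma-algebra.\<close>

lemma set_integral_eq_0_iff_parts:
  fixes f :: "'a \<Rightarrow> real"
  assumes f: "integrable M f" and A: "A \<in> sets M"
  shows "(LINT x:A|M. f x) = 0 \<longleftrightarrow>
    (\<integral>\<^sup>+x. ennreal (f x) * indicator A x \<partial>M) = (\<integral>\<^sup>+x. ennreal (- f x) * indicator A x \<partial>M)"
proof -
  let ?g = "\<lambda>x. indicator A x *\<^sub>R f x"
  have g: "integrable M ?g" using f A by (rule integrable_mult_indicator[rotated])
  have fin: "(\<integral>\<^sup>+x. ennreal (?g x) \<partial>M) < \<infinity>" "(\<integral>\<^sup>+x. ennreal (- ?g x) \<partial>M) < \<infinity>"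
    using g real_integrable_def[of M ?g] by (auto simp: less_top)
  have eq: "(\<integral>\<^sup>+x. ennreal (?g x) \<partial>M) = (\<integral>\<^sup>+x. ennreal (f x) * indicator A x \<partial>M)"
    "(\<integral>\<^sup>+x. ennreal (- ?g x) \<partial>M) = (\<integral>\<^sup>+x. ennreal (- f x) * indicator A x \<partial>M)"
    by (auto intro!: nn_integral_cong simp: indicator_def)
  have "(LINT x:A|M. f x) = enn2real (\<integral>\<^sup>+x. ennreal (?g x) \<partial>M) - enn2real (\<integral>\<^sup>+x. ennreal (- ?g x) \<partial>M)"
    unfolding set_lebesgue_integral_def by (rule real_lebesgue_integral_def[OF g])
  moreover have "enn2real p = enn2real q \<longleftrightarrow> p = q" if "p < \<infinity>" "q < \<infinity>" for p q
    using that by (metis ennreal_enn2real infinity_ennreal_def)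
  ultimately show ?thesis using fin unfolding eq by simp
qed

text \<open>Bumps converge boundedly to indicators of boxes, so \<open>f\<close> has integral zero over every box whose closure lies
in \<open>U\<close>. These boxes form an intersection-stable generator, hence the measures with densities \<open>max f 0\<close> and \<open>max (- f) 0\<close>
coincide, and \<open>f\<close> vanishes almost everywhere.

The measure lives on its own space, a subset of \<open>U\<close> with the trace of the Borel sets. This covers both
Lebesgue measure on \<open>U\<close> and arc length on a union of segments, with \<open>U\<close> the whole plane.\<close>

lemma integral_test_functions_zero_imp_AE_zero:
  fixes M :: "plane measure" and f :: "plane \<Rightarrow> real"
  assumes U: "open U" "space M \<subseteq> U" and M: "sets M = sets (restrict_space borel (space M))"
    and f: "integrable M f" and zero: "\<And>\<phi>. \<phi> \<in> test_functions U \<Longrightarrow> (LINT x|M. f x * \<phi> x) = 0"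
  shows "AE x in M. f x = 0"
proof (rule density_unique_real[OF f integrable_zero])
  have [measurable]: "f \<in> borel_measurable M" using f by blast
  have id[measurable]: "(\<lambda>x. x) \<in> borel_measurable M"
    by (subst measurable_cong_sets[OF M refl]) (rule measurable_restrict_space1, simp)
  have idU: "(\<lambda>x. x) \<in> measurable M (restrict_space borel U)"
    using U(2) by (intro measurable_restrict_space2) auto
  have setsI: "A \<inter> space M \<in> sets M" if "A \<in> sets borel" for A
    using measurable_sets[OF id that] by (simp add: vimage_def Int_commute)
  have box0: "(LINT x:box a b \<inter> space M|M. f x) = 0" if ab: "cbox a b \<subseteq> U" for a b
  proof -
    have "(\<lambda>n. LINT x|M. f x * bump a b n x) \<longlonglongrightarrow> (LINT x|M. f x * indicator (box a b) x)"
    proof (rule integral_dominated_convergence[where w = "\<lambda>x. \<bar>f x\<bar>"])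
      have "bump a b n \<in> borel_measurable borel" for n
        by (intro borel_measurable_continuous_onI smooth_continuous smooth_bump)
      then have [measurable]: "bump a b n \<in> borel_measurable M" for n
        using id by (rule measurable_compose[rotated])
      show "(\<lambda>x. f x * bump a b n x) \<in> borel_measurable M" for n by measurable
      show "(\<lambda>x. f x * indicator (box a b) x) \<in> borel_measurable M"
        by (intro borel_measurable_times borel_measurable_indicator' ) (use setsI[of "box a b"] in \<open>auto simp: Int_def\<close>)
      show "integrable M (\<lambda>x. \<bar>f x\<bar>)" using f by simp
      show "AE x in M. (\<lambda>n. f x * bump a b n x) \<longlonglongrightarrow> f x * indicator (box a b) x"
        by (intro AE_I2 tendsto_mult tendsto_const bump_tendsto_indicator)
      show "AE x in M. norm (f x * bump a b n x) \<le> \<bar>f x\<bar>" for n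
        using bump_range[of a b n] by (auto simp: abs_mult intro!: mult_left_le)
    qed
    then have "(LINT x|M. f x * indicator (box a b) x) = 0"
      using zero bump_test_function[OF ab] by (simp add: LIMSEQ_const_iff)
    moreover have "(LINT x:box a b \<inter> space M|M. f x) = (LINT x|M. f x * indicator (box a b) x)"
      unfolding set_lebesgue_integral_def by (rule Bochner_Integration.integral_cong) (auto simp: indicator_def)
    ultimately show ?thesis by simp
  qed
  \<comment> \<open>The factor \<open>s\<close> is \<open>1\<close> or \<open>-1\<close>; \<^const>\<open>ennreal\<close> truncates, so \<open>P s\<close> has the positive or the negative part as density.\<close>
  define P where "P s = distr (density M (\<lambda>x. ennreal (s * f x))) (restrict_space borel U) (\<lambda>x. x)" for s
  have idP: "(\<lambda>x. x) \<in> measurable (density M (\<lambda>x. ennreal (s * f x))) (restrict_space borel U)" for s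
    using idU by (simp add: measurable_density_eq1)
  have P: "emeasure (P s) A = (\<integral>\<^sup>+x. ennreal (s * f x) * indicator (A \<inter> space M) x \<partial>M)"
    if A: "A \<in> sets borel" "A \<subseteq> U" for s A
  proof -
    have "A \<in> sets (restrict_space borel U)" using A U(1) by (simp add: sets_restrict_space_iff)
    then show ?thesis unfolding P_def using setsI[OF A(1)]
      by (subst emeasure_distr[OF idP]) (auto simp: emeasure_density vimage_def)
  qed
  have "P 1 = P (-1)"
  proof -
    let ?E = "{box a b |a b. cbox a b \<subseteq> U}"
    obtain F where F: "countable F" "F \<subseteq> ?E" "\<Union>F = U"
      using sets_restrict_borel_eq_boxes(2)[OF U(1)] by blast
    have "box 0 (-1 :: plane) = {}" "cbox 0 (-1 :: plane) = {}"
      by (simp_all add: interval_eq_empty_cart)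
    \<comment> \<open>The empty box makes the enumeration of the countable cover well defined.\<close>
    then have e: "{} \<in> ?E" by (metis (mono_tags, lifting) empty_subsetI mem_Collect_eq)
    define A where "A = from_nat_into (insert {} F)"
    have rA: "range A = insert {} F"
      unfolding A_def using F(1) by (intro range_from_nat_into) auto
    show ?thesis
    proof (rule measure_eqI_generator_eq[where \<Omega> = U and E = ?E and A = A])
      show "?E \<subseteq> Pow U" using box_subset_cbox by fastforce
      show "sets (P 1) = sigma_sets U ?E" "sets (P (- 1)) = sigma_sets U ?E"
        using sets_restrict_borel_eq_boxes(1)[OF U(1)] by (simp_all add: P_def)
      show "range A \<subseteq> ?E" using rA F e by simp
      show "(\<Union>i. A i) = U" using rA F by simp
      show "emeasure (P 1) X = emeasure (P (-1)) X" if X: "X \<in> ?E" for X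
      proof -
        obtain a b where ab: "X = box a b" "cbox a b \<subseteq> U" using X by blast
        then have "X \<subseteq> U" "X \<in> sets borel" using box_subset_cbox by auto
        then show ?thesis
          using box0[OF ab(2)] set_integral_eq_0_iff_parts[OF f setsI[of X]] ab(1) by (simp add: P)
      qed
      show "emeasure (P 1) (A i) \<noteq> \<infinity>" for i
      proof -
        have "A i \<in> ?E" using \<open>range A \<subseteq> ?E\<close> by blast
        then have "A i \<subseteq> U" "A i \<in> sets borel" using box_subset_cbox by fastforce+
        then have "emeasure (P 1) (A i) \<le> (\<integral>\<^sup>+x. ennreal (f x) \<partial>M)"
          by (auto simp: P indicator_def intro!: nn_integral_mono)
        then show ?thesis using f real_integrable_def[of M f] by (metis infinity_ennreal_def top.extremum_unique)
      qed
    qed (rule Int_stable_boxes)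
  qed
  fix A assume A: "A \<in> sets M"
  then obtain B where B: "B \<in> sets borel" "A = B \<inter> space M"
    unfolding M by (auto simp: sets_restrict_space)
  have "B \<inter> U \<in> sets borel" "B \<inter> U \<inter> space M = A" using B U by auto
  then have "(\<integral>\<^sup>+x. ennreal (f x) * indicator A x \<partial>M) = (\<integral>\<^sup>+x. ennreal (- f x) * indicator A x \<partial>M)"
    using P[of "B \<inter> U" 1] P[of "B \<inter> U" "-1"] \<open>P 1 = P (-1)\<close> by simp
  then show "(LINT x:A|M. f x) = (LINT x:A|M. 0)"
    using set_integral_eq_0_iff_parts[OF f A] by (simp add: set_lebesgue_integral_def)
qed

section \<open>Partial derivatives of test functions integrate to zero\<close>

lemma test_functions_partial:
  assumes "\<phi> \<in> test_functions U"
  shows "partial i \<phi> \<in> test_functions U"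
proof -
  obtain K where K: "compact K" "K \<subseteq> U" "\<And>x. x \<notin> K \<Longrightarrow> \<phi> x = 0"
    using test_functions_support[OF assms] by auto
  have "partial i \<phi> x = 0" if x: "x \<notin> K" for x
  proof -
    have "(\<phi> has_derivative (\<lambda>h. 0)) (at x)"
      by (rule has_derivative_transform_within_open[of "\<lambda>x. 0" _ _ _ "- K"])
        (use x K(3) compact_imp_closed[OF K(1)] in auto)
    then show ?thesis by (rule partial_eqI)
  qed
  then show ?thesis
    using K test_functionsD(1)[OF assms] by (intro test_functionsI[of _ K] smooth_partial)
qed

lemma test_functions_mult:
  assumes "\<phi> \<in> test_functions U" "smooth f"
  shows "(\<lambda>x. f x * \<phi> x) \<in> test_functions U"
proof -
  obtain K where K: "compact K" "K \<subseteq> U" "\<And>x. x \<notin> K \<Longrightarrow> \<phi> x = 0"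
    using test_functions_support[OF assms(1)] by auto
  then show ?thesis
    using test_functionsD(1)[OF assms(1)] assms(2) by (intro test_functionsI[of _ K] smooth_mult) auto
qed

lemma test_functions_add:
  assumes "\<phi> \<in> test_functions U" "\<psi> \<in> test_functions U"
  shows "(\<lambda>x. \<phi> x + \<psi> x) \<in> test_functions U"
proof -
  obtain K where K: "compact K" "K \<subseteq> U" "\<And>x. x \<notin> K \<Longrightarrow> \<phi> x = 0"
    using test_functions_support[OF assms(1)] by auto
  obtain L where L: "compact L" "L \<subseteq> U" "\<And>x. x \<notin> L \<Longrightarrow> \<psi> x = 0"
    using test_functions_support[OF assms(2)] by auto
  show ?thesis using K L test_functionsD(1)[OF assms(1)] test_functionsD(1)[OF assms(2)]
    by (intro test_functionsI[of _ "K \<union> L"] smooth_add) auto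
qed

lemma test_functions_bounded:
  assumes "\<phi> \<in> test_functions U"
  shows "\<exists>B. \<forall>x. \<bar>\<phi> x\<bar> \<le> B"
proof -
  obtain K where K: "compact K" "K \<subseteq> U" "\<And>x. x \<notin> K \<Longrightarrow> \<phi> x = 0"
    using test_functions_support[OF assms] by auto
  have "compact (\<phi> ` K)"
    using K(1) test_functionsD(1)[OF assms] by (intro compact_continuous_image smooth_continuous)
  then obtain B where B: "\<And>x. x \<in> K \<Longrightarrow> norm (\<phi> x) \<le> B"
    using compact_imp_bounded[of "\<phi> ` K"] unfolding bounded_iff by auto
  have "\<bar>\<phi> x\<bar> \<le> max B 0" for x
    using B[of x] K(3)[of x] by (cases "x \<in> K") auto
  then show ?thesis by blast
qed

lemma smooth_borel_measurable: "smooth f \<Longrightarrow> f \<in> borel_measurable borel"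
  by (intro borel_measurable_continuous_onI smooth_continuous)

lemma test_functions_integrable:
  assumes "\<phi> \<in> test_functions U"
  shows "integrable lborel \<phi>"
proof -
  obtain K where K: "compact K" "K \<subseteq> U" "\<And>x. x \<notin> K \<Longrightarrow> \<phi> x = 0"
    using test_functions_support[OF assms] by auto
  have "integrable lborel (\<lambda>x. indicator K x *\<^sub>R \<phi> x)"
    using K(1) test_functionsD(1)[OF assms] by (intro borel_integrable_compact smooth_continuous)
  moreover have "(\<lambda>x. indicator K x *\<^sub>R \<phi> x) = \<phi>"
    using K(3) by (intro ext) (auto simp: indicator_def)
  ultimately show ?thesis by simp
qed

lemma lborel_integral_translate:
  fixes f :: "'a::euclidean_space \<Rightarrow> real"
  assumes "f \<in> borel_measurable borel"
  shows "(LINT x|lborel. f (c + x)) = (LINT x|lborel. f x)"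
  using integral_distr[of "(+) c" lborel borel f] assms lborel_distr_plus[of c] by simp

lemma lborel_integrable_translate:
  fixes f :: "'a::euclidean_space \<Rightarrow> real"
  assumes "integrable lborel f"
  shows "integrable lborel (\<lambda>x. f (c + x))"
  using integrable_distr_eq[of "(+) c" lborel borel f] assms lborel_distr_plus[of c] by simp

text \<open>Prepares the dominated convergence argument for the integral of a partial derivative: a uniform bound by the
mean value theorem, and the pointwise limit.\<close>

lemma difference_quotient_partial:
  assumes "smooth \<phi>" "\<And>x. \<bar>partial i \<phi> x\<bar> \<le> B" "h > 0"
  shows "\<bar>(\<phi> (h *\<^sub>R axis i 1 + x) - \<phi> x) / h\<bar> \<le> B"
    and "((\<lambda>h. (\<phi> (h *\<^sub>R axis i 1 + x) - \<phi> x) / h) \<longlongrightarrow> partial i \<phi> x) (at 0)"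
proof -
  let ?g = "\<lambda>t. \<phi> (t *\<^sub>R axis i 1 + x)"
  have D: "(?g has_real_derivative partial i \<phi> (t *\<^sub>R axis i 1 + x)) (at t)" for t
  proof -
    have a: "((\<lambda>t. t *\<^sub>R axis i 1 + x) has_derivative (\<lambda>s. s *\<^sub>R axis i 1)) (at t)"
      by (auto intro!: derivative_eq_intros)
    have "\<phi> differentiable (at (t *\<^sub>R axis i 1 + x))" using assms(1) by (rule smooth_differentiable)
    then have b: "(\<phi> has_derivative frechet_derivative \<phi> (at (t *\<^sub>R axis i 1 + x))) (at (t *\<^sub>R axis i 1 + x))"
      by (simp add: frechet_derivative_works)
    have "(?g has_derivative (\<lambda>s. frechet_derivative \<phi> (at (t *\<^sub>R axis i 1 + x)) (s *\<^sub>R axis i 1))) (at t)"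
      by (rule has_derivative_compose[OF a b])
    moreover have "(\<lambda>s. frechet_derivative \<phi> (at (t *\<^sub>R axis i 1 + x)) (s *\<^sub>R axis i 1)) =
        (*) (partial i \<phi> (t *\<^sub>R axis i 1 + x))"
      using has_derivative_linear[OF b] by (auto simp: partial_def linear_cmul fun_eq_iff)
    ultimately show ?thesis by (simp add: has_field_derivative_def)
  qed
  obtain z where "?g h - ?g 0 = (h - 0) * partial i \<phi> (z *\<^sub>R axis i 1 + x)"
    using MVT2[of 0 h ?g "\<lambda>t. partial i \<phi> (t *\<^sub>R axis i 1 + x)"] assms(3) D by blast
  then show "\<bar>(\<phi> (h *\<^sub>R axis i 1 + x) - \<phi> x) / h\<bar> \<le> B"
    using assms(2,3) by simp
  show "((\<lambda>h. (\<phi> (h *\<^sub>R axis i 1 + x) - \<phi> x) / h) \<longlongrightarrow> partial i \<phi> x) (at 0)"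
    using D[of 0] by (simp add: has_field_derivative_iff)
qed

text \<open>Translation invariance makes the integral of every difference quotient vanish, and the difference quotients
converge dominatedly to the partial derivative. This avoids iterated integrals on the plane.\<close>

lemma integral_partial_test_function:
  assumes "\<phi> \<in> test_functions U"
  shows "(LINT x|lborel. partial i \<phi> x) = 0"
proof -
  note \<phi> = test_functionsD[OF assms]
  obtain B where "\<forall>x. \<bar>partial i \<phi> x\<bar> \<le> B"
    using test_functions_bounded[OF test_functions_partial[OF assms]] ..
  then have B: "\<bar>partial i \<phi> x\<bar> \<le> B" for x ..
  obtain K where K: "compact K" "K \<subseteq> U" "\<And>x. x \<notin> K \<Longrightarrow> \<phi> x = 0"
    using test_functions_support[OF assms] by auto
  obtain R where "\<forall>x\<in>K. norm x \<le> R"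
    using compact_imp_bounded[OF K(1)] unfolding bounded_iff by blast
  then have R: "\<phi> x = 0" if "norm x > R" for x
    using K(3)[of x] that by fastforce
  \<comment> \<open>Steps of length at most one keep all difference quotients supported in a common ball.\<close>
  define h where "h n = inverse (real (Suc n))" for n
  define g where "g n x = (\<phi> (h n *\<^sub>R axis i 1 + x) - \<phi> x) / h n" for n x
  have h: "h n > 0" "h n \<le> 1" for n by (auto simp: h_def field_simps)
  have g0: "(LINT x|lborel. g n x) = 0" for n
  proof -
    have "(LINT x|lborel. g n x) = ((LINT x|lborel. \<phi> (h n *\<^sub>R axis i 1 + x)) - (LINT x|lborel. \<phi> x)) / h n"
      unfolding g_def using test_functions_integrable[OF assms]
      by (simp add: lborel_integrable_translate)
    then show ?thesis using lborel_integral_translate[OF smooth_borel_measurable[OF \<phi>(1)]] by simp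
  qed
  have "(\<lambda>n. LINT x|lborel. g n x) \<longlonglongrightarrow> (LINT x|lborel. partial i \<phi> x)"
  proof (rule integral_dominated_convergence[where w = "\<lambda>x. indicator (cball 0 (R + 1)) x *\<^sub>R B"])
    show "partial i \<phi> \<in> borel_measurable lborel"
      using smooth_borel_measurable[OF smooth_partial[OF \<phi>(1)]] by simp
    show "g n \<in> borel_measurable lborel" for n
    proof -
      have [measurable]: "\<phi> \<in> borel_measurable borel" by (rule smooth_borel_measurable[OF \<phi>(1)])
      show ?thesis unfolding g_def by measurable
    qed
    show "integrable lborel (\<lambda>x::plane. indicator (cball 0 (R + 1)) x *\<^sub>R B)"
      by (intro borel_integrable_compact) auto
    show "AE x in lborel. (\<lambda>n. g n x) \<longlonglongrightarrow> partial i \<phi> x"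
    proof (rule AE_I2)
      fix x
      have "filterlim h (at 0) sequentially"
        using LIMSEQ_inverse_real_of_nat h(1) unfolding h_def[abs_def] filterlim_at
        by (auto simp: less_imp_neq[symmetric])
      then show "(\<lambda>n. g n x) \<longlonglongrightarrow> partial i \<phi> x"
        unfolding g_def by (rule filterlim_compose[OF difference_quotient_partial(2)[OF \<phi>(1) B h(1)[of 0]]])
    qed
    show "AE x in lborel. norm (g n x) \<le> indicator (cball 0 (R + 1)) x *\<^sub>R B" for n
    proof (rule AE_I2)
      fix x :: plane
      show "norm (g n x) \<le> indicator (cball 0 (R + 1)) x *\<^sub>R B"
      proof (cases "norm x \<le> R + 1")
        case True
        then show ?thesis using difference_quotient_partial(1)[OF \<phi>(1) B h(1)[of n]] by (simp add: g_def)
      next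
        case False
        have "norm x \<le> norm (h n *\<^sub>R axis i 1 + x) + h n"
          using norm_triangle_ineq4[of "h n *\<^sub>R axis i 1 + x" "h n *\<^sub>R axis i (1::real)"] h(1)[of n]
          by (simp add: norm_axis_1)
        then have "\<phi> (h n *\<^sub>R axis i 1 + x) = 0" "\<phi> x = 0"
          using False h(2)[of n] by (intro R; simp)+
        then show ?thesis using False by (simp add: g_def)
      qed
    qed
  qed
  then show ?thesis using g0 by (simp add: LIMSEQ_const_iff)
qed

section \<open>Square-integrable functions\<close>

lemma L2_I: "f \<in> borel_measurable M \<Longrightarrow> integrable M (\<lambda>x. (f x)\<^sup>2) \<Longrightarrow> f \<in> L2 M"
  by (simp add: L2_def)

lemma L2_measurable: "f \<in> L2 M \<Longrightarrow> f \<in> borel_measurable M"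
  by (simp add: L2_def)

lemma L2_mult_integrable:
  assumes "f \<in> L2 M" "g \<in> L2 M"
  shows "integrable M (\<lambda>x. f x * g x)"
proof (rule Bochner_Integration.integrable_bound)
  show "integrable M (\<lambda>x. (f x)\<^sup>2 + (g x)\<^sup>2)" using assms by (auto simp: L2_def)
  show "(\<lambda>x. f x * g x) \<in> borel_measurable M" using assms by (auto simp: L2_def)
  have "\<bar>a * b\<bar> \<le> a\<^sup>2 + b\<^sup>2" for a b :: real
    using sum_squares_bound[of "\<bar>a\<bar>" "\<bar>b\<bar>"] mult_nonneg_nonneg[OF abs_ge_zero[of a] abs_ge_zero[of b]]
    unfolding abs_mult power2_abs by linarith
  then show "AE x in M. norm (f x * g x) \<le> norm ((f x)\<^sup>2 + (g x)\<^sup>2)" by auto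
qed

lemma L2_lincomb:
  assumes "f \<in> L2 M" "g \<in> L2 M"
  shows "(\<lambda>x. a * f x + b * g x) \<in> L2 M"
proof (rule L2_I)
  show "(\<lambda>x. a * f x + b * g x) \<in> borel_measurable M" using assms by (auto simp: L2_def)
  have "integrable M (\<lambda>x. a\<^sup>2 * (f x)\<^sup>2 + 2 * a * b * (f x * g x) + b\<^sup>2 * (g x)\<^sup>2)"
    using assms L2_mult_integrable[OF assms] by (auto simp: L2_def)
  moreover have "(\<lambda>x. a\<^sup>2 * (f x)\<^sup>2 + 2 * a * b * (f x * g x) + b\<^sup>2 * (g x)\<^sup>2) = (\<lambda>x. (a * f x + b * g x)\<^sup>2)"
    by (auto simp: power2_eq_square algebra_simps)
  ultimately show "integrable M (\<lambda>x. (a * f x + b * g x)\<^sup>2)" by simp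
qed

lemma L2_zero: "(\<lambda>x. 0) \<in> L2 M"
  by (simp add: L2_def)

lemma subspace_L2: "subspace (L2 M)"
  by (intro subspace_lincombI L2_zero L2_lincomb)

lemma semi_inner_L2: "semi_inner (L2 M) (L2_inner M)"
  unfolding semi_inner_def linear_on_def
proof (intro conjI ballI allI subspace_L2)
  fix f g h assume "f \<in> L2 M" "g \<in> L2 M" "h \<in> L2 M"
  then show "L2_inner M (f + g) h = L2_inner M f h + L2_inner M g h"
    by (simp add: L2_inner_def distrib_right L2_mult_integrable)
next
  fix f h :: "'a \<Rightarrow> real" and c
  show "L2_inner M (c *\<^sub>R f) h = c * L2_inner M f h"
    by (simp add: L2_inner_def mult.assoc)
  show "L2_inner M f h = L2_inner M h f" by (simp add: L2_inner_def mult.commute)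
  show "0 \<le> L2_inner M f f" by (simp add: L2_inner_def)
qed

lemma L2_norm_eq: "L2_norm M f = sqrt (L2_inner M f f)"
  by (simp add: L2_norm_def L2_inner_def power2_eq_square)

lemma L2_bounded:
  assumes "finite_measure M" "f \<in> borel_measurable M" "\<And>x. x \<in> space M \<Longrightarrow> \<bar>f x\<bar> \<le> B"
  shows "f \<in> L2 M"
proof (rule L2_I[OF assms(2)])
  have "(f x)\<^sup>2 \<le> B\<^sup>2" if "x \<in> space M" for x
    using power_mono[OF assms(3)[OF that] abs_ge_zero, of 2] by simp
  then show "integrable M (\<lambda>x. (f x)\<^sup>2)"
    using assms(2) by (intro finite_measure.integrable_const_bound[OF assms(1), of _ "B\<^sup>2"]) auto
qed

lemma L2_integrable: "finite_measure M \<Longrightarrow> f \<in> L2 M \<Longrightarrow> integrable M f"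
  using L2_mult_integrable[of f M "\<lambda>x. 1"] L2_bounded[of M "\<lambda>x. 1" 1] by simp

section \<open>Integration by parts on bounded open sets\<close>

lemma finite_measure_lebesgue_on_open: "open U \<Longrightarrow> bounded U \<Longrightarrow> finite_measure (lebesgue_on U)"
  by (intro finite_measure_lebesgue_on lmeasurable_open)

lemma smooth_measurable_lebesgue_on:
  "open U \<Longrightarrow> smooth f \<Longrightarrow> f \<in> borel_measurable (lebesgue_on U)"
  by (intro continuous_imp_measurable_on_sets_lebesgue smooth_continuous) auto

lemma smooth_bounded_on:
  assumes "bounded S" "smooth f"
  shows "\<exists>B. \<forall>x\<in>S. \<bar>f x\<bar> \<le> B"
proof -
  have "compact (f ` closure S)"
    using assms by (intro compact_continuous_image smooth_continuous) auto
  then obtain B where "\<forall>y\<in>f ` closure S. norm y \<le> B"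
    using compact_imp_bounded[of "f ` closure S"] unfolding bounded_iff by auto
  then show ?thesis using closure_subset[of S] by auto
qed

lemma smooth_L2:
  assumes "open U" "bounded U" "smooth f"
  shows "f \<in> L2 (lebesgue_on U)"
proof -
  obtain B where "\<forall>x\<in>U. \<bar>f x\<bar> \<le> B" using smooth_bounded_on[OF assms(2,3)] ..
  then show ?thesis using assms
    by (intro L2_bounded[of _ _ B] finite_measure_lebesgue_on_open smooth_measurable_lebesgue_on) auto
qed

lemma lebesgue_on_integral_test_function:
  assumes "open U" "\<phi> \<in> test_functions U"
  shows "(LINT x|lebesgue_on U. \<phi> x) = (LINT x|lborel. \<phi> x)"
proof -
  have "(LINT x|lebesgue_on U. \<phi> x) = (LINT x|lebesgue. indicator U x *\<^sub>R \<phi> x)"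
    using assms(1) by (intro integral_restrict_space) auto
  also have "\<dots> = (LINT x|lebesgue. \<phi> x)"
    using test_functions_zero_outside[OF assms(2)]
    by (intro Bochner_Integration.integral_cong) (auto simp: indicator_def)
  also have "\<dots> = (LINT x|lborel. \<phi> x)"
    using smooth_borel_measurable[OF test_functionsD(1)[OF assms(2)]]
    by (intro integral_completion) simp
  finally show ?thesis .
qed

lemma integral_by_parts_test_function:
  assumes U: "open U" "bounded U" and \<phi>: "\<phi> \<in> test_functions U" and f: "smooth f"
  shows "(LINT x|lebesgue_on U. f x * partial i \<phi> x) = - (LINT x|lebesgue_on U. partial i f x * \<phi> x)"
proof -
  note sm = test_functionsD(1)[OF \<phi>]
  have L: "f \<in> L2 (lebesgue_on U)" "partial i f \<in> L2 (lebesgue_on U)"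
    "\<phi> \<in> L2 (lebesgue_on U)" "partial i \<phi> \<in> L2 (lebesgue_on U)"
    using U f sm by (auto intro!: smooth_L2 smooth_partial)
  have t: "(\<lambda>x. f x * \<phi> x) \<in> test_functions U" by (rule test_functions_mult[OF \<phi> f])
  have "partial i (\<lambda>x. f x * \<phi> x) = (\<lambda>x. f x * partial i \<phi> x + partial i f x * \<phi> x)"
    using smooth_differentiable f sm by (auto simp: partial_mult)
  then have "(LINT x|lebesgue_on U. f x * partial i \<phi> x + partial i f x * \<phi> x) = 0"
    using integral_partial_test_function[OF t, of i]
      lebesgue_on_integral_test_function[OF U(1) test_functions_partial[OF t], of i] by simp
  then show ?thesis
    using L2_mult_integrable[OF L(1,4)] L2_mult_integrable[OF L(2,3)] by simp
qed

text \<open>The fundamental lemma for Lebesgue measurable functions. Passing to a Borel representative reduces it to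
the version for Borel measures.\<close>

lemma lebesgue_on_AE_zeroI:
  assumes U: "open U" and f: "integrable (lebesgue_on U) f"
    and zero: "\<And>\<phi>. \<phi> \<in> test_functions U \<Longrightarrow> (LINT x|lebesgue_on U. f x * \<phi> x) = 0"
  shows "AE x in lebesgue_on U. f x = 0"
proof -
  let ?F = "\<lambda>x. indicator U x *\<^sub>R f x"
  let ?M = "restrict_space lborel U"
  have F: "integrable lebesgue ?F" using f U by (simp add: integrable_restrict_space)
  then have Fm: "?F \<in> borel_measurable lebesgue" by blast
  then obtain g where g: "g \<in> borel_measurable lborel" "AE x in lborel. ?F x = g x"
    using completion_ex_borel_measurable_real by blast
  have gm: "g \<in> borel_measurable lebesgue" using g(1) by (rule measurable_completion)
  have ae: "AE x in lebesgue. ?F x = g x" using g(2) by (rule AE_completion)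
  have "integrable lebesgue g" by (rule integrable_cong_AE_imp[OF F gm ae])
  then have gi: "integrable lborel g" using g(1) by (simp add: integrable_completion)
  have Us: "U \<inter> space lborel \<in> sets lborel" using U by simp
  have "AE x in ?M. g x = 0"
  proof (rule integral_test_functions_zero_imp_AE_zero[OF U])
    show "space ?M \<subseteq> U" by (simp add: space_restrict_space)
    show "sets ?M = sets (restrict_space borel (space ?M))"
      by (simp add: space_restrict_space sets_restrict_space)
    show "integrable ?M g"
      using gi U by (subst integrable_restrict_space[OF Us]) (rule integrable_mult_indicator, simp_all)
    fix \<phi> assume \<phi>: "\<phi> \<in> test_functions U"
    have m[measurable]: "\<phi> \<in> borel_measurable lborel" using smooth_borel_measurable test_functionsD(1)[OF \<phi>] by simp
    have [measurable]: "g \<in> borel_measurable lborel" "U \<in> sets lborel" using g U by auto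
    have Fp: "(\<lambda>x. ?F x * \<phi> x) \<in> borel_measurable lebesgue"
      using Fm measurable_completion[OF m] by (rule borel_measurable_times)
    have "(LINT x|?M. g x * \<phi> x) = (LINT x|lborel. indicator U x *\<^sub>R (g x * \<phi> x))"
      by (rule integral_restrict_space[OF Us])
    also have "\<dots> = (LINT x|lebesgue. indicator U x *\<^sub>R (g x * \<phi> x))"
      by (rule integral_completion[symmetric]) measurable
    also have "\<dots> = (LINT x|lebesgue. ?F x * \<phi> x)"
    proof (rule integral_cong_AE)
      have "(\<lambda>x. indicator U x *\<^sub>R (g x * \<phi> x)) \<in> borel_measurable lborel" by measurable
      then show "(\<lambda>x. indicator U x *\<^sub>R (g x * \<phi> x)) \<in> borel_measurable lebesgue" by (rule measurable_completion)
      show "AE x in lebesgue. indicator U x *\<^sub>R (g x * \<phi> x) = ?F x * \<phi> x"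
        using ae by eventually_elim (auto simp: indicator_def split: if_splits)
    qed (fact Fp)
    also have "\<dots> = (LINT x|lebesgue. indicator U x *\<^sub>R (f x * \<phi> x))"
      by (simp add: mult.assoc)
    also have "\<dots> = (LINT x|lebesgue_on U. f x * \<phi> x)"
      using U by (intro integral_restrict_space[symmetric]) auto
    finally show "(LINT x|?M. g x * \<phi> x) = 0" using zero[OF \<phi>] by simp
  qed
  then have "AE x in lborel. x \<in> U \<longrightarrow> g x = 0" by (simp add: AE_restrict_space_iff[OF Us])
  then have "AE x in lborel. x \<in> U \<longrightarrow> f x = 0"
    using g(2) by eventually_elim (auto simp: indicator_def)
  then have "AE x in lebesgue. x \<in> U \<longrightarrow> f x = 0" by (rule AE_completion)
  then show ?thesis using U by (subst AE_restrict_space_iff) auto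
qed

section \<open>Weak gradients\<close>

lemma has_weak_gradientD:
  assumes "has_weak_gradient U u G"
  shows "(\<lambda>x. G x $ i) \<in> L2 (lebesgue_on U)"
    and "\<phi> \<in> test_functions U \<Longrightarrow>
      (LINT x|lebesgue_on U. u x * partial i \<phi> x) = - (LINT x|lebesgue_on U. G x $ i * \<phi> x)"
  using assms by (auto simp: has_weak_gradient_def)

text \<open>Needed with two functions \<open>u\<close>, \<open>v\<close> that agree only on \<open>U\<close>, since functions are identified by their values there
but the chosen weak gradients may differ.\<close>

lemma weak_gradient_unique:
  assumes U: "open U" "bounded U" and G: "has_weak_gradient U u G" and H: "has_weak_gradient U v H"
    and eq: "\<And>x. x \<in> U \<Longrightarrow> u x = v x"
  shows "AE x in lebesgue_on U. G x = H x"
proof -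
  have "AE x in lebesgue_on U. G x $ i - H x $ i = 0" for i
  proof (rule lebesgue_on_AE_zeroI[OF U(1)])
    note L = has_weak_gradientD(1)[OF G, of i] has_weak_gradientD(1)[OF H, of i]
    show "integrable (lebesgue_on U) (\<lambda>x. G x $ i - H x $ i)"
      using L U by (intro Bochner_Integration.integrable_diff L2_integrable finite_measure_lebesgue_on_open)
    fix \<phi> assume \<phi>: "\<phi> \<in> test_functions U"
    have sm: "\<phi> \<in> L2 (lebesgue_on U)" using U test_functionsD(1)[OF \<phi>] by (rule smooth_L2)
    have "(LINT x|lebesgue_on U. u x * partial i \<phi> x) = (LINT x|lebesgue_on U. v x * partial i \<phi> x)"
      using eq by (intro Bochner_Integration.integral_cong) auto
    then have "(LINT x|lebesgue_on U. G x $ i * \<phi> x) = (LINT x|lebesgue_on U. H x $ i * \<phi> x)"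
      using has_weak_gradientD(2)[OF G \<phi>] has_weak_gradientD(2)[OF H \<phi>] by simp
    then show "(LINT x|lebesgue_on U. (G x $ i - H x $ i) * \<phi> x) = 0"
      using L2_mult_integrable[OF L(1) sm] L2_mult_integrable[OF L(2) sm] by (simp add: left_diff_distrib)
  qed
  then have "AE x in lebesgue_on U. G x $ 1 - H x $ 1 = 0 \<and> G x $ 2 - H x $ 2 = 0"
    by (intro AE_conjI)
  then show ?thesis by eventually_elim (auto simp: vec_eq_iff forall_2)
qed

lemma has_weak_gradient_smooth:
  assumes "open U" "bounded U" "smooth f"
  shows "has_weak_gradient U f (\<lambda>x. \<chi> i. partial i f x)"
  unfolding has_weak_gradient_def
  using assms smooth_L2[OF assms(1,2) smooth_partial[OF assms(3)]]
  by (simp add: integral_by_parts_test_function)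

lemma smooth_H1: "open U \<Longrightarrow> bounded U \<Longrightarrow> smooth f \<Longrightarrow> f \<in> H1 U"
  unfolding H1_def using has_weak_gradient_smooth smooth_L2 by blast

lemma has_weak_gradient_lincomb:
  assumes U: "open U" "bounded U" and u: "u \<in> L2 (lebesgue_on U)" and v: "v \<in> L2 (lebesgue_on U)"
    and G: "has_weak_gradient U u G" and H: "has_weak_gradient U v H"
  shows "has_weak_gradient U (\<lambda>x. a * u x + b * v x) (\<lambda>x. a *\<^sub>R G x + b *\<^sub>R H x)"
  unfolding has_weak_gradient_def
proof (intro conjI allI ballI)
  show "(\<lambda>x. (a *\<^sub>R G x + b *\<^sub>R H x) $ i) \<in> L2 (lebesgue_on U)" for i
    using L2_lincomb[OF has_weak_gradientD(1)[OF G] has_weak_gradientD(1)[OF H]] by simp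
  fix \<phi> i assume \<phi>: "\<phi> \<in> test_functions U"
  have sm: "\<phi> \<in> L2 (lebesgue_on U)" "partial i \<phi> \<in> L2 (lebesgue_on U)"
    using U test_functionsD(1)[OF \<phi>] by (auto intro!: smooth_L2 smooth_partial)
  note I = L2_mult_integrable[OF u sm(2)] L2_mult_integrable[OF v sm(2)]
    L2_mult_integrable[OF has_weak_gradientD(1)[OF G, of i] sm(1)]
    L2_mult_integrable[OF has_weak_gradientD(1)[OF H, of i] sm(1)]
  have "(LINT x|lebesgue_on U. (a * u x + b * v x) * partial i \<phi> x) =
      a * (LINT x|lebesgue_on U. u x * partial i \<phi> x) + b * (LINT x|lebesgue_on U. v x * partial i \<phi> x)"
    using I by (simp add: distrib_right mult.assoc)
  also have "\<dots> = - (a * (LINT x|lebesgue_on U. G x $ i * \<phi> x) + b * (LINT x|lebesgue_on U. H x $ i * \<phi> x))"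
    using has_weak_gradientD(2)[OF G \<phi>] has_weak_gradientD(2)[OF H \<phi>] by simp
  also have "\<dots> = - (LINT x|lebesgue_on U. (a *\<^sub>R G x + b *\<^sub>R H x) $ i * \<phi> x)"
    using I by (simp add: distrib_right mult.assoc)
  finally show "(LINT x|lebesgue_on U. (a * u x + b * v x) * partial i \<phi> x) =
      - (LINT x|lebesgue_on U. (a *\<^sub>R G x + b *\<^sub>R H x) $ i * \<phi> x)" .
qed

lemma H1_L2: "u \<in> H1 U \<Longrightarrow> u \<in> L2 (lebesgue_on U)"
  by (simp add: H1_def)

lemma weak_gradientI: "has_weak_gradient U u G \<Longrightarrow> has_weak_gradient U u (weak_gradient U u)"
  unfolding weak_gradient_def by (rule someI[of "has_weak_gradient U u"])

lemma H1_weak_gradient: "u \<in> H1 U \<Longrightarrow> has_weak_gradient U u (weak_gradient U u)"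
  unfolding H1_def by (auto intro: weak_gradientI)

lemma subspace_H1: "open U \<Longrightarrow> bounded U \<Longrightarrow> subspace (H1 U)"
proof (rule subspace_lincombI)
  assume U: "open U" "bounded U"
  show "(\<lambda>x. 0) \<in> H1 U" using U by (intro smooth_H1 smooth_const)
  fix f g a b assume "f \<in> H1 U" "g \<in> H1 U"
  then show "(\<lambda>x. a * f x + b * g x) \<in> H1 U"
    using has_weak_gradient_lincomb[OF U H1_L2 H1_L2 H1_weak_gradient H1_weak_gradient]
      L2_lincomb[OF H1_L2 H1_L2] unfolding H1_def by blast
qed

lemma weak_gradient_inner_measurable:
  assumes "has_weak_gradient U u G" "has_weak_gradient U v H"
  shows "(\<lambda>x. G x \<bullet> H x) \<in> borel_measurable (lebesgue_on U)"
    and "integrable (lebesgue_on U) (\<lambda>x. G x \<bullet> H x)"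
proof -
  note L = has_weak_gradientD(1)[OF assms(1)] has_weak_gradientD(1)[OF assms(2)]
  have "integrable (lebesgue_on U) (\<lambda>x. G x $ 1 * H x $ 1 + G x $ 2 * H x $ 2)"
    using L by (intro Bochner_Integration.integrable_add L2_mult_integrable)
  then show "integrable (lebesgue_on U) (\<lambda>x. G x \<bullet> H x)" by (simp add: inner_vec_def sum_2)
  then show "(\<lambda>x. G x \<bullet> H x) \<in> borel_measurable (lebesgue_on U)" by blast
qed

text \<open>Frees the inner product of the arbitrary choice in \<^const>\<open>weak_gradient\<close>: any weak gradients may be used. Bilinearity
follows from this, although the chosen gradients are not linear.\<close>

lemma grad_inner_eq:
  assumes U: "open U" "bounded U" and G: "has_weak_gradient U u G" and H: "has_weak_gradient U v H"
  shows "grad_inner U u v = (LINT x|lebesgue_on U. G x \<bullet> H x)"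
proof -
  have wu: "has_weak_gradient U u (weak_gradient U u)" and wv: "has_weak_gradient U v (weak_gradient U v)"
    using G H by (auto intro: weak_gradientI)
  have "AE x in lebesgue_on U. weak_gradient U u x = G x" "AE x in lebesgue_on U. weak_gradient U v x = H x"
    using weak_gradient_unique[OF U wu G] weak_gradient_unique[OF U wv H] by auto
  then have "AE x in lebesgue_on U. weak_gradient U u x \<bullet> weak_gradient U v x = G x \<bullet> H x"
    by eventually_elim simp
  then show ?thesis unfolding grad_inner_def
    using weak_gradient_inner_measurable(1) wu wv G H by (intro integral_cong_AE) auto
qed

lemma has_weak_gradient_cong:
  assumes "\<And>x. x \<in> U \<Longrightarrow> u x = v x"
  shows "has_weak_gradient U u G \<longleftrightarrow> has_weak_gradient U v G"
proof -
  have "(LINT x|lebesgue_on U. u x * partial i \<phi> x) = (LINT x|lebesgue_on U. v x * partial i \<phi> x)" for i \<phi>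
    using assms by (intro Bochner_Integration.integral_cong) auto
  then show ?thesis by (simp add: has_weak_gradient_def)
qed

lemma grad_inner_zero_left:
  assumes U: "open U" "bounded U" and v: "v \<in> H1 U" and u: "\<And>x. x \<in> U \<Longrightarrow> u x = 0"
  shows "grad_inner U u v = 0"
proof -
  have "has_weak_gradient U (\<lambda>x. 0) (\<lambda>x. 0)"
    by (simp add: has_weak_gradient_def L2_zero)
  then have "has_weak_gradient U u (\<lambda>x. 0)" using has_weak_gradient_cong[of U u "\<lambda>x. 0"] u by blast
  then show ?thesis using grad_inner_eq[OF U _ H1_weak_gradient[OF v]] by simp
qed

lemma semi_inner_grad_inner:
  assumes U: "open U" "bounded U"
  shows "semi_inner (H1 U) (grad_inner U)"
  unfolding semi_inner_def linear_on_def
proof (intro conjI ballI allI)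
  show "subspace (H1 U)" using U by (rule subspace_H1)
  have lin: "grad_inner U (\<lambda>x. a * u x + b * v x) w = a * grad_inner U u w + b * grad_inner U v w"
    if "u \<in> H1 U" "v \<in> H1 U" "w \<in> H1 U" for u v w a b
  proof -
    note W = that[THEN H1_weak_gradient]
    show ?thesis
      using grad_inner_eq[OF U has_weak_gradient_lincomb[OF U that(1,2)[THEN H1_L2] W(1,2)] W(3), of a b]
        weak_gradient_inner_measurable(2)[OF W(1) W(3)] weak_gradient_inner_measurable(2)[OF W(2) W(3)]
      by (simp add: grad_inner_def inner_add_left)
  qed
  show "grad_inner U (u + v) w = grad_inner U u w + grad_inner U v w"
    if "u \<in> H1 U" "v \<in> H1 U" "w \<in> H1 U" for u v w
    using lin[OF that, of 1 1] by (simp add: plus_fun_def)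
  show "grad_inner U (c *\<^sub>R u) w = c * grad_inner U u w" if "u \<in> H1 U" "w \<in> H1 U" for u w c
    using lin[OF that(1) that(1) that(2), of c 0] by (simp add: scaleR_fun_def)
  show "grad_inner U u v = grad_inner U v u" for u v
    by (simp add: grad_inner_def inner_commute)
  show "grad_inner U u u \<ge> 0" for u
    by (simp add: grad_inner_def)
qed

lemma H1_seminorm_eq: "H1_seminorm U u = sqrt (grad_inner U u u)"
  by (simp add: H1_seminorm_def grad_inner_def power2_norm_eq_inner)

lemma H1_seminorm_sq: "(H1_seminorm U u)\<^sup>2 = grad_inner U u u"
  by (simp add: H1_seminorm_eq grad_inner_def)

lemma H1_seminorm_nonneg: "0 \<le> H1_seminorm U u"
  by (simp add: H1_seminorm_def)

text \<open>The inner product behind \<^const>\<open>H1_norm\<close>, so that the general facts on semi-inner products apply.\<close>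

definition H1_inner :: "plane set \<Rightarrow> (plane \<Rightarrow> real) \<Rightarrow> (plane \<Rightarrow> real) \<Rightarrow> real" where
  "H1_inner U u v = L2_inner (lebesgue_on U) u v + grad_inner U u v"

lemma semi_inner_H1:
  assumes "open U" "bounded U"
  shows "semi_inner (H1 U) (H1_inner U)"
  unfolding H1_inner_def[abs_def] using subspace_H1[OF assms]
  by (intro semi_inner_add semi_inner_grad_inner assms semi_inner_subset[OF semi_inner_L2]) (auto intro: H1_L2)

lemma H1_norm_eq: "H1_norm U u = sqrt (H1_inner U u u)"
  by (simp add: H1_norm_def H1_inner_def H1_seminorm_sq L2_norm_eq L2_inner_def)

lemma H1_norm_zero:
  assumes U: "open U" "bounded U"
  shows "H1_norm U (\<lambda>x. 0) = 0"
  using grad_inner_zero_left[OF U smooth_H1[OF U smooth_const[of 0]], of "\<lambda>x. 0"]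
  by (simp add: H1_norm_eq H1_inner_def L2_inner_def)

section \<open>The Poincare inequality\<close>

lemma L2_norm_le_H1_norm: "L2_norm (lebesgue_on U) u \<le> H1_norm U u"
  and H1_seminorm_le_H1_norm: "H1_seminorm U u \<le> H1_norm U u"
  by (auto simp: H1_norm_def intro!: real_le_rsqrt)

text \<open>Integrating the derivative of \<open>x\<^sub>1 \<phi>\<^sup>2\<close> gives \<open>\<integral> \<phi>\<^sup>2 = - 2 \<integral> x\<^sub>1 \<phi> \<partial>\<^sub>1 \<phi>\<close>, and Cauchy-Schwarz with
\<open>|x\<^sub>1| \<le> R\<close> gives the bound.\<close>

lemma Poincare_test_function:
  assumes U: "open U" "bounded U" and R: "\<And>x. x \<in> U \<Longrightarrow> norm x \<le> R" "0 \<le> R"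
    and \<phi>: "\<phi> \<in> test_functions U"
  shows "L2_norm (lebesgue_on U) \<phi> \<le> 2 * R * H1_seminorm U \<phi>"
proof -
  let ?M = "lebesgue_on U"
  let ?D = "partial 1 \<phi>"
  let ?x = "\<lambda>x::plane. x $ 1"
  note sm = test_functionsD(1)[OF \<phi>]
  have s: "smooth (\<lambda>x. x $ 1 * \<phi> x)" using sm by (intro smooth_mult smooth_coord)
  have L: "\<phi> \<in> L2 ?M" "?D \<in> L2 ?M" "(\<lambda>x. x $ 1 * \<phi> x) \<in> L2 ?M" "(\<lambda>x. x $ 1 * ?D x) \<in> L2 ?M"
    using U sm s by (auto intro!: smooth_L2 smooth_partial smooth_mult smooth_coord)
  have "partial 1 (\<lambda>x. x $ 1 * \<phi> x) = (\<lambda>x. x $ 1 * ?D x + \<phi> x)"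
    using smooth_differentiable[OF sm] smooth_differentiable[OF smooth_coord]
    by (auto simp: partial_mult partial_coord)
  then have "(LINT x|?M. (x $ 1 * \<phi> x) * ?D x) = - (LINT x|?M. (x $ 1 * ?D x + \<phi> x) * \<phi> x)"
    using integral_by_parts_test_function[OF U \<phi> s, of 1] by simp
  also have "\<dots> = - (LINT x|?M. (x $ 1 * ?D x) * \<phi> x) - L2_inner ?M \<phi> \<phi>"
    using L2_mult_integrable[OF L(4,1)] L2_mult_integrable[OF L(1,1)]
    by (simp add: distrib_right L2_inner_def)
  finally have "L2_inner ?M \<phi> \<phi> = - 2 * L2_inner ?M (\<lambda>x. x $ 1 * \<phi> x) ?D"
    by (simp add: L2_inner_def mult.assoc mult.left_commute mult.commute)
  also have "\<dots> \<le> 2 * (sqrt (L2_inner ?M (\<lambda>x. x $ 1 * \<phi> x) (\<lambda>x. x $ 1 * \<phi> x)) * sqrt (L2_inner ?M ?D ?D))"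
    using semi_inner_Cauchy_Schwarz[OF semi_inner_L2 L(3,2)] by linarith
  also have "\<dots> \<le> 2 * ((R * L2_norm ?M \<phi>) * H1_seminorm U \<phi>)"
  proof (intro mult_left_mono mult_mono)
    have "L2_inner ?M (\<lambda>x. x $ 1 * \<phi> x) (\<lambda>x. x $ 1 * \<phi> x) \<le> (LINT x|?M. R\<^sup>2 * (\<phi> x * \<phi> x))"
      unfolding L2_inner_def
    proof (rule integral_mono)
      show "integrable ?M (\<lambda>x. x $ 1 * \<phi> x * (x $ 1 * \<phi> x))" by (rule L2_mult_integrable[OF L(3,3)])
      show "integrable ?M (\<lambda>x. R\<^sup>2 * (\<phi> x * \<phi> x))" using L2_mult_integrable[OF L(1,1)] by simp
      fix x assume "x \<in> space ?M"
      then have "\<bar>x $ 1\<bar> \<le> R" using R(1)[of x] component_le_norm_cart[of x 1] by simp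
      then have "(x $ 1)\<^sup>2 \<le> R\<^sup>2" using power_mono[of "\<bar>x $ 1\<bar>" R 2] by simp
      then have "(x $ 1)\<^sup>2 * (\<phi> x * \<phi> x) \<le> R\<^sup>2 * (\<phi> x * \<phi> x)" by (rule mult_right_mono) simp
      then show "x $ 1 * \<phi> x * (x $ 1 * \<phi> x) \<le> R\<^sup>2 * (\<phi> x * \<phi> x)"
        by (simp add: power2_eq_square algebra_simps)
    qed
    then have "sqrt (L2_inner ?M (\<lambda>x. x $ 1 * \<phi> x) (\<lambda>x. x $ 1 * \<phi> x)) \<le> sqrt (R\<^sup>2 * L2_inner ?M \<phi> \<phi>)"
      by (simp add: L2_inner_def)
    then show "sqrt (L2_inner ?M (\<lambda>x. x $ 1 * \<phi> x) (\<lambda>x. x $ 1 * \<phi> x)) \<le> R * L2_norm ?M \<phi>"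
      using R(2) by (simp add: L2_norm_eq real_sqrt_mult)
    note G = has_weak_gradient_smooth[OF U sm]
    have "L2_inner ?M ?D ?D \<le> (LINT x|?M. (\<chi> i. partial i \<phi> x) \<bullet> (\<chi> i. partial i \<phi> x))"
      unfolding L2_inner_def
      using L2_mult_integrable[OF L(2,2)] weak_gradient_inner_measurable(2)[OF G G]
      by (intro integral_mono) (auto simp: inner_vec_def sum_2)
    then show "sqrt (L2_inner ?M ?D ?D) \<le> H1_seminorm U \<phi>"
      using grad_inner_eq[OF U G G] by (simp add: H1_seminorm_eq)
    show "0 \<le> R * L2_norm ?M \<phi>" using R(2) by (simp add: L2_norm_def)
  qed (auto simp: L2_inner_def)
  finally have "(L2_norm ?M \<phi>)\<^sup>2 \<le> L2_norm ?M \<phi> * (2 * R * H1_seminorm U \<phi>)"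
    by (simp add: L2_norm_eq L2_inner_def algebra_simps)
  moreover have "a \<le> b" if "a\<^sup>2 \<le> a * b" "0 \<le> a" "0 \<le> b" for a b :: real
    using that by (cases "a = 0") (simp_all add: power2_eq_square)
  moreover have "0 \<le> L2_norm ?M \<phi>" "0 \<le> 2 * R * H1_seminorm U \<phi>"
    using R(2) by (simp_all add: L2_norm_def H1_seminorm_def)
  ultimately show ?thesis by blast
qed

lemma H10_H1: "u \<in> H10 U \<Longrightarrow> u \<in> H1 U"
  by (simp add: H10_def)

lemma Poincare_H10:
  assumes U: "open U" "bounded U"
  obtains C where "0 \<le> C" "\<forall>u\<in>H10 U. L2_norm (lebesgue_on U) u \<le> C * H1_seminorm U u"
proof -
  obtain R0 where "\<forall>x\<in>U. norm x \<le> R0" using U(2) by (auto simp: bounded_iff)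
  then have R: "\<And>x. x \<in> U \<Longrightarrow> norm x \<le> max R0 0" by fastforce
  define C where "C = 2 * max R0 0"
  have C: "0 \<le> C" by (simp add: C_def)
  have "L2_norm (lebesgue_on U) u \<le> C * H1_seminorm U u" if u: "u \<in> H10 U" for u
  proof -
    have uH: "u \<in> H1 U" using u by (rule H10_H1)
    obtain \<phi> where \<phi>: "\<And>n. \<phi> n \<in> test_functions U"
      and lim: "(\<lambda>n::nat. H1_norm U (\<lambda>x. \<phi> n x - u x)) \<longlonglongrightarrow> 0"
      using u by (auto simp: H10_def)
    \<comment> \<open>The distance \<open>d n\<close> to the approximating test functions enters both sides and tends to zero.\<close>
    define d where "d n = H1_norm U (\<phi> n - u)" for n
    have dlim: "d \<longlonglongrightarrow> 0" using lim by (simp add: d_def[abs_def] fun_diff_def)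
    have "L2_norm (lebesgue_on U) u \<le> C * (d n + H1_seminorm U u) + d n" for n
    proof -
      have pH: "\<phi> n \<in> H1 U" using \<phi> U by (intro smooth_H1 test_functionsD(1))
      have "L2_norm (lebesgue_on U) u \<le> L2_norm (lebesgue_on U) (u - \<phi> n) + L2_norm (lebesgue_on U) (\<phi> n)"
        unfolding L2_norm_eq by (rule semi_inner_norm_le_diff[OF semi_inner_L2 H1_L2[OF uH] H1_L2[OF pH]])
      also have "L2_norm (lebesgue_on U) (u - \<phi> n) = L2_norm (lebesgue_on U) (\<phi> n - u)"
        unfolding L2_norm_eq by (rule semi_inner_norm_minus[OF semi_inner_L2 H1_L2[OF uH] H1_L2[OF pH]])
      also have "\<dots> \<le> d n" unfolding d_def by (rule L2_norm_le_H1_norm)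
      also have "L2_norm (lebesgue_on U) (\<phi> n) \<le> C * H1_seminorm U (\<phi> n)"
        unfolding C_def using Poincare_test_function[OF U R _ \<phi>] by simp
      also have "H1_seminorm U (\<phi> n) \<le> H1_seminorm U (\<phi> n - u) + H1_seminorm U u"
        unfolding H1_seminorm_eq by (rule semi_inner_norm_le_diff[OF semi_inner_grad_inner[OF U] pH uH])
      also have "H1_seminorm U (\<phi> n - u) \<le> d n" unfolding d_def by (rule H1_seminorm_le_H1_norm)
      finally show ?thesis using C by (simp add: mult_left_mono)
    qed
    moreover have "(\<lambda>n. C * (d n + H1_seminorm U u) + d n) \<longlonglongrightarrow> C * (0 + H1_seminorm U u) + 0"
      by (intro tendsto_intros dlim)
    ultimately show ?thesis
      using LIMSEQ_le_const[of "\<lambda>n. C * (d n + H1_seminorm U u) + d n" _ "L2_norm (lebesgue_on U) u"] by simp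
  qed
  then show thesis by (intro that[OF C] ballI)
qed

lemma subspace_H10:
  assumes U: "open U" "bounded U"
  shows "subspace (H10 U)"
proof (rule subspace_lincombI)
  have z: "H1_norm U (\<lambda>x. 0) = 0" by (rule H1_norm_zero[OF U])
  have "(\<lambda>x. 0) \<in> test_functions U" by (intro test_functionsI[of _ "{}"] smooth_const) auto
  then show "(\<lambda>x. 0) \<in> H10 U"
    using U z by (auto simp: H10_def intro!: smooth_H1 smooth_const exI[of _ "\<lambda>n x. 0"])
  fix u v a b assume u: "u \<in> H10 U" and v: "v \<in> H10 U"
  obtain \<phi> where \<phi>: "\<And>n. \<phi> n \<in> test_functions U"
    and lim\<phi>: "(\<lambda>n::nat. H1_norm U (\<lambda>x. \<phi> n x - u x)) \<longlonglongrightarrow> 0" using u by (auto simp: H10_def)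
  obtain \<psi> where \<psi>: "\<And>n. \<psi> n \<in> test_functions U"
    and lim\<psi>: "(\<lambda>n::nat. H1_norm U (\<lambda>x. \<psi> n x - v x)) \<longlonglongrightarrow> 0" using v by (auto simp: H10_def)
  have "(\<lambda>n. H1_norm U (\<lambda>x. (a * \<phi> n x + b * \<psi> n x) - (a * u x + b * v x))) \<longlonglongrightarrow> 0"
    unfolding H1_norm_eq
    by (rule semi_inner_lincomb_tendsto[OF semi_inner_H1[OF U] _ _ _ _ lim\<phi>[unfolded H1_norm_eq] lim\<psi>[unfolded H1_norm_eq]])
      (use \<phi> \<psi> u v in \<open>auto intro: smooth_H1[OF U] test_functionsD(1) H10_H1\<close>)
  moreover have "(\<lambda>x. a * \<phi> n x + b * \<psi> n x) \<in> test_functions U" for n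
    using \<phi> \<psi> by (intro test_functions_add test_functions_mult[OF _ smooth_const])
  moreover have "(\<lambda>x. a * u x + b * v x) \<in> H1 U"
    using subspace_lincomb[OF subspace_H1[OF U]] u v H10_H1 by blast
  ultimately show "(\<lambda>x. a * u x + b * v x) \<in> H10 U"
    unfolding H10_def by (auto intro!: exI[of _ "\<lambda>n x. a * \<phi> n x + b * \<psi> n x"])
qed

section \<open>Continuous piecewise affine functions\<close>

lemma Vh_H10: "v \<in> Vh U T \<Longrightarrow> v \<in> H10 U" and Vh_H1: "v \<in> Vh U T \<Longrightarrow> v \<in> H1 U"
  and Vh_continuous: "v \<in> Vh U T \<Longrightarrow> continuous_on (closure U) v"
  by (auto simp: Vh_def H10_def)

lemma subspace_Vh:
  assumes U: "open U" "bounded U"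
  shows "subspace (Vh U T)"
proof (rule subspace_lincombI)
  show "(\<lambda>x. 0) \<in> Vh U T"
    using subspace_0[OF subspace_H10[OF U]] by (auto simp: Vh_def zero_fun_def intro!: exI[of _ 0])
  fix f g a b assume f: "f \<in> Vh U T" and g: "g \<in> Vh U T"
  have "\<exists>d e. \<forall>x\<in>K. a * f x + b * g x = d \<bullet> x + e" if K: "K \<in> T" for K
  proof -
    obtain d e d' e' where "\<forall>x\<in>K. f x = d \<bullet> x + e" "\<forall>x\<in>K. g x = d' \<bullet> x + e'"
      using f g K unfolding Vh_def by blast
    then have "\<forall>x\<in>K. a * f x + b * g x = (a *\<^sub>R d + b *\<^sub>R d') \<bullet> x + (a * e + b * e')"
      by (auto simp: inner_add_left algebra_simps)
    then show ?thesis by blast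
  qed
  then show "(\<lambda>x. a * f x + b * g x) \<in> Vh U T"
    using f g subspace_lincomb[OF subspace_H10[OF U]]
    by (auto simp: Vh_def intro!: continuous_intros)
qed

text \<open>Passes from almost everywhere to everywhere, since members of \<open>V\<^sub>h\<close> are compared pointwise.\<close>

lemma continuous_AE_zero_imp_zero:
  assumes "open U" "continuous_on (closure U) v" "AE x in lebesgue_on U. v x = 0" "x \<in> closure U"
  shows "v x = (0::real)"
proof (rule continuous_constant_on_closure[OF assms(2) _ assms(4)])
  have "AE x in lebesgue. x \<in> U \<longrightarrow> v x = 0"
    using assms(1,3) by (simp add: AE_restrict_space_iff)
  then have ae: "AE x\<in>U in lebesgue. x \<in> {x \<in> closure U. v x = 0}"
    by eventually_elim (use closure_subset in auto)
  have "closed {x \<in> closure U. v x = 0}"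
    using assms(2) by (intro continuous_closed_preimage_constant) auto
  then show "v x = 0" if "x \<in> U" for x
    using mem_closed_if_AE_lebesgue_open[OF assms(1) _ ae that] by simp
qed

text \<open>The Poincare inequality makes the energy seminorm definite on \<open>V\<^sub>h\<close>.\<close>

lemma Vh_seminorm_zero:
  assumes U: "open U" "bounded U" and v: "v \<in> Vh U T" "grad_inner U v v = 0" and x: "x \<in> closure U"
  shows "v x = 0"
proof (rule continuous_AE_zero_imp_zero[OF U(1) Vh_continuous[OF v(1)] _ x])
  obtain C where "\<forall>u\<in>H10 U. L2_norm (lebesgue_on U) u \<le> C * H1_seminorm U u"
    using Poincare_H10[OF U] by blast
  then have "L2_norm (lebesgue_on U) v \<le> 0" using v Vh_H10[OF v(1)] by (auto simp: H1_seminorm_eq)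
  then have "(LINT x|lebesgue_on U. (v x)\<^sup>2) = 0"
    by (auto simp: L2_norm_def intro: antisym)
  moreover have "integrable (lebesgue_on U) (\<lambda>x. (v x)\<^sup>2)"
    using H1_L2[OF Vh_H1[OF v(1)]] by (simp add: L2_def)
  ultimately show "AE x in lebesgue_on U. v x = 0"
    using integral_nonneg_eq_0_iff_AE[of "lebesgue_on U" "\<lambda>x. (v x)\<^sup>2"] by simp
qed

text \<open>The values at the vertices of the mesh are coordinates of \<open>V\<^sub>h\<close>: an affine function that vanishes at the extreme
points of a triangle vanishes on their convex hull.\<close>

lemma Vh_zero_of_vertices:
  assumes T: "\<And>K. K \<in> T \<Longrightarrow> polytope K" "\<Union>T = closure U" and v: "v \<in> Vh U T"
    and zero: "\<And>K x. K \<in> T \<Longrightarrow> x extreme_point_of K \<Longrightarrow> v x = 0" and x: "x \<in> closure U"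
  shows "v x = 0"
proof -
  obtain K where K: "K \<in> T" "x \<in> K" using T(2) x by blast
  obtain a c where ac: "\<forall>x\<in>K. v x = a \<bullet> x + c" using v K(1) unfolding Vh_def by blast
  let ?X = "{x. x extreme_point_of K}"
  have "K = convex hull ?X"
    using T(1)[OF K(1)] by (intro Krein_Milman_Minkowski polytope_imp_compact polytope_imp_convex)
  moreover have "?X \<subseteq> {x. a \<bullet> x = - c}"
  proof
    fix y assume "y \<in> ?X"
    then have "y \<in> K" "v y = 0" using zero[OF K(1)] by (auto simp: extreme_point_of_def)
    then show "y \<in> {x. a \<bullet> x = - c}" using ac by auto
  qed
  then have "convex hull ?X \<subseteq> {x. a \<bullet> x = - c}" by (intro hull_minimal convex_hyperplane)
  ultimately have "a \<bullet> x = - c" using K(2) by blast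
  then show ?thesis using ac K(2) by simp
qed

section \<open>The arc length measure\<close>

lemma sets_arclength: "sets (arclength G) = sets (restrict_space borel (segments G))"
  unfolding arclength_def
  by (intro sets_restrict_space_cong) (simp add: sets.sigma_sets_eq[of borel, simplified])

lemma space_arclength: "space (arclength G) = segments G"
  using sets_eq_imp_space_eq[OF sets_arclength] by (simp add: space_restrict_space)

lemma compact_segments: "finite G \<Longrightarrow> compact (segments G)"
  unfolding segments_def by (intro compact_UN) auto

lemma borel_segments: "finite G \<Longrightarrow> segments G \<in> sets borel"
  by (simp add: compact_segments borel_closed compact_imp_closed)

lemma sets_arclength_closed:
  "finite G \<Longrightarrow> closed A \<Longrightarrow> A \<subseteq> segments G \<Longrightarrow> A \<in> sets (arclength G)"
  by (simp add: sets_arclength sets_restrict_space_iff borel_segments borel_closed)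

lemma emeasure_segment_measure_le: "emeasure (segment_measure a b) A \<le> ennreal (dist a b)"
proof -
  have m[measurable]: "linepath a b \<in> borel_measurable borel"
    by (intro borel_measurable_continuous_onI continuous_on_linepath)
  have "emeasure (segment_measure a b) A \<le> emeasure (segment_measure a b) (space (segment_measure a b))"
    by (rule emeasure_space)
  also have "\<dots> = (\<integral>\<^sup>+t. ennreal (dist a b) * indicator {0..1} (t::real) \<partial>lborel)"
    unfolding segment_measure_def by (subst emeasure_distr) (auto simp: emeasure_density)
  also have "\<dots> = ennreal (dist a b)" by (simp add: nn_integral_cmult)
  finally show ?thesis .
qed

lemma finite_measure_arclength:
  assumes "finite G"
  shows "finite_measure (arclength G)"
proof
  have "emeasure (arclength G) (segments G) = (\<Sum>(a, b)\<in>G. emeasure (segment_measure a b) (segments G))"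
    by (rule emeasure_arclength[OF assms borel_segments[OF assms] order_refl])
  also have "\<dots> \<le> (\<Sum>(a, b)\<in>G. ennreal (dist a b))"
    by (intro sum_mono) (auto simp: emeasure_segment_measure_le)
  also have "\<dots> < \<infinity>" by (simp add: case_prod_beta sum_ennreal)
  finally show "emeasure (arclength G) (space (arclength G)) \<noteq> \<infinity>" by (simp add: space_arclength)
qed

text \<open>Ensures that the constant multiplier \<open>1\<close> is not identified with zero.\<close>

lemma arclength_nonnull:
  assumes "finite G" "(a, b) \<in> G" "a \<noteq> b"
  shows "\<not> (AE x in arclength G. False)"
proof
  assume "AE x in arclength G. False"
  then have "emeasure (arclength G) (segments G) = 0"
    using AE_iff_measurable[of "segments G" "arclength G" "\<lambda>x. False"] sets.top[of "arclength G"]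
    by (simp add: space_arclength)
  moreover have "emeasure (segment_measure a b) (closed_segment a b)
      \<le> (\<Sum>(a, b)\<in>G. emeasure (segment_measure a b) (segments G))"
  proof -
    have "closed_segment a b \<subseteq> segments G" using assms(2) by (auto simp: segments_def)
    then have "emeasure (segment_measure a b) (closed_segment a b) \<le> emeasure (segment_measure a b) (segments G)"
      using borel_segments[OF assms(1)] by (intro emeasure_mono) (auto simp: segment_measure_def)
    also have "\<dots> \<le> (\<Sum>(a, b)\<in>G. emeasure (segment_measure a b) (segments G))"
      using member_le_sum[OF assms(2), of "\<lambda>(a, b). emeasure (segment_measure a b) (segments G)"] assms(1) by simp
    finally show ?thesis .
  qed
  ultimately show False
    using assms(3) emeasure_arclength[OF assms(1) borel_segments[OF assms(1)] order_refl]
    by (simp add: emeasure_segment_measure_closed_segment)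
qed

lemma continuous_L2_arclength:
  assumes "finite G" "continuous_on (segments G) v"
  shows "v \<in> L2 (arclength G)"
proof -
  have "bounded (v ` segments G)"
    by (intro compact_imp_bounded compact_continuous_image assms compact_segments)
  then obtain B where "\<forall>y\<in>v ` segments G. norm y \<le> B" unfolding bounded_iff by auto
  moreover have "v \<in> borel_measurable (arclength G)"
    using borel_measurable_continuous_on_restrict[OF assms(2)] by (simp add: measurable_cong_sets[OF sets_arclength refl])
  ultimately show ?thesis
    by (intro L2_bounded[OF finite_measure_arclength[OF assms(1)], of _ B]) (auto simp: space_arclength)
qed

lemma smooth_L2_arclength: "finite G \<Longrightarrow> smooth \<phi> \<Longrightarrow> \<phi> \<in> L2 (arclength G)"
  by (intro continuous_L2_arclength smooth_continuous)

lemma pairing_eq_L2_inner: "pairing G l v = L2_inner (arclength G) l v"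
  by (simp add: pairing_def L2_inner_def)

lemma pairing_commute: "pairing G p q = pairing G q p"
  by (simp add: pairing_def mult.commute)

lemma pairing_linear_right: "l \<in> L2 (arclength G) \<Longrightarrow> linear_on (L2 (arclength G)) (pairing G l)"
  using semi_inner_linear_right[OF semi_inner_L2] by (simp add: pairing_eq_L2_inner[abs_def])

lemma pairing_linear_left: "v \<in> L2 (arclength G) \<Longrightarrow> linear_on (L2 (arclength G)) (\<lambda>l. pairing G l v)"
  using semi_inner_L2[of "arclength G"] by (simp add: pairing_eq_L2_inner semi_inner_def)

lemma pairing_AE_zero_left: "AE x in arclength G. l x = 0 \<Longrightarrow> pairing G l v = 0"
  unfolding pairing_def by (rule integral_eq_zero_AE) auto

text \<open>The fundamental lemma for arc length: smooth functions separate multipliers.\<close>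

lemma AE_zero_of_smooth_pairing:
  assumes G: "finite G" and l: "l \<in> L2 (arclength G)"
    and zero: "\<And>\<phi>. smooth \<phi> \<Longrightarrow> pairing G l \<phi> = 0"
  shows "AE x in arclength G. l x = 0"
proof (rule integral_test_functions_zero_imp_AE_zero[of UNIV])
  show "integrable (arclength G) l" using l G by (intro L2_integrable finite_measure_arclength)
  show "sets (arclength G) = sets (restrict_space borel (space (arclength G)))"
    by (simp add: sets_arclength space_arclength)
qed (use zero test_functionsD(1) in \<open>auto simp: pairing_def\<close>)

section \<open>The stabilisation form\<close>

text \<open>The fluctuation \<open>l - P l\<close>, cut off outside the edge \<open>e\<close>.\<close>

definition fluctuation :: "(plane \<times> plane) set \<Rightarrow> plane set \<Rightarrow> (plane \<Rightarrow> real) \<Rightarrow> plane \<Rightarrow> real" where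
  "fluctuation G e l x = indicator e x * (l x - edge_mean G e l)"

lemma L2_indicator_mult:
  assumes "f \<in> L2 M" "A \<in> sets M"
  shows "(\<lambda>x. indicator A x * f x) \<in> L2 M"
proof (rule L2_I)
  show "(\<lambda>x. indicator A x * f x) \<in> borel_measurable M" using assms by (auto simp: L2_def)
  have "integrable M (\<lambda>x. indicator A x *\<^sub>R (f x)\<^sup>2)"
    using assms by (intro integrable_mult_indicator) (auto simp: L2_def)
  moreover have "(\<lambda>x. indicator A x *\<^sub>R (f x)\<^sup>2) = (\<lambda>x. (indicator A x * f x)\<^sup>2)"
    by (auto simp: indicator_def)
  ultimately show "integrable M (\<lambda>x. (indicator A x * f x)\<^sup>2)" by simp
qed

lemma set_integral_linear:
  assumes "finite G" "e \<in> sets (arclength G)"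
  shows "linear_on (L2 (arclength G)) (\<lambda>l. LINT x:e|arclength G. l x)"
proof -
  let ?M = "arclength G"
  have "integrable ?M (\<lambda>x. indicator e x * f x)" if "f \<in> L2 ?M" for f
    using L2_integrable[OF finite_measure_arclength[OF assms(1)] L2_indicator_mult[OF that assms(2)]] .
  then show ?thesis unfolding linear_on_def set_lebesgue_integral_def
    by (auto simp: distrib_left mult.left_commute)
qed

text \<open>On each edge the form is the \<open>L\<^sup>2\<close> inner product of fluctuations, hence a pullback of a semi-inner product along a
linear map.\<close>

lemma semi_inner_stab:
  assumes G: "finite G" and Cs: "Cs > 0" and E: "\<And>e. e \<in> E \<Longrightarrow> compact e \<and> e \<subseteq> segments G"
    and fin: "finite E"
  shows "semi_inner (L2 (arclength G)) (stab G E Cs)"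
proof -
  let ?M = "arclength G"
  have eq: "stab G E Cs = (\<lambda>l m. \<Sum>e\<in>E. Cs * diameter e * L2_inner ?M (fluctuation G e l) (fluctuation G e m))"
    unfolding stab_def set_lebesgue_integral_def L2_inner_def fluctuation_def
    by (intro ext sum.cong arg_cong2[where f = "(*)"] refl Bochner_Integration.integral_cong) (auto simp: indicator_def)
  show ?thesis unfolding eq
  proof (rule semi_inner_sum[OF fin subspace_L2])
    fix e assume e: "e \<in> E"
    have es: "e \<in> sets ?M" using E[OF e] G by (intro sets_arclength_closed) (auto simp: compact_imp_closed)
    note lin = set_integral_linear[OF G es]
    have m: "edge_mean G e (f + g) = edge_mean G e f + edge_mean G e g" "edge_mean G e (r *\<^sub>R f) = r * edge_mean G e f"
      if "f \<in> L2 ?M" "g \<in> L2 ?M" for f g r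
      using linear_on_add[OF lin that] linear_on_scale[OF lin that(1), of r]
      by (simp_all add: edge_mean_def add_divide_distrib)
    show "semi_inner (L2 ?M) (\<lambda>l m. Cs * diameter e * L2_inner ?M (fluctuation G e l) (fluctuation G e m))"
    proof (rule semi_inner_pullback[OF semi_inner_L2 subspace_L2])
      show "0 \<le> Cs * diameter e" using Cs E[OF e] by (simp add: diameter_ge_0 compact_imp_bounded)
      show "fluctuation G e f \<in> L2 ?M" if f: "f \<in> L2 ?M" for f
      proof -
        have "(\<lambda>x. 1) \<in> L2 ?M" using G by (intro continuous_L2_arclength continuous_intros)
        from L2_lincomb[OF f this, of 1 "- edge_mean G e f"]
        have "(\<lambda>x. f x - edge_mean G e f) \<in> L2 ?M" by simp
        then show ?thesis unfolding fluctuation_def[abs_def] using es by (rule L2_indicator_mult)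
      qed
      show "fluctuation G e (f + g) = fluctuation G e f + fluctuation G e g" if "f \<in> L2 ?M" "g \<in> L2 ?M" for f g
        using m(1)[OF that] by (auto simp: fluctuation_def algebra_simps)
      show "fluctuation G e (r *\<^sub>R f) = r *\<^sub>R fluctuation G e f" if "f \<in> L2 ?M" for r f
        using m(2)[OF that that] by (auto simp: fluctuation_def algebra_simps)
    qed
  qed
qed

lemma stab_AE_zero:
  assumes "AE x in arclength G. l x = 0"
  shows "stab G E Cs l m = 0"
proof -
  let ?M = "arclength G"
  have "edge_mean G e l = 0" for e
  proof -
    have "AE x in ?M. indicator e x *\<^sub>R l x = 0" using assms by eventually_elim simp
    then show ?thesis by (simp add: edge_mean_def set_lebesgue_integral_def integral_eq_zero_AE)
  qed
  then have "(LINT x:e|?M. (l x - edge_mean G e l) * (m x - edge_mean G e m)) = 0" for e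
    unfolding set_lebesgue_integral_def using assms by (intro integral_eq_zero_AE) auto
  then show ?thesis by (simp add: stab_def)
qed

section \<open>The partition induced on the boundary\<close>

text \<open>The intersection of a segment with a mesh edge is a polytope and has finitely many extreme points.\<close>

lemma finite_extreme_points_of_Int_edges:
  assumes "polytope S" "polytope K"
  shows "finite {x. \<exists>E. E edge_of K \<and> x extreme_point_of (S \<inter> E)}"
proof -
  have "{x. \<exists>E. E edge_of K \<and> x extreme_point_of (S \<inter> E)}
      \<subseteq> (\<Union>E\<in>{E. E face_of K}. {x. x extreme_point_of (S \<inter> E)})"
    by (auto simp: edge_of_def)
  moreover have "finite {x. x extreme_point_of (S \<inter> E)}" if "E face_of K" for E
    using assms(1) face_of_polytope_polytope[OF assms(2) that]
    by (intro finite_polyhedron_extreme_points polyhedron_Int polytope_imp_polyhedron)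
  then have "finite (\<Union>E\<in>{E. E face_of K}. {x. x extreme_point_of (S \<inter> E)})"
    using finite_polytope_faces[OF assms(2)] by auto
  ultimately show ?thesis by (rule finite_subset)
qed

lemma finite_induced_vertices:
  assumes "finite G" "finite T" "\<And>K. K \<in> T \<Longrightarrow> polytope K"
  shows "finite (induced_vertices G T)"
proof -
  have "polytope (closed_segment a b)" for a b :: plane
    unfolding segment_convex_hull by (intro polytope_convex_hull) auto
  then have "finite {x. \<exists>E. E edge_of K \<and> x extreme_point_of (closed_segment a b \<inter> E)}" if "K \<in> T" for a b K
    using assms(3)[OF that] by (intro finite_extreme_points_of_Int_edges)
  then have "finite (\<Union>(a, b)\<in>G. \<Union>K\<in>T. {x. \<exists>E. E edge_of K \<and> x extreme_point_of (closed_segment a b \<inter> E)})"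
    using assms(1,2) by auto
  moreover have "induced_vertices G T = (\<Union>(a, b)\<in>G. \<Union>K\<in>T. {x. \<exists>E. E edge_of K \<and> x extreme_point_of (closed_segment a b \<inter> E)}) \<union> corners G"
    unfolding induced_vertices_def by blast
  moreover have "finite (corners G)" using assms(1) by (simp add: corners_def)
  ultimately show ?thesis by simp
qed

lemma finite_induced_partition:
  assumes "finite (induced_vertices G T)"
  shows "finite (induced_partition G T)"
proof (rule finite_subset)
  show "induced_partition G T \<subseteq> (\<lambda>(p, q). closed_segment p q) ` (induced_vertices G T \<times> induced_vertices G T)"
    unfolding induced_partition_def by auto
qed (use assms in auto)

text \<open>For \<open>t > l\<close> take the last element before \<open>t\<close> and the first one from \<open>t\<close> on. At the left end
\<open>t = l\<close> there is nothing before \<open>t\<close>, and the bracket starts at \<open>l\<close> itself.\<close>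

lemma consecutive_bracket:
  fixes t :: "'a::linorder"
  assumes S: "finite S" "l \<in> S" "r \<in> S" and t: "l \<le> t" "t \<le> r" "l < r"
  obtains p q where "p \<in> S" "q \<in> S" "p < q" "p \<le> t" "t \<le> q" "\<And>s. s \<in> S \<Longrightarrow> \<not> (p < s \<and> s < q)"
proof (cases "l < t")
  case True
  let ?P = "{s \<in> S. s < t}" and ?Q = "{s \<in> S. t \<le> s}"
  have fin: "finite ?P" "?P \<noteq> {}" "finite ?Q" "?Q \<noteq> {}" using S t True by auto
  show thesis
  proof (rule that[of "Max ?P" "Min ?Q"])
    have P: "Max ?P \<in> ?P" using fin by (intro Max_in)
    have Q: "Min ?Q \<in> ?Q" using fin by (intro Min_in)
    show "Max ?P \<in> S" "Min ?Q \<in> S" "Max ?P < Min ?Q" "Max ?P \<le> t" "t \<le> Min ?Q" using P Q by auto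
    fix s assume "s \<in> S"
    then show "\<not> (Max ?P < s \<and> s < Min ?Q)"
      using Max_ge[OF fin(1), of s] Min_le[OF fin(3), of s] by (cases "s < t") (auto simp: not_less)
  qed
next
  case False
  let ?Q = "{s \<in> S. l < s}"
  have fin: "finite ?Q" "?Q \<noteq> {}" using S t by auto
  show thesis
  proof (rule that[of l "Min ?Q"])
    have Q: "Min ?Q \<in> ?Q" using fin by (intro Min_in)
    show "l \<in> S" "Min ?Q \<in> S" "l < Min ?Q" "l \<le> t" "t \<le> Min ?Q" using Q S t False by auto
    fix s assume "s \<in> S"
    then show "\<not> (l < s \<and> s < Min ?Q)" using Min_le[OF fin(1), of s] by auto
  qed
qed

lemma linepath_compose_linepath: "linepath (linepath a b p) (linepath a b q) u = linepath a b ((1 - u) * p + u * q)"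
  by (simp add: linepath_def algebra_simps)

text \<open>In the arc parameter of a side, the induced vertices are a finite set that contains both end points. Every
parameter lies between two consecutive elements of it, and these bound an element of the partition.\<close>

lemma induced_partition_covers:
  assumes G: "\<forall>(a, b)\<in>G. a \<noteq> b" and fin: "finite (induced_vertices G T)" and x: "x \<in> segments G"
  shows "\<exists>e\<in>induced_partition G T. x \<in> e"
proof -
  let ?V = "induced_vertices G T"
  obtain a b where ab: "(a, b) \<in> G" "x \<in> closed_segment a b" using x by (auto simp: segments_def)
  then have "a \<noteq> b" using G by auto
  let ?l = "linepath a b"
  obtain t where t: "0 \<le> t" "t \<le> 1" "x = ?l t"
    using ab(2) linepath_image_01[of a b] by fastforce
  have inj: "inj ?l"
  proof (rule injI)
    fix s t assume "?l s = ?l t"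
    then have "(s - t) *\<^sub>R (b - a) = 0" by (simp add: linepath_def algebra_simps)
    then show "s = t" using \<open>a \<noteq> b\<close> by simp
  qed
  define S where "S = {s. ?l s \<in> ?V} \<inter> {0..1}"
  have "finite {s. ?l s \<in> ?V}" using finite_vimageI[OF fin inj] by (simp add: vimage_def)
  then have "finite S" by (simp add: S_def)
  have "a \<in> corners G" "b \<in> corners G" using ab(1) by (auto simp: corners_def image_iff Bex_def)
  then have "0 \<in> S" "1 \<in> S" by (auto simp: S_def induced_vertices_def linepath_0' linepath_1')
  then obtain p q where pq: "p \<in> S" "q \<in> S" "p < q" "p \<le> t" "t \<le> q" "\<And>s. s \<in> S \<Longrightarrow> \<not> (p < s \<and> s < q)"
    using consecutive_bracket[OF \<open>finite S\<close>, of 0 1 t] t(1,2) by auto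
  have p01: "0 \<le> p" "q \<le> 1" using pq(1,2) by (auto simp: S_def)
  have between: "p \<le> (1 - u) * p + u * q" "(1 - u) * p + u * q \<le> q" if "0 \<le> u" "u \<le> 1" for u
  proof -
    have "u * p \<le> u * q" "(1 - u) * p \<le> (1 - u) * q" using that pq(3) by (auto intro: mult_left_mono)
    then show "p \<le> (1 - u) * p + u * q" "(1 - u) * p + u * q \<le> q" by (auto simp: algebra_simps)
  qed
  have sbetween: "p < (1 - u) * p + u * q" "(1 - u) * p + u * q < q" if "0 < u" "u < 1" for u
  proof -
    have "u * p < u * q" "(1 - u) * p < (1 - u) * q" using that pq(3) by (auto intro: mult_strict_left_mono)
    then show "p < (1 - u) * p + u * q" "(1 - u) * p + u * q < q" by (auto simp: algebra_simps)
  qed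
  have "closed_segment (?l p) (?l q) \<in> induced_partition G T"
    unfolding induced_partition_def
  proof (intro CollectI exI conjI)
    show "?l p \<noteq> ?l q" using inj pq(3) by (auto dest: injD)
    show "?l p \<in> ?V" "?l q \<in> ?V" using pq(1,2) by (auto simp: S_def)
    show "\<exists>(a, b)\<in>G. closed_segment (?l p) (?l q) \<subseteq> closed_segment a b"
    proof (rule bexI[OF _ ab(1)], simp, rule subsetI)
      fix y assume "y \<in> closed_segment (?l p) (?l q)"
      then obtain u where u: "0 \<le> u" "u \<le> 1" "y = linepath (?l p) (?l q) u"
        by (auto simp: linepath_image_01[symmetric])
      then show "y \<in> closed_segment a b"
        using between[OF u(1,2)] p01 by (simp add: linepath_compose_linepath linepath_in_path)
    qed
    show "open_segment (?l p) (?l q) \<inter> ?V = {}"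
    proof (rule ccontr)
      assume "open_segment (?l p) (?l q) \<inter> ?V \<noteq> {}"
      then obtain y where y: "y \<in> open_segment (?l p) (?l q)" "y \<in> ?V" by blast
      then obtain u where u: "0 < u" "u < 1" "y = linepath (?l p) (?l q) u"
        by (auto simp: in_segment linepath_def)
      then have "(1 - u) * p + u * q \<in> S"
        using y(2) sbetween[OF u(1,2)] p01 by (simp add: S_def linepath_compose_linepath)
      then show False using pq(6) sbetween[OF u(1,2)] by blast
    qed
  qed (rule refl)
  moreover have "x \<in> closed_segment (?l p) (?l q)"
  proof -
    define u where "u = (t - p) / (q - p)"
    have "0 \<le> u" "u \<le> 1" using pq(3-5) by (auto simp: u_def)
    moreover have "(1 - u) * p + u * q = t"
    proof -
      have "u * (q - p) = t - p" using pq(3) by (simp add: u_def)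
      then show ?thesis by (simp add: algebra_simps)
    qed
    ultimately show ?thesis
      using linepath_in_path[of u "?l p" "?l q"] by (simp add: linepath_compose_linepath t(3))
  qed
  ultimately show ?thesis by blast
qed

section \<open>Piecewise constant multipliers\<close>

lemma Lh_L2: "l \<in> Lh G T \<Longrightarrow> l \<in> L2 (arclength G)"
  by (simp add: Lh_def)

lemma subspace_Lh: "subspace (Lh G T)"
proof (rule subspace_lincombI)
  show "(\<lambda>x. 0) \<in> Lh G T" by (auto simp: Lh_def L2_zero)
  fix f g a b assume f: "f \<in> Lh G T" and g: "g \<in> Lh G T"
  have "\<exists>c. AE x in arclength G. x \<in> e \<longrightarrow> a * f x + b * g x = c" if e: "e \<in> induced_partition G T" for e
  proof -
    obtain c where "AE x in arclength G. x \<in> e \<longrightarrow> f x = c" using f e by (auto simp: Lh_def)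
    moreover obtain d where "AE x in arclength G. x \<in> e \<longrightarrow> g x = d" using g e by (auto simp: Lh_def)
    ultimately have "AE x in arclength G. x \<in> e \<longrightarrow> a * f x + b * g x = a * c + b * d"
      by eventually_elim auto
    then show ?thesis by blast
  qed
  then show "(\<lambda>x. a * f x + b * g x) \<in> Lh G T"
    using L2_lincomb[OF Lh_L2[OF f] Lh_L2[OF g]] by (auto simp: Lh_def)
qed

lemma const_Lh: "finite G \<Longrightarrow> (\<lambda>x. c) \<in> Lh G T"
  by (auto simp: Lh_def intro!: continuous_L2_arclength continuous_intros)

lemma induced_partition_compact:
  "e \<in> induced_partition G T \<Longrightarrow> compact e \<and> e \<subseteq> segments G"
  by (auto simp: induced_partition_def segments_def)

text \<open>The integrals over the edges of the induced partition are coordinates of \<open>\<Lambda>\<^sub>h\<close>: if the integral of a constant over an edge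
vanishes, then the constant is zero or the edge is a null set.\<close>

lemma Lh_AE_zero:
  assumes G: "finite G" "\<forall>(a, b)\<in>G. a \<noteq> b" and fin: "finite (induced_vertices G T)"
    and l: "l \<in> Lh G T" and zero: "\<And>e. e \<in> induced_partition G T \<Longrightarrow> (LINT x:e|arclength G. l x) = 0"
  shows "AE x in arclength G. l x = 0"
proof -
  let ?M = "arclength G"
  have "AE x in ?M. x \<in> e \<longrightarrow> l x = 0" if e: "e \<in> induced_partition G T" for e
  proof -
    have es: "e \<in> sets ?M"
      using induced_partition_compact[OF e] G(1) by (intro sets_arclength_closed) (auto simp: compact_imp_closed)
    have efin: "emeasure ?M e \<noteq> \<infinity>" using finite_measure.emeasure_finite[OF finite_measure_arclength[OF G(1)]] by simp
    obtain c where c: "AE x in ?M. x \<in> e \<longrightarrow> l x = c" using l e by (auto simp: Lh_def)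
    have "(LINT x:e|?M. l x) = (LINT x:e|?M. c)"
      unfolding set_lebesgue_integral_def
    proof (rule integral_cong_AE)
      show "(\<lambda>x. indicator e x *\<^sub>R l x) \<in> borel_measurable ?M"
        using es L2_measurable[OF Lh_L2[OF l]] by measurable
      show "(\<lambda>x. indicator e x *\<^sub>R c) \<in> borel_measurable ?M"
        using es by measurable
      show "AE x in ?M. indicator e x *\<^sub>R l x = indicator e x *\<^sub>R c"
        using c by eventually_elim (auto simp: indicator_def)
    qed
    also have "\<dots> = measure ?M e * c"
      using es efin by (simp add: set_lebesgue_integral_def less_top)
    finally have "measure ?M e = 0 \<or> c = 0" using zero[OF e] by simp
    then show ?thesis
    proof
      assume "measure ?M e = 0"
      then have "e \<in> null_sets ?M" using es efin by (simp add: null_sets_def measure_def enn2real_eq_0_iff)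
      then have "AE x in ?M. x \<notin> e" by (rule AE_not_in)
      then show ?thesis by eventually_elim auto
    next
      assume "c = 0" then show ?thesis using c by simp
    qed
  qed
  then have "AE x in ?M. \<forall>e\<in>induced_partition G T. x \<in> e \<longrightarrow> l x = 0"
    by (intro AE_finite_allI finite_induced_partition fin)
  then show ?thesis
    using AE_space
  proof eventually_elim
    case (elim x)
    then show ?case using induced_partition_covers[OF G(2) fin, of x] by (auto simp: space_arclength)
  qed
qed

section \<open>Traces and the dual norm\<close>

lemma is_trace_lincomb:
  assumes U: "open U" "bounded U" and t: "is_trace U G u p" "is_trace U G v q"
    and smooth_L2_G: "\<And>\<phi>. smooth \<phi> \<Longrightarrow> \<phi> \<in> L2 (arclength G)"
  shows "is_trace U G (\<lambda>x. a * u x + b * v x) (\<lambda>x. a * p x + b * q x)"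
proof -
  note t' = t[unfolded is_trace_def]
  obtain \<phi> where \<phi>: "\<And>n. smooth (\<phi> n)" "(\<lambda>n::nat. H1_norm U (\<lambda>x. \<phi> n x - u x)) \<longlonglongrightarrow> 0"
    "(\<lambda>n. L2_norm (arclength G) (\<lambda>x. \<phi> n x - p x)) \<longlonglongrightarrow> 0" using t'(1) by blast
  obtain \<psi> where \<psi>: "\<And>n. smooth (\<psi> n)" "(\<lambda>n::nat. H1_norm U (\<lambda>x. \<psi> n x - v x)) \<longlonglongrightarrow> 0"
    "(\<lambda>n. L2_norm (arclength G) (\<lambda>x. \<psi> n x - q x)) \<longlonglongrightarrow> 0" using t'(2) by blast
  have mem: "u \<in> H1 U" "v \<in> H1 U" "p \<in> L2 (arclength G)" "q \<in> L2 (arclength G)" using t' by auto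
  have "(\<lambda>n. H1_norm U (\<lambda>x. a * \<phi> n x + b * \<psi> n x - (a * u x + b * v x))) \<longlonglongrightarrow> 0"
    unfolding H1_norm_eq
    by (rule semi_inner_lincomb_tendsto[OF semi_inner_H1[OF U] _ _ mem(1,2) \<phi>(2)[unfolded H1_norm_eq] \<psi>(2)[unfolded H1_norm_eq]])
      (use \<phi> \<psi> in \<open>auto intro: smooth_H1[OF U]\<close>)
  moreover have "(\<lambda>n. L2_norm (arclength G) (\<lambda>x. a * \<phi> n x + b * \<psi> n x - (a * p x + b * q x))) \<longlonglongrightarrow> 0"
    unfolding L2_norm_eq
    by (rule semi_inner_lincomb_tendsto[OF semi_inner_L2 _ _ mem(3,4) \<phi>(3)[unfolded L2_norm_eq] \<psi>(3)[unfolded L2_norm_eq]])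
      (use \<phi> \<psi> smooth_L2_G in auto)
  moreover have "smooth (\<lambda>x. a * \<phi> n x + b * \<psi> n x)" for n
    using \<phi>(1) \<psi>(1) by (intro smooth_add smooth_scale)
  ultimately show ?thesis
    unfolding is_trace_def using mem subspace_lincomb[OF subspace_H1[OF U]] L2_lincomb[OF mem(3,4)]
    by (intro conjI exI[of _ "\<lambda>n x. a * \<phi> n x + b * \<psi> n x"]) auto
qed

text \<open>A constant approximating sequence suffices, because the norms of the zero function vanish.\<close>

lemma is_trace_smooth:
  assumes "open U" "bounded U" "finite G" "smooth \<phi>"
  shows "is_trace U G \<phi> \<phi>"
  using assms unfolding is_trace_def
  by (auto simp: smooth_H1 smooth_L2_arclength H1_norm_zero L2_norm_def intro!: exI[of _ "\<lambda>n. \<phi>"])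

lemma Hhalf_diff:
  assumes "open U" "bounded U" "finite G" "p \<in> Hhalf U G" "q \<in> Hhalf U G"
  shows "(\<lambda>x. p x - q x) \<in> Hhalf U G"
proof -
  obtain u v where "is_trace U G u p" "is_trace U G v q" using assms(4,5) by (auto simp: Hhalf_def)
  from is_trace_lincomb[OF assms(1,2) this smooth_L2_arclength[OF assms(3)], of 1 "-1"]
  show ?thesis by (auto simp: Hhalf_def)
qed

lemma Hhalf_L2: "q \<in> Hhalf U G \<Longrightarrow> q \<in> L2 (arclength G)"
  by (auto simp: Hhalf_def is_trace_def)

lemma Hhalf_norm_nonneg: "q \<in> Hhalf U G \<Longrightarrow> 0 \<le> Hhalf_norm U G q"
  unfolding Hhalf_norm_def by (rule cInf_greatest) (auto simp: Hhalf_def H1_norm_def)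

text \<open>The supremum that defines the dual norm ranges over nonnegative quotients, but over the empty set it is \<open>-\<infinity>\<close>.\<close>

lemma Hmhalf_norm_cases: "Hmhalf_norm U G F = -\<infinity> \<or> 0 \<le> Hmhalf_norm U G F"
proof (cases "{q \<in> Hhalf U G. \<not> (AE x in arclength G. q x = 0)} = {}")
  case True
  then show ?thesis unfolding Hmhalf_norm_def True by (simp add: bot_ereal_def)
next
  case False
  then obtain q where q: "q \<in> Hhalf U G" "\<not> (AE x in arclength G. q x = 0)" by blast
  have "0 \<le> ereal \<bar>F q\<bar> / ereal (Hhalf_norm U G q)"
    using Hhalf_norm_nonneg[OF q(1)] by (simp add: divide_ereal_def)
  also have "\<dots> \<le> Hmhalf_norm U G F"
    unfolding Hmhalf_norm_def using q by (intro SUP_upper) auto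
  finally show ?thesis ..
qed

text \<open>The duality estimate. If the trace norm of \<open>q\<close> were zero but the pairing not, the quotient in the
definition of the dual norm would be \<open>\<infinity>\<close>, contrary to the bound \<open>N\<close>.\<close>

lemma pairing_le_Hmhalf_norm:
  assumes q: "q \<in> Hhalf U G" and N: "Hmhalf_norm U G (pairing G l) \<le> ereal N" "0 \<le> N"
  shows "\<bar>pairing G l q\<bar> \<le> N * Hhalf_norm U G q"
proof (cases "(AE x in arclength G. q x = 0) \<or> pairing G l q = 0")
  case True
  have "pairing G l q = 0"
  proof (cases "pairing G l q = 0")
    case False
    then have "AE x in arclength G. l x * q x = 0" using True by auto
    then show ?thesis by (simp add: pairing_def integral_eq_zero_AE)
  qed
  then show ?thesis using N(2) Hhalf_norm_nonneg[OF q] by simp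
next
  case False
  let ?F = "\<bar>pairing G l q\<bar>" and ?H = "Hhalf_norm U G q"
  have "ereal ?F / ereal ?H \<le> Hmhalf_norm U G (pairing G l)"
    unfolding Hmhalf_norm_def using q False by (intro SUP_upper) auto
  then have le: "ereal ?F / ereal ?H \<le> ereal N" using N(1) by (rule order_trans)
  have "?H \<noteq> 0"
  proof
    assume "?H = 0"
    then have "ereal ?F / ereal ?H = \<infinity>" using False by (simp add: divide_ereal_def)
    then show False using le by simp
  qed
  then have "?H > 0" using Hhalf_norm_nonneg[OF q] by simp
  then show ?thesis using le by (simp add: divide_le_eq)
qed

section \<open>The inf-sup condition\<close>

text \<open>The properties of one mesh of the family on which the analysis rests.\<close>

locale stabilised_problem =
  fixes \<omega> \<Omega> :: "plane set" and \<Gamma> :: "(plane \<times> plane) set" and \<T> \<E> :: "plane set set" and Cs \<beta> :: real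
  assumes \<omega>: "open \<omega>" "bounded \<omega>" and \<Omega>: "open \<Omega>" "bounded \<Omega>"
    and \<Gamma>: "finite \<Gamma>" "\<Gamma> \<noteq> {}" "\<forall>(a, b)\<in>\<Gamma>. a \<noteq> b" and \<Gamma>\<Omega>: "segments \<Gamma> \<subseteq> \<Omega>"
    and \<T>: "finite \<T>" "\<And>K. K \<in> \<T> \<Longrightarrow> polytope K" "\<Union>\<T> = closure \<Omega>"
    and \<E>: "finite \<E>" "\<And>e. e \<in> \<E> \<Longrightarrow> compact e \<and> e \<subseteq> segments \<Gamma>"
    and Cs: "Cs > 0" and \<beta>: "\<beta> > 0"
    and stability: "\<And>\<mu>. \<mu> \<in> Lh \<Gamma> \<T> \<Longrightarrow>
           ereal \<beta> * Hmhalf_norm \<omega> \<Gamma> (pairing \<Gamma> \<mu>)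
             \<le> (SUP v\<in>Vh_nonzero \<Omega> \<T>. ereal (- pairing \<Gamma> \<mu> v / H1_seminorm \<Omega> v))
               + ereal (sqrt (stab \<Gamma> \<E> Cs \<mu> \<mu>))"
begin

abbreviation "V \<equiv> Vh \<Omega> \<T>"

abbreviation "\<Lambda> \<equiv> Lh \<Gamma> \<T>"

abbreviation "W \<equiv> Wh \<Omega> \<Gamma> \<T>"

abbreviation "B \<equiv> Bform \<Omega> \<Gamma> \<E> Cs"

abbreviation "nW \<equiv> Wh_norm \<omega> \<Omega> \<Gamma> \<E> Cs \<beta>"

abbreviation "semiV \<equiv> H1_seminorm \<Omega>"

abbreviation "s \<equiv> stab \<Gamma> \<E> Cs"

text \<open>The dual norm as a real number. It is meaningful once it is known to be finite; see \<open>dual_norm_finite\<close>.\<close>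

definition "dual_norm \<mu> = real_of_ereal (Hmhalf_norm \<omega> \<Gamma> (pairing \<Gamma> \<mu>))"

lemma semi_inner_grad_Vh: "semi_inner V (grad_inner \<Omega>)"
  by (rule semi_inner_subset[OF semi_inner_grad_inner[OF \<Omega>] subspace_Vh[OF \<Omega>]]) (auto intro: Vh_H1)

lemma semi_inner_stab_Lh: "semi_inner \<Lambda> s"
  by (rule semi_inner_subset[OF semi_inner_stab[OF \<Gamma>(1) Cs \<E>(2,1)] subspace_Lh]) (auto intro: Lh_L2)

lemma Vh_L2_arclength: "v \<in> V \<Longrightarrow> v \<in> L2 (arclength \<Gamma>)"
  using \<Gamma>\<Omega> closure_subset[of \<Omega>] by (intro continuous_L2_arclength \<Gamma> continuous_on_subset[OF Vh_continuous]) auto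

lemma pairing_zero_right: "\<forall>x\<in>closure \<Omega>. v x = 0 \<Longrightarrow> pairing \<Gamma> l v = 0"
proof -
  assume "\<forall>x\<in>closure \<Omega>. v x = 0"
  then have "AE x in arclength \<Gamma>. l x * v x = 0"
    using \<Gamma>\<Omega> closure_subset[of \<Omega>] by (intro AE_I2) (auto simp: space_arclength)
  then show ?thesis unfolding pairing_def by (rule integral_eq_zero_AE)
qed

text \<open>Turns the stability inequality for \<open>\<beta>\<close> into a bound without suprema. It also yields finiteness of the
dual norm, because the right-hand side is a real number.\<close>

lemma dual_norm_bound:
  assumes \<mu>: "\<mu> \<in> \<Lambda>" and K: "0 \<le> K" "\<And>v. v \<in> V \<Longrightarrow> - pairing \<Gamma> \<mu> v \<le> K * semiV v"
  shows "Hmhalf_norm \<omega> \<Gamma> (pairing \<Gamma> \<mu>) \<le> ereal (dual_norm \<mu>)" "\<beta> * dual_norm \<mu> \<le> K + sqrt (s \<mu> \<mu>)"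
proof -
  have "(SUP v\<in>Vh_nonzero \<Omega> \<T>. ereal (- pairing \<Gamma> \<mu> v / semiV v)) \<le> ereal K"
  proof (rule SUP_least)
    fix v assume "v \<in> Vh_nonzero \<Omega> \<T>"
    then have "- pairing \<Gamma> \<mu> v \<le> K * semiV v" using K(2) by (auto simp: Vh_nonzero_def)
    then have "- pairing \<Gamma> \<mu> v / semiV v \<le> K"
      using K(1) H1_seminorm_nonneg[of \<Omega> v] pos_divide_le_eq[of "semiV v" "- pairing \<Gamma> \<mu> v" K]
      by (cases "semiV v = 0") auto
    then show "ereal (- pairing \<Gamma> \<mu> v / semiV v) \<le> ereal K" by simp
  qed
  from add_right_mono[OF this, of "ereal (sqrt (s \<mu> \<mu>))"]
  have "(SUP v\<in>Vh_nonzero \<Omega> \<T>. ereal (- pairing \<Gamma> \<mu> v / semiV v)) + ereal (sqrt (s \<mu> \<mu>))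
      \<le> ereal (K + sqrt (s \<mu> \<mu>))"
    unfolding plus_ereal.simps(1) .
  with stability[OF \<mu>] have le: "ereal \<beta> * Hmhalf_norm \<omega> \<Gamma> (pairing \<Gamma> \<mu>) \<le> ereal (K + sqrt (s \<mu> \<mu>))"
    by (rule order_trans)
  have nn: "0 \<le> s \<mu> \<mu>" using semi_inner_stab_Lh \<mu> by (simp add: semi_inner_def)
  have "Hmhalf_norm \<omega> \<Gamma> (pairing \<Gamma> \<mu>) \<le> ereal (dual_norm \<mu>) \<and> \<beta> * dual_norm \<mu> \<le> K + sqrt (s \<mu> \<mu>)"
    using le \<beta> nn K(1) unfolding dual_norm_def
    by (cases "Hmhalf_norm \<omega> \<Gamma> (pairing \<Gamma> \<mu>)") auto
  then show "Hmhalf_norm \<omega> \<Gamma> (pairing \<Gamma> \<mu>) \<le> ereal (dual_norm \<mu>)" "\<beta> * dual_norm \<mu> \<le> K + sqrt (s \<mu> \<mu>)" by auto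
qed

lemma dual_norm_nonneg: "0 \<le> dual_norm \<mu>"
  unfolding dual_norm_def using Hmhalf_norm_cases[of \<omega> \<Gamma> "pairing \<Gamma> \<mu>"] by (auto intro: real_of_ereal_pos)

lemma dual_norm_AE_zero: "AE x in arclength \<Gamma>. l x = 0 \<Longrightarrow> dual_norm l = 0"
proof -
  assume "AE x in arclength \<Gamma>. l x = 0"
  then have "pairing \<Gamma> l q = 0" for q by (rule pairing_AE_zero_left)
  then have "Hmhalf_norm \<omega> \<Gamma> (pairing \<Gamma> l) \<le> 0"
    unfolding Hmhalf_norm_def by (intro SUP_least) (simp add: zero_ereal_def[symmetric])
  then show ?thesis using Hmhalf_norm_cases[of \<omega> \<Gamma> "pairing \<Gamma> l"] by (auto simp: dual_norm_def)
qed

lemma norm_sq: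
  assumes "u \<in> V" "l \<in> \<Lambda>"
  shows "(nW (u, l))\<^sup>2 = (semiV u)\<^sup>2 + (\<beta> * dual_norm l)\<^sup>2 + s l l"
proof -
  have "0 \<le> s l l" using semi_inner_stab_Lh assms by (simp add: semi_inner_def)
  then show ?thesis by (simp add: Wh_norm_def dual_norm_def power_mult_distrib)
qed

lemma norm_nonneg: "z \<in> W \<Longrightarrow> 0 \<le> nW z"
  using semi_inner_stab_Lh by (auto simp: Wh_def Wh_norm_def semi_inner_def)

lemma norm_ge:
  assumes "u \<in> V" "l \<in> \<Lambda>"
  shows "semiV u \<le> nW (u, l)" "\<beta> * dual_norm l \<le> nW (u, l)"
proof -
  have "0 \<le> s l l" using semi_inner_stab_Lh assms by (simp add: semi_inner_def)
  then have "(semiV u)\<^sup>2 \<le> (nW (u, l))\<^sup>2" "(\<beta> * dual_norm l)\<^sup>2 \<le> (nW (u, l))\<^sup>2"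
    unfolding norm_sq[OF assms] by simp_all
  moreover have "0 \<le> nW (u, l)" using assms by (intro norm_nonneg) (simp add: Wh_def)
  ultimately show "semiV u \<le> nW (u, l)" "\<beta> * dual_norm l \<le> nW (u, l)"
    by (auto intro: power2_le_imp_le simp del: power_mult_distrib)
qed

lemma zero_\<Lambda>: "(\<lambda>x. 0) \<in> \<Lambda>" and zero_V: "(\<lambda>x. 0) \<in> V"
  using subspace_0[OF subspace_Lh] subspace_0[OF subspace_Vh[OF \<Omega>]] by (simp_all add: zero_fun_def)

text \<open>The inf-sup estimate, with \<open>m\<close> a bound for the quotients \<open>B (u, l) z / nW z\<close>. Testing with \<open>(u, l)\<close> itself controls
the energy and the stabilisation, testing with \<open>(v, 0)\<close> controls the dual norm through the inequality for \<open>\<beta>\<close>.\<close>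

lemma norm_le_six_B_bound:
  assumes w: "u \<in> V" "l \<in> \<Lambda>" and m: "0 \<le> m"
    and bound: "\<And>z. z \<in> W \<Longrightarrow> B (u, l) z \<le> m * nW z"
  shows "nW (u, l) \<le> 6 * m"
proof -
  define A S N w where "A = semiV u" and "S = sqrt (s l l)" and "N = \<beta> * dual_norm l" and "w = nW (u, l)"
  have pos: "0 \<le> s l l" using semi_inner_stab_Lh assms by (simp add: semi_inner_def)
  have nn: "0 \<le> A" "0 \<le> S" "0 \<le> N" "0 \<le> w"
    using pos dual_norm_nonneg \<beta> norm_nonneg[of "(u, l)"] assms by (auto simp: A_def S_def N_def w_def H1_seminorm_def Wh_def)
  have w2: "w\<^sup>2 = A\<^sup>2 + N\<^sup>2 + S\<^sup>2" using norm_sq[OF w] pos by (simp add: A_def S_def N_def w_def)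
  have "B (u, l) (u, l) = A\<^sup>2 + S\<^sup>2"
    using pos by (simp add: Bform_def A_def S_def H1_seminorm_sq)
  then have AS: "A\<^sup>2 + S\<^sup>2 \<le> m * w" using bound[of "(u, l)"] w by (simp add: Wh_def w_def)
  have "- pairing \<Gamma> l v \<le> (m + A) * semiV v" if v: "v \<in> V" for v
  proof -
    have "nW (v, \<lambda>x. 0) = semiV v"
      using dual_norm_AE_zero[of "\<lambda>x. 0"] stab_AE_zero[of "\<lambda>x. 0" \<Gamma> \<E> Cs]
      by (simp add: Wh_norm_def dual_norm_def H1_seminorm_def)
    moreover have "B (u, l) (v, \<lambda>x. 0) = grad_inner \<Omega> u v - pairing \<Gamma> l v"
    proof -
      have "s l (\<lambda>x. 0) = s (\<lambda>x. 0) l"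
        using semi_inner_stab_Lh w zero_\<Lambda> by (simp add: semi_inner_def)
      then show ?thesis
        using stab_AE_zero[of "\<lambda>x. 0" \<Gamma> \<E> Cs l] pairing_AE_zero_left[of "\<lambda>x. 0"] by (simp add: Bform_def)
    qed
    ultimately have "grad_inner \<Omega> u v - pairing \<Gamma> l v \<le> m * semiV v"
      using bound[of "(v, \<lambda>x. 0)"] v zero_\<Lambda> by (simp add: Wh_def)
    moreover have "\<bar>grad_inner \<Omega> u v\<bar> \<le> A * semiV v"
      using semi_inner_Cauchy_Schwarz[OF semi_inner_grad_Vh w(1) v] by (simp add: A_def H1_seminorm_eq)
    ultimately show ?thesis by (simp add: algebra_simps)
  qed
  note db = dual_norm_bound[OF w(2) _ this]
  have "N \<le> m + A + S" using db(2) m nn by (simp add: N_def S_def)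
  \<comment> \<open>Twice \<open>(x + y)\<^sup>2 \<le> 2 x\<^sup>2 + 2 y\<^sup>2\<close>; with \<open>m < w / 6\<close> the resulting right-hand side would
    be less than \<open>(1 / 18 + 5 / 6) w\<^sup>2\<close>.\<close>
  then have "N\<^sup>2 \<le> (m + (A + S))\<^sup>2" using nn by (intro power_mono) auto
  also have "\<dots> \<le> 2 * m\<^sup>2 + 2 * (A + S)\<^sup>2" using sum_squares_bound[of m "A + S"] by (simp add: power2_sum)
  also have "\<dots> \<le> 2 * m\<^sup>2 + 4 * (A\<^sup>2 + S\<^sup>2)" using sum_squares_bound[of A S] by (simp add: power2_sum)
  also have "\<dots> \<le> 2 * m\<^sup>2 + 4 * (m * w)" using AS by simp
  finally have le: "w\<^sup>2 \<le> 2 * m\<^sup>2 + 5 * (m * w)" using w2 AS by simp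
  show "nW (u, l) \<le> 6 * m"
  proof (rule ccontr)
    assume "\<not> nW (u, l) \<le> 6 * m"
    then have lt: "6 * m < w" by (simp add: w_def)
    then have "w > 0" using m by simp
    then have "6 * (m * w) < w\<^sup>2" using lt by (simp add: power2_eq_square mult.assoc[symmetric])
    moreover have "6 * m\<^sup>2 \<le> m * w" using lt m mult_left_mono[of "6 * m" w m] by (simp add: power2_eq_square)
    moreover have "0 \<le> m * w" using m nn by simp
    ultimately show False using le by linarith
  qed
qed

text \<open>If the dual norm of \<open>l\<close> vanishes, then \<open>l\<close> annihilates the traces of smooth functions, and these separate
multipliers.\<close>

lemma norm_zero_imp_eq_zero:
  assumes w: "u \<in> V" "l \<in> \<Lambda>" and fin: "Hmhalf_norm \<omega> \<Gamma> (pairing \<Gamma> l) \<le> ereal (dual_norm l)"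
    and zero: "nW (u, l) \<le> 0"
  shows "\<forall>x\<in>closure \<Omega>. u x = 0" "AE x in arclength \<Gamma>. l x = 0"
proof -
  have "semiV u = 0" using norm_ge(1)[OF w] zero H1_seminorm_nonneg[of \<Omega> u] by linarith
  then have "grad_inner \<Omega> u u = 0" using H1_seminorm_sq[of \<Omega> u] by simp
  then show "\<forall>x\<in>closure \<Omega>. u x = 0" using Vh_seminorm_zero[OF \<Omega> w(1)] by blast
  have "\<beta> * dual_norm l \<le> 0" using norm_ge(2)[OF w] zero by simp
  then have "dual_norm l = 0" using \<beta> dual_norm_nonneg[of l] by (simp add: mult_le_0_iff)
  then have "pairing \<Gamma> l \<phi> = 0" if "smooth \<phi>" for \<phi>
    using pairing_le_Hmhalf_norm[of \<phi> \<omega> \<Gamma> l 0] fin is_trace_smooth[OF \<omega> \<Gamma>(1) that] by (auto simp: Hhalf_def)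
  then show "AE x in arclength \<Gamma>. l x = 0" by (intro AE_zero_of_smooth_pairing \<Gamma> Lh_L2[OF w(2)])
qed

lemma finite_mesh_vertices: "finite {x. \<exists>K\<in>\<T>. x extreme_point_of K}"
proof -
  have "{x. \<exists>K\<in>\<T>. x extreme_point_of K} = (\<Union>K\<in>\<T>. {x. x extreme_point_of K})" by auto
  then show ?thesis using \<T> by (auto intro!: finite_polyhedron_extreme_points polytope_imp_polyhedron)
qed

text \<open>Finite-dimensional solvability for the energy inner product, which is definite by the Poincare
inequality. The sign matches the inequality for \<open>\<beta>\<close>.\<close>

lemma pairing_Riesz_representative:
  assumes \<mu>: "\<mu> \<in> \<Lambda>"
  obtains u where "u \<in> V" "\<And>v. v \<in> V \<Longrightarrow> grad_inner \<Omega> u v = - pairing \<Gamma> \<mu> v"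
proof -
  have "\<exists>u\<in>V. \<forall>v\<in>V. grad_inner \<Omega> u v = - pairing \<Gamma> \<mu> v"
  proof (rule finite_dimensional_solvability[where T = "\<lambda>x v. v x", OF subspace_Vh[OF \<Omega>] finite_mesh_vertices])
    show "linear_on V (\<lambda>v. v x)" for x by (simp add: linear_on_def)
    show "linear_on V (\<lambda>w. grad_inner \<Omega> w z)" if "z \<in> V" for z
      using semi_inner_grad_Vh that by (simp add: semi_inner_def)
    show "linear_on V (grad_inner \<Omega> w)" if "w \<in> V" for w
      using semi_inner_linear_right[OF semi_inner_grad_Vh that] .
    show "grad_inner \<Omega> w z = 0" if "w \<in> V" "z \<in> V" "\<forall>x\<in>{x. \<exists>K\<in>\<T>. x extreme_point_of K}. w x = 0" for w z
    proof (rule grad_inner_zero_left[OF \<Omega> Vh_H1[OF that(2)]])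
      show "w x = 0" if "x \<in> \<Omega>" for x
        using Vh_zero_of_vertices[OF \<T>(2,3) \<open>w \<in> V\<close>, of x] that closure_subset[of \<Omega>]
          \<open>\<forall>x\<in>{x. \<exists>K\<in>\<T>. x extreme_point_of K}. w x = 0\<close> by blast
    qed
    have "linear_on V (pairing \<Gamma> \<mu>)"
      using linear_on_subset[OF pairing_linear_right[OF Lh_L2[OF \<mu>]]] Vh_L2_arclength by blast
    then show "linear_on V (\<lambda>v. - pairing \<Gamma> \<mu> v)" by (simp add: linear_on_def)
    show "- pairing \<Gamma> \<mu> z = 0" if "z \<in> V" "\<forall>w\<in>V. grad_inner \<Omega> w z = 0" for z
      using pairing_zero_right Vh_seminorm_zero[OF \<Omega> that(1)] that by simp
  qed
  then show thesis using that by blast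
qed

text \<open>By Cauchy-Schwarz the energy of the Riesz representative bounds the supremum in the inequality for \<open>\<beta>\<close>.\<close>

lemma dual_norm_finite:
  assumes \<mu>: "\<mu> \<in> \<Lambda>"
  shows "Hmhalf_norm \<omega> \<Gamma> (pairing \<Gamma> \<mu>) \<le> ereal (dual_norm \<mu>)"
proof -
  obtain u where u: "u \<in> V" "\<And>v. v \<in> V \<Longrightarrow> grad_inner \<Omega> u v = - pairing \<Gamma> \<mu> v"
    using pairing_Riesz_representative[OF \<mu>] by metis
  show ?thesis
  proof (rule dual_norm_bound(1)[OF \<mu>, of "semiV u"])
    show "0 \<le> semiV u" by (rule H1_seminorm_nonneg)
    show "- pairing \<Gamma> \<mu> v \<le> semiV u * semiV v" if "v \<in> V" for v
      using semi_inner_Cauchy_Schwarz[OF semi_inner_grad_Vh u(1) that] u(2)[OF that] by (simp add: H1_seminorm_eq)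
  qed
qed

lemma Wh_pairI: "u \<in> V \<Longrightarrow> l \<in> \<Lambda> \<Longrightarrow> (u, l) \<in> W"
  by (simp add: Wh_def)

lemma subspace_W: "subspace W"
  unfolding Wh_def by (intro subspace_Times subspace_Vh subspace_Lh \<Omega>)

lemma linear_on_fst: "linear_on V F \<Longrightarrow> linear_on W (\<lambda>z. F (fst z))"
  and linear_on_snd: "linear_on \<Lambda> H \<Longrightarrow> linear_on W (\<lambda>z. H (snd z))"
  unfolding linear_on_def Wh_def by auto

lemma linear_on_lift:
  assumes "linear_on V F" "linear_on \<Lambda> H"
  shows "linear_on W (\<lambda>z. F (fst z) + H (snd z))"
  using linear_on_fst[OF assms(1)] linear_on_snd[OF assms(2)] unfolding linear_on_def
  by (simp add: algebra_simps)

lemma pairing_linear_V: "l \<in> L2 (arclength \<Gamma>) \<Longrightarrow> linear_on V (pairing \<Gamma> l)"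
  by (rule linear_on_subset[OF pairing_linear_right]) (auto intro: Vh_L2_arclength)

lemma pairing_linear_Lh: "v \<in> L2 (arclength \<Gamma>) \<Longrightarrow> linear_on \<Lambda> (\<lambda>l. pairing \<Gamma> l v)"
  by (rule linear_on_subset[OF pairing_linear_left]) (auto intro: Lh_L2)

lemma B_linear_left: "z \<in> W \<Longrightarrow> linear_on W (\<lambda>w. B w z)"
proof -
  assume "z \<in> W"
  then obtain v \<mu> where z: "z = (v, \<mu>)" "v \<in> V" "\<mu> \<in> \<Lambda>" by (auto simp: Wh_def)
  have "linear_on V (\<lambda>u. grad_inner \<Omega> u v + pairing \<Gamma> \<mu> u)"
    using semi_inner_grad_Vh z by (intro linear_on_plus pairing_linear_V Lh_L2) (auto simp: semi_inner_def)
  moreover have "linear_on \<Lambda> (\<lambda>l. s l \<mu> - pairing \<Gamma> l v)"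
    using semi_inner_stab_Lh z by (intro linear_on_minus pairing_linear_Lh Vh_L2_arclength) (auto simp: semi_inner_def)
  ultimately have "linear_on W (\<lambda>w. (grad_inner \<Omega> (fst w) v + pairing \<Gamma> \<mu> (fst w)) + (s (snd w) \<mu> - pairing \<Gamma> (snd w) v))"
    by (rule linear_on_lift)
  moreover have "(\<lambda>w. (grad_inner \<Omega> (fst w) v + pairing \<Gamma> \<mu> (fst w)) + (s (snd w) \<mu> - pairing \<Gamma> (snd w) v)) = (\<lambda>w. B w z)"
    by (auto simp: Bform_def z(1))
  ultimately show ?thesis by simp
qed

text \<open>The form is the sum of a symmetric and a skew part, and the skew part couples functions to multipliers. Changing the sign of
both multipliers therefore transposes it.\<close>

lemma B_flip:
  assumes "u \<in> V" "l \<in> \<Lambda>" "v \<in> V" "\<mu> \<in> \<Lambda>"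
  shows "B (u, l) (v, \<mu>) = B (v, - \<mu>) (u, - l)"
proof -
  have m: "- \<mu> \<in> \<Lambda>" "- l \<in> \<Lambda>" using assms subspace_neg[OF subspace_Lh] by auto
  have neg: "F (- x) = - F x" if "linear_on X F" "x \<in> X" for X and F :: "(plane \<Rightarrow> real) \<Rightarrow> real" and x
    using linear_on_scale[OF that, of "-1"] by simp
  have sym: "s a b = s b a" if "a \<in> \<Lambda>" "b \<in> \<Lambda>" for a b
    using semi_inner_stab_Lh that by (simp add: semi_inner_def)
  have "s (- \<mu>) (- l) = - s \<mu> (- l)"
    using semi_inner_stab_Lh m assms by (intro neg[of \<Lambda> "\<lambda>x. s x (- l)"]) (auto simp: semi_inner_def)
  also have "s \<mu> (- l) = - s \<mu> l"
    by (rule neg[OF semi_inner_linear_right[OF semi_inner_stab_Lh assms(4)] assms(2)])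
  finally have "s (- \<mu>) (- l) = - (- s \<mu> l)" .
  then have "s (- \<mu>) (- l) = s l \<mu>" using sym[OF assms(4,2)] by linarith
  moreover have "pairing \<Gamma> (- \<mu>) u = - pairing \<Gamma> \<mu> u" "pairing \<Gamma> (- l) v = - pairing \<Gamma> l v"
    using neg[OF pairing_linear_Lh[OF Vh_L2_arclength]] assms by auto
  moreover have "grad_inner \<Omega> u v = grad_inner \<Omega> v u"
    by (simp add: grad_inner_def inner_commute)
  ultimately show ?thesis by (simp add: Bform_def)
qed

lemma B_linear_right: "w \<in> W \<Longrightarrow> linear_on W (B w)"
proof -
  assume "w \<in> W"
  then obtain u l where w: "w = (u, l)" "u \<in> V" "l \<in> \<Lambda>" by (auto simp: Wh_def)
  have "linear_on V (\<lambda>v. grad_inner \<Omega> u v - pairing \<Gamma> l v)"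
    using semi_inner_linear_right[OF semi_inner_grad_Vh] w by (intro linear_on_minus pairing_linear_V Lh_L2) auto
  moreover have "linear_on \<Lambda> (\<lambda>\<mu>. pairing \<Gamma> \<mu> u + s l \<mu>)"
    using semi_inner_linear_right[OF semi_inner_stab_Lh] w by (intro linear_on_plus pairing_linear_Lh Vh_L2_arclength) auto
  ultimately have "linear_on W (\<lambda>z. (grad_inner \<Omega> u (fst z) - pairing \<Gamma> l (fst z)) + (pairing \<Gamma> (snd z) u + s l (snd z)))"
    by (rule linear_on_lift)
  moreover have "(\<lambda>z. (grad_inner \<Omega> u (fst z) - pairing \<Gamma> l (fst z)) + (pairing \<Gamma> (snd z) u + s l (snd z))) = B w"
    by (auto simp: Bform_def w(1))
  ultimately show ?thesis by simp
qed

lemma B_zero_left: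
  assumes w: "u \<in> V" "l \<in> \<Lambda>" and z: "z \<in> W" and zero: "\<forall>x\<in>closure \<Omega>. u x = 0" "AE x in arclength \<Gamma>. l x = 0"
  shows "B (u, l) z = 0"
proof -
  obtain v \<mu> where z': "z = (v, \<mu>)" "v \<in> V" "\<mu> \<in> \<Lambda>" using z by (auto simp: Wh_def)
  have "grad_inner \<Omega> u v = 0"
    using zero(1) closure_subset[of \<Omega>] by (intro grad_inner_zero_left[OF \<Omega> Vh_H1[OF z'(2)]]) auto
  then show ?thesis
    using pairing_zero_right[OF zero(1)] pairing_AE_zero_left[OF zero(2)] stab_AE_zero[OF zero(2)]
    by (simp add: Bform_def z'(1))
qed

text \<open>The inf-sup estimate with \<open>m = 0\<close>.\<close>

lemma B_nondegenerate:
  assumes w: "u \<in> V" "l \<in> \<Lambda>" and zero: "\<And>z. z \<in> W \<Longrightarrow> B (u, l) z = 0"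
  shows "\<forall>x\<in>closure \<Omega>. u x = 0" "AE x in arclength \<Gamma>. l x = 0"
proof -
  have "nW (u, l) \<le> 0" using norm_le_six_B_bound[OF w, of 0] zero by simp
  from norm_zero_imp_eq_zero[OF w dual_norm_finite[OF w(2)] this]
  show "\<forall>x\<in>closure \<Omega>. u x = 0" "AE x in arclength \<Gamma>. l x = 0" by auto
qed

lemma B_zero_right:
  assumes "w \<in> W" "v \<in> V" "\<mu> \<in> \<Lambda>" "\<forall>x\<in>closure \<Omega>. v x = 0" "AE x in arclength \<Gamma>. \<mu> x = 0"
  shows "B w (v, \<mu>) = 0"
proof -
  obtain u l where w: "w = (u, l)" "u \<in> V" "l \<in> \<Lambda>" using assms(1) by (auto simp: Wh_def)
  have "B (v, - \<mu>) (u, - l) = 0"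
    using assms w subspace_neg[OF subspace_Lh] by (intro B_zero_left) (auto simp: Wh_pairI)
  then show ?thesis using B_flip[OF w(2,3) assms(2,3)] w(1) by simp
qed

text \<open>What remains is to pass from the bound \<open>m\<close> to the supremum over nonzero elements: the supremum is a
nonnegative real number, and elements of norm zero contribute nothing because the form vanishes on them.\<close>

theorem inf_sup:
  assumes "w \<in> W"
  shows "ereal (1 / 6 * nW w) \<le> (SUP z\<in>Wh_nonzero \<Omega> \<Gamma> \<T>. ereal (B w z / nW z))"
proof (rule ccontr)
  let ?\<Sigma> = "SUP z\<in>Wh_nonzero \<Omega> \<Gamma> \<T>. ereal (B w z / nW z)"
  obtain u l where w: "w = (u, l)" "u \<in> V" "l \<in> \<Lambda>" using assms by (auto simp: Wh_def)
  assume "\<not> ereal (1 / 6 * nW w) \<le> ?\<Sigma>"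
  then have lt: "?\<Sigma> < ereal (1 / 6 * nW w)" by simp
  have one: "(\<lambda>x. 0, \<lambda>x. c) \<in> Wh_nonzero \<Omega> \<Gamma> \<T>" if "c \<noteq> 0" for c
  proof -
    obtain a b where ab: "(a, b) \<in> \<Gamma>" using \<Gamma>(2) by auto
    then have "\<not> (AE x in arclength \<Gamma>. False)" using \<Gamma> arclength_nonnull[of \<Gamma> a b] by blast
    then show ?thesis using that zero_V const_Lh[OF \<Gamma>(1)] by (simp add: Wh_nonzero_def Wh_eq_def Wh_pairI)
  qed
  have upper: "ereal (B w z / nW z) \<le> ?\<Sigma>" if "z \<in> Wh_nonzero \<Omega> \<Gamma> \<T>" for z
    using that by (rule SUP_upper)
  \<comment> \<open>The constant multipliers \<open>1\<close> and \<open>-1\<close> are nonzero and give quotients of opposite signs.\<close>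
  have nn: "0 \<le> ?\<Sigma>"
  proof -
    let ?z = "\<lambda>c::real. (\<lambda>x::plane. 0::real, \<lambda>x::plane. c)"
    have e: "(-1) *\<^sub>R ?z 1 = ?z (-1)" by (simp add: scaleR_prod_def scaleR_fun_def)
    have eq: "B w (?z (-1)) = - B w (?z 1)"
      using linear_on_scale[OF B_linear_right[OF assms] Wh_pairI[OF zero_V const_Lh[OF \<Gamma>(1)]], of "-1" 1, unfolded e]
      by simp
    have n: "0 \<le> nW (?z c)" for c by (intro norm_nonneg Wh_pairI zero_V const_Lh \<Gamma>)
    have "0 \<le> B w (?z 1) / nW (?z 1) \<or> 0 \<le> B w (?z (-1)) / nW (?z (-1))"
      using n[of 1] n[of "-1"] unfolding eq by (cases "0 \<le> B w (?z 1)") (auto intro: divide_nonneg_nonneg divide_nonpos_nonneg)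
    moreover have "0 \<le> ?\<Sigma>" if c: "c \<noteq> 0" "0 \<le> B w (?z c) / nW (?z c)" for c
    proof -
      have "0 \<le> ereal (B w (?z c) / nW (?z c))" using c(2) by simp
      also have "\<dots> \<le> ?\<Sigma>" by (rule upper[OF one[OF c(1)]])
      finally show ?thesis .
    qed
    from this[of 1] this[of "-1"] have "0 \<le> B w (?z 1) / nW (?z 1) \<Longrightarrow> 0 \<le> ?\<Sigma>"
      "0 \<le> B w (?z (-1)) / nW (?z (-1)) \<Longrightarrow> 0 \<le> ?\<Sigma>" by simp_all
    ultimately show ?thesis by blast
  qed
  obtain m where m: "?\<Sigma> = ereal m" "0 \<le> m"
    using nn lt by (cases ?\<Sigma>) auto
  have "B w z \<le> m * nW z" if z: "z \<in> W" for z
  proof -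
    obtain v \<mu> where z': "z = (v, \<mu>)" "v \<in> V" "\<mu> \<in> \<Lambda>" using z by (auto simp: Wh_def)
    show ?thesis
    proof (cases "nW z \<le> 0")
      case True
      have "B w z = 0"
        using B_zero_right[OF assms z'(2,3)] norm_zero_imp_eq_zero[OF z'(2,3) dual_norm_finite[OF z'(3)]] True z'(1) by simp
      then show ?thesis using m(2) norm_nonneg[OF z] by simp
    next
      case False
      have "\<not> Wh_eq \<Omega> \<Gamma> z (\<lambda>x. 0, \<lambda>x. 0)"
      proof
        assume "Wh_eq \<Omega> \<Gamma> z (\<lambda>x. 0, \<lambda>x. 0)"
        then have zero: "\<forall>x\<in>closure \<Omega>. v x = 0" "AE x in arclength \<Gamma>. \<mu> x = 0"
          by (auto simp: Wh_eq_def z'(1))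
        have "grad_inner \<Omega> v v = 0"
          using zero(1) closure_subset[of \<Omega>] by (intro grad_inner_zero_left[OF \<Omega> Vh_H1[OF z'(2)]]) auto
        then have "(nW z)\<^sup>2 = 0"
          unfolding z'(1) norm_sq[OF z'(2,3)] using dual_norm_AE_zero[OF zero(2)] stab_AE_zero[OF zero(2)]
          by (simp add: H1_seminorm_sq)
        then show False using False by simp
      qed
      then have "ereal (B w z / nW z) \<le> ereal m"
        using upper[of z] z unfolding m(1) by (simp add: Wh_nonzero_def)
      then show ?thesis using False by (simp add: divide_le_eq)
    qed
  qed
  then have "nW w \<le> 6 * m" using norm_le_six_B_bound[OF w(2,3) m(2)] w(1) by blast
  then show False using lt unfolding m(1) by simp
qed

section \<open>Well-posedness of the discrete problem\<close>

lemma load_linear: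
  assumes f: "f \<in> L2 (lebesgue_on \<Omega>)" and g: "g \<in> Hhalf \<omega> \<Gamma>"
  shows "linear_on W (\<lambda>z. L2_inner (lebesgue_on \<Omega>) f (fst z) + pairing \<Gamma> g (snd z))"
proof (rule linear_on_lift)
  show "linear_on V (L2_inner (lebesgue_on \<Omega>) f)"
    by (rule linear_on_subset[OF semi_inner_linear_right[OF semi_inner_L2 f]]) (auto intro: H1_L2 Vh_H1)
  show "linear_on \<Lambda> (pairing \<Gamma> g)"
    by (rule linear_on_subset[OF pairing_linear_right[OF Hhalf_L2[OF g]]]) (auto intro: Lh_L2)
qed

lemma L2_inner_zero_right:
  assumes "\<forall>x\<in>closure \<Omega>. v x = 0"
  shows "L2_inner (lebesgue_on \<Omega>) f v = 0"
proof -
  have "AE x in lebesgue_on \<Omega>. f x * v x = 0"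
    using assms closure_subset[of \<Omega>] by (intro AE_I2) auto
  then show ?thesis unfolding L2_inner_def by (rule integral_eq_zero_AE)
qed

text \<open>The coordinates are the values at the mesh vertices and the integrals over the edges of the
induced partition. Nondegeneracy in the second argument follows from that in the first by flipping the signs of the multipliers.\<close>

lemma solution_exists:
  assumes f: "f \<in> L2 (lebesgue_on \<Omega>)" and g: "g \<in> Hhalf \<omega> \<Gamma>"
  shows "\<exists>w. discrete_solution \<Omega> \<Gamma> \<T> \<E> Cs f g w"
proof -
  let ?J = "Inl ` {x. \<exists>K\<in>\<T>. x extreme_point_of K} \<union> Inr ` induced_partition \<Gamma> \<T>"
  let ?T = "\<lambda>i z. case i of Inl x \<Rightarrow> fst z x | Inr e \<Rightarrow> (LINT x:e|arclength \<Gamma>. snd z x)"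
  have fin: "finite (induced_vertices \<Gamma> \<T>)" by (intro finite_induced_vertices \<Gamma> \<T>)
  have "\<exists>w\<in>W. \<forall>z\<in>W. B w z = L2_inner (lebesgue_on \<Omega>) f (fst z) + pairing \<Gamma> g (snd z)"
  proof (rule finite_dimensional_solvability[where T = ?T and J = ?J, OF subspace_W])
    show "finite ?J" using finite_mesh_vertices finite_induced_partition[OF fin] by simp
    fix i assume i: "i \<in> ?J"
    show "linear_on W (?T i)"
    proof (cases i)
      case (Inl x)
      then show ?thesis using linear_on_fst[of "\<lambda>v. v x"] by (simp add: linear_on_def)
    next
      case (Inr e)
      then have "compact e \<and> e \<subseteq> segments \<Gamma>" using i induced_partition_compact by auto
      then have "linear_on (L2 (arclength \<Gamma>)) (\<lambda>l. LINT x:e|arclength \<Gamma>. l x)"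
        using \<Gamma>(1) by (intro set_integral_linear sets_arclength_closed) (auto simp: compact_imp_closed)
      then have "linear_on \<Lambda> (\<lambda>l. LINT x:e|arclength \<Gamma>. l x)"
        by (rule linear_on_subset) (auto intro: Lh_L2)
      from linear_on_snd[OF this] show ?thesis using Inr by simp
    qed
  next
    show "linear_on W (\<lambda>w. B w z)" if "z \<in> W" for z using that by (rule B_linear_left)
    show "linear_on W (B w)" if "w \<in> W" for w using that by (rule B_linear_right)
    show "linear_on W (\<lambda>z. L2_inner (lebesgue_on \<Omega>) f (fst z) + pairing \<Gamma> g (snd z))"
      using f g by (rule load_linear)
    show "B w z = 0" if w: "w \<in> W" and z: "z \<in> W" and zero: "\<forall>i\<in>?J. ?T i w = 0" for w z
    proof -
      obtain u l where w': "w = (u, l)" "u \<in> V" "l \<in> \<Lambda>" using w by (auto simp: Wh_def)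
      have "u x = 0" if "K \<in> \<T>" "x extreme_point_of K" for K x
        using bspec[OF zero, of "Inl x"] that by (auto simp: w'(1))
      then have "\<forall>x\<in>closure \<Omega>. u x = 0" using Vh_zero_of_vertices[OF \<T>(2,3) w'(2)] by blast
      moreover have "(LINT x:e|arclength \<Gamma>. l x) = 0" if "e \<in> induced_partition \<Gamma> \<T>" for e
        using bspec[OF zero, of "Inr e"] that by (auto simp: w'(1))
      then have "AE x in arclength \<Gamma>. l x = 0" by (intro Lh_AE_zero[OF \<Gamma>(1,3) fin w'(3)])
      ultimately show ?thesis using B_zero_left[OF w'(2,3) z] w'(1) by simp
    qed
    show "L2_inner (lebesgue_on \<Omega>) f (fst z) + pairing \<Gamma> g (snd z) = 0"
      if z: "z \<in> W" and zero: "\<forall>w\<in>W. B w z = 0" for z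
    proof -
      obtain v \<mu> where z': "z = (v, \<mu>)" "v \<in> V" "\<mu> \<in> \<Lambda>" using z by (auto simp: Wh_def)
      have neg: "- \<mu> \<in> \<Lambda>" using z' subspace_neg[OF subspace_Lh] by auto
      have "B (v, - \<mu>) y = 0" if y: "y \<in> W" for y
      proof -
        obtain a b where y': "y = (a, b)" "a \<in> V" "b \<in> \<Lambda>" using y by (auto simp: Wh_def)
        have nb: "- b \<in> \<Lambda>" using y' subspace_neg[OF subspace_Lh] by auto
        have "B (a, - b) (v, \<mu>) = B (v, - \<mu>) (a, - (- b))"
          by (rule B_flip[OF y'(2) nb z'(2,3)])
        moreover have "- (- b) = b" by (simp add: fun_eq_iff)
        ultimately show ?thesis using zero Wh_pairI[OF y'(2) nb] z'(1) y'(1) by simp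
      qed
      from B_nondegenerate[OF z'(2) neg this]
      have "\<forall>x\<in>closure \<Omega>. v x = 0" "AE x in arclength \<Gamma>. \<mu> x = 0" by auto
      then show ?thesis
        using L2_inner_zero_right pairing_AE_zero_left by (simp add: z'(1) pairing_commute[of _ g])
    qed
  qed
  then obtain w where "w \<in> W" "\<forall>z\<in>W. B w z = L2_inner (lebesgue_on \<Omega>) f (fst z) + pairing \<Gamma> g (snd z)" ..
  then have "discrete_solution \<Omega> \<Gamma> \<T> \<E> Cs f g w" by (fastforce simp: discrete_solution_def)
  then show ?thesis ..
qed

lemma solution_difference:
  assumes data: "f \<in> L2 (lebesgue_on \<Omega>)" "f' \<in> L2 (lebesgue_on \<Omega>)" "g \<in> Hhalf \<omega> \<Gamma>" "g' \<in> Hhalf \<omega> \<Gamma>"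
    and sol: "discrete_solution \<Omega> \<Gamma> \<T> \<E> Cs f g (u, l)" "discrete_solution \<Omega> \<Gamma> \<T> \<E> Cs f' g' (u', l')"
  shows "(\<lambda>x. u x - u' x) \<in> V" "(\<lambda>x. l x - l' x) \<in> \<Lambda>"
    and "(v, \<mu>) \<in> W \<Longrightarrow> B (\<lambda>x. u x - u' x, \<lambda>x. l x - l' x) (v, \<mu>)
      = L2_inner (lebesgue_on \<Omega>) (\<lambda>x. f x - f' x) v + pairing \<Gamma> (\<lambda>x. g x - g' x) \<mu>"
proof -
  have W: "(u, l) \<in> W" "(u', l') \<in> W" using sol by (auto simp: discrete_solution_def)
  have eq: "(\<lambda>x. u x - u' x, \<lambda>x. l x - l' x) = (u, l) - (u', l')" by (simp add: fun_diff_def)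
  have "(u, l) - (u', l') \<in> W" by (rule subspace_diff[OF subspace_W W])
  then show "(\<lambda>x. u x - u' x) \<in> V" "(\<lambda>x. l x - l' x) \<in> \<Lambda>"
    unfolding eq[symmetric] by (auto simp: Wh_def)
  assume z: "(v, \<mu>) \<in> W"
  then have "v \<in> L2 (lebesgue_on \<Omega>)" "\<mu> \<in> L2 (arclength \<Gamma>)" by (auto simp: Wh_def intro: H1_L2 Vh_H1 Lh_L2)
  then have "L2_inner (lebesgue_on \<Omega>) (\<lambda>x. f x - f' x) v = L2_inner (lebesgue_on \<Omega>) f v - L2_inner (lebesgue_on \<Omega>) f' v"
    "pairing \<Gamma> (\<lambda>x. g x - g' x) \<mu> = pairing \<Gamma> g \<mu> - pairing \<Gamma> g' \<mu>"
    using data by (auto simp: L2_inner_def pairing_def left_diff_distrib L2_mult_integrable Hhalf_L2)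
  moreover have "B ((u, l) - (u', l')) (v, \<mu>) = B (u, l) (v, \<mu>) - B (u', l') (v, \<mu>)"
    by (rule linear_on_diff[OF B_linear_left[OF z] subspace_W W])
  moreover have "B (u, l) (v, \<mu>) = L2_inner (lebesgue_on \<Omega>) f v + pairing \<Gamma> g \<mu>"
    "B (u', l') (v, \<mu>) = L2_inner (lebesgue_on \<Omega>) f' v + pairing \<Gamma> g' \<mu>"
    using sol z unfolding discrete_solution_def by blast+
  ultimately show "B (\<lambda>x. u x - u' x, \<lambda>x. l x - l' x) (v, \<mu>)
      = L2_inner (lebesgue_on \<Omega>) (\<lambda>x. f x - f' x) v + pairing \<Gamma> (\<lambda>x. g x - g' x) \<mu>"
    unfolding eq by simp
qed

lemma solution_unique:
  assumes data: "f \<in> L2 (lebesgue_on \<Omega>)" "g \<in> Hhalf \<omega> \<Gamma>"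
    and sol: "discrete_solution \<Omega> \<Gamma> \<T> \<E> Cs f g w" "discrete_solution \<Omega> \<Gamma> \<T> \<E> Cs f g w'"
  shows "Wh_eq \<Omega> \<Gamma> w w'"
proof -
  obtain u l u' l' where w: "w = (u, l)" "w' = (u', l')" by (metis surj_pair)
  note d = solution_difference[OF data(1,1,2,2) sol[unfolded w]]
  have "B (\<lambda>x. u x - u' x, \<lambda>x. l x - l' x) z = 0" if "z \<in> W" for z
    using d(3)[of "fst z" "snd z"] that by (simp add: L2_inner_def pairing_def)
  from B_nondegenerate[OF d(1,2) this] show ?thesis
    by (auto simp: Wh_eq_def w)
qed

text \<open>The difference of two solutions solves the problem with the difference of the data. By the Poincare inequality and the
duality estimate, that right-hand side is bounded by a multiple of the norm of the test function, so the
inf-sup estimate applies. The factor \<open>1 / \<beta>\<close> comes from the weight of the dual norm in \<open>nW\<close>.\<close>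

lemma solution_stable:
  "\<exists>M\<ge>0. \<forall>f\<in>L2 (lebesgue_on \<Omega>). \<forall>f'\<in>L2 (lebesgue_on \<Omega>). \<forall>g\<in>Hhalf \<omega> \<Gamma>. \<forall>g'\<in>Hhalf \<omega> \<Gamma>. \<forall>u l u' l'.
     discrete_solution \<Omega> \<Gamma> \<T> \<E> Cs f g (u, l) \<and> discrete_solution \<Omega> \<Gamma> \<T> \<E> Cs f' g' (u', l') \<longrightarrow>
     nW (\<lambda>x. u x - u' x, \<lambda>x. l x - l' x)
       \<le> M * (L2_norm (lebesgue_on \<Omega>) (\<lambda>x. f x - f' x) + Hhalf_norm \<omega> \<Gamma> (\<lambda>x. g x - g' x))"
proof -
  obtain C where C: "0 \<le> C" "\<forall>u\<in>H10 \<Omega>. L2_norm (lebesgue_on \<Omega>) u \<le> C * semiV u"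
    using Poincare_H10[OF \<Omega>] by blast
  \<comment> \<open>\<open>C\<close> handles the load \<open>f\<close>, \<open>1 / \<beta>\<close> the boundary data \<open>g\<close>.\<close>
  define c where "c = max C (1 / \<beta>)"
  have c: "0 \<le> c" "C \<le> c" "1 / \<beta> \<le> c" using C(1) by (auto simp: c_def)
  show ?thesis
  proof (intro exI[of _ "6 * c"] conjI ballI allI impI)
    show "0 \<le> 6 * c" using c by simp
    fix f f' g g' u l u' l'
    assume data: "f \<in> L2 (lebesgue_on \<Omega>)" "f' \<in> L2 (lebesgue_on \<Omega>)" "g \<in> Hhalf \<omega> \<Gamma>" "g' \<in> Hhalf \<omega> \<Gamma>"
      and "discrete_solution \<Omega> \<Gamma> \<T> \<E> Cs f g (u, l) \<and> discrete_solution \<Omega> \<Gamma> \<T> \<E> Cs f' g' (u', l')"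
    then have sol: "discrete_solution \<Omega> \<Gamma> \<T> \<E> Cs f g (u, l)" "discrete_solution \<Omega> \<Gamma> \<T> \<E> Cs f' g' (u', l')"
      by auto
    note d = solution_difference[OF data sol]
    let ?f = "\<lambda>x. f x - f' x" and ?g = "\<lambda>x. g x - g' x"
    define F where "F = L2_norm (lebesgue_on \<Omega>) ?f"
    define H where "H = Hhalf_norm \<omega> \<Gamma> ?g"
    have fL: "?f \<in> L2 (lebesgue_on \<Omega>)" using L2_lincomb[OF data(1,2), of 1 "-1"] by simp
    have gH: "?g \<in> Hhalf \<omega> \<Gamma>" by (rule Hhalf_diff[OF \<omega> \<Gamma>(1) data(3,4)])
    have nn: "0 \<le> F" "0 \<le> H" using Hhalf_norm_nonneg[OF gH] by (simp_all add: F_def H_def L2_norm_def)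
    have bound: "B (\<lambda>x. u x - u' x, \<lambda>x. l x - l' x) z \<le> (c * (F + H)) * nW z" if z: "z \<in> W" for z
    proof -
      obtain v \<mu> where z': "z = (v, \<mu>)" "v \<in> V" "\<mu> \<in> \<Lambda>" using z by (auto simp: Wh_def)
      have "L2_inner (lebesgue_on \<Omega>) ?f v \<le> F * L2_norm (lebesgue_on \<Omega>) v"
        using semi_inner_Cauchy_Schwarz[OF semi_inner_L2 fL H1_L2[OF Vh_H1[OF z'(2)]]]
        by (simp add: F_def L2_norm_eq)
      also have "\<dots> \<le> F * (C * semiV v)" using C(2) Vh_H10[OF z'(2)] nn by (intro mult_left_mono) auto
      also have "\<dots> \<le> F * (c * nW z)"
        using norm_ge(1)[OF z'(2,3)] z'(1) c C(1) nn H1_seminorm_nonneg[of \<Omega> v]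
        by (intro mult_left_mono mult_mono) auto
      finally have 1: "L2_inner (lebesgue_on \<Omega>) ?f v \<le> F * (c * nW z)" .
      have "pairing \<Gamma> ?g \<mu> \<le> dual_norm \<mu> * H"
        using pairing_le_Hmhalf_norm[OF gH dual_norm_finite[OF z'(3)] dual_norm_nonneg] by (simp add: H_def pairing_commute[of _ ?g])
      also have "\<dots> \<le> (c * nW z) * H"
      proof (rule mult_right_mono[OF _ nn(2)])
        have "dual_norm \<mu> \<le> 1 / \<beta> * nW z" using norm_ge(2)[OF z'(2,3)] \<beta> z'(1) by (simp add: field_simps)
        also have "\<dots> \<le> c * nW z" using c norm_nonneg[OF z] by (intro mult_right_mono)
        finally show "dual_norm \<mu> \<le> c * nW z" .
      qed
      finally have "pairing \<Gamma> ?g \<mu> \<le> (c * nW z) * H" .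
      then show ?thesis using 1 d(3)[of v \<mu>] z z'(1) by (simp add: algebra_simps)
    qed
    have "nW (\<lambda>x. u x - u' x, \<lambda>x. l x - l' x) \<le> 6 * (c * (F + H))"
      using c nn by (intro norm_le_six_B_bound[OF d(1,2) _ bound]) auto
    then show "nW (\<lambda>x. u x - u' x, \<lambda>x. l x - l' x) \<le> 6 * c * (L2_norm (lebesgue_on \<Omega>) ?f + Hhalf_norm \<omega> \<Gamma> ?g)"
      by (simp add: F_def H_def mult.assoc)
  qed
qed

theorem well_posed: "discrete_well_posed \<omega> \<Omega> \<Gamma> \<T> \<E> Cs \<beta>"
  unfolding discrete_well_posed_def
proof (intro conjI ballI)
  fix f g assume fg: "f \<in> L2 (lebesgue_on \<Omega>)" "g \<in> Hhalf \<omega> \<Gamma>"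
  show "\<exists>w. discrete_solution \<Omega> \<Gamma> \<T> \<E> Cs f g w" using fg by (rule solution_exists)
  show "\<forall>w w'. discrete_solution \<Omega> \<Gamma> \<T> \<E> Cs f g w \<and> discrete_solution \<Omega> \<Gamma> \<T> \<E> Cs f g w'
      \<longrightarrow> Wh_eq \<Omega> \<Gamma> w w'"
    using solution_unique[OF fg] by blast
qed (rule solution_stable)

end

section \<open>Stability and well-posedness for the family of meshes\<close>

theorem theorem2:
  fixes \<omega> \<Omega> :: "plane set"
    and \<Gamma> :: "(plane \<times> plane) set"
    and I :: "'i set"
    and \<T> \<E> :: "'i \<Rightarrow> plane set set"
    and C Cs \<beta> :: real
  assumes "lipschitz_polygonal_domain \<omega> \<Gamma>"
    and "polygonal_domain \<Omega>"
    and "closure \<omega> \<subseteq> \<Omega>"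
    and "regular_family \<Omega> I \<T>"
    and "C > 0"
    and "\<And>h. h \<in> I \<Longrightarrow> coarse_partition \<Gamma> (\<T> h) C (\<E> h)"
    and "Cs > 0"
    and "\<beta> > 0"
    and "\<And>h \<mu>. h \<in> I \<Longrightarrow> \<mu> \<in> Lh \<Gamma> (\<T> h) \<Longrightarrow>
           ereal \<beta> * Hmhalf_norm \<omega> \<Gamma> (pairing \<Gamma> \<mu>)
             \<le> (SUP v\<in>Vh_nonzero \<Omega> (\<T> h). ereal (- pairing \<Gamma> \<mu> v / H1_seminorm \<Omega> v))
               + ereal (sqrt (stab \<Gamma> (\<E> h) Cs \<mu> \<mu>))"
  shows "\<forall>h\<in>I.
           (\<forall>w\<in>Wh \<Omega> \<Gamma> (\<T> h).
              (SUP z\<in>Wh_nonzero \<Omega> \<Gamma> (\<T> h).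
                 ereal (Bform \<Omega> \<Gamma> (\<E> h) Cs w z / Wh_norm \<omega> \<Omega> \<Gamma> (\<E> h) Cs \<beta> z))
              \<ge> ereal (1 / 6 * Wh_norm \<omega> \<Omega> \<Gamma> (\<E> h) Cs \<beta> w)) \<and>
           discrete_well_posed \<omega> \<Omega> \<Gamma> (\<T> h) (\<E> h) Cs \<beta>"
proof
  fix h assume h: "h \<in> I"
  have \<omega>: "\<omega> \<noteq> {}" "open \<omega>" "bounded \<omega>" and \<Omega>: "open \<Omega>" "bounded \<Omega>"
    and \<Gamma>: "finite \<Gamma>" "frontier \<omega> = segments \<Gamma>" "\<forall>(a, b)\<in>\<Gamma>. a \<noteq> b"
    using assms(1,2) by (auto simp: lipschitz_polygonal_domain_def polygonal_domain_def bounded_domain_def)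
  have T: "triangulation (\<T> h)" "\<And>K. K \<in> \<T> h \<Longrightarrow> 2 simplex K" "\<Union>(\<T> h) = closure \<Omega>"
    using assms(4) h by (auto simp: regular_family_def mesh_def)
  have E: "finite (\<E> h)" "\<Union>(\<E> h) = segments \<Gamma>"
    "\<forall>e\<in>\<E> h. (\<exists>p q. p \<noteq> q \<and> e = closed_segment p q \<and>
        p \<in> induced_vertices \<Gamma> (\<T> h) \<and> q \<in> induced_vertices \<Gamma> (\<T> h)) \<and>
      (\<exists>(a, b)\<in>\<Gamma>. e \<subseteq> closed_segment a b)"
    using assms(6)[OF h] unfolding coarse_partition_def by - ((elim conjE, assumption)+)
  interpret stabilised_problem \<omega> \<Omega> \<Gamma> "\<T> h" "\<E> h" Cs \<beta>
  proof
    have "\<omega> \<noteq> UNIV" using \<omega>(3) not_bounded_UNIV by auto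
    then have "frontier \<omega> \<noteq> {}" using \<omega>(1) frontier_not_empty by blast
    then show "\<Gamma> \<noteq> {}" using \<Gamma>(2) by (auto simp: segments_def)
    show "segments \<Gamma> \<subseteq> \<Omega>" using \<Gamma>(2) assms(3) by (auto simp: frontier_def)
    show "finite (\<T> h)" using T(1) by (simp add: triangulation_def)
    show "polytope K" if "K \<in> \<T> h" for K
      using T(2)[OF that] by (auto simp: simplex_def intro: polytope_convex_hull aff_independent_finite)
    show "compact e \<and> e \<subseteq> segments \<Gamma>" if "e \<in> \<E> h" for e
    proof -
      have "compact e" using bspec[OF E(3) that] by (elim conjE exE) simp
      then show ?thesis using E(2) that by auto
    qed
    show "ereal \<beta> * Hmhalf_norm \<omega> \<Gamma> (pairing \<Gamma> \<mu>)
        \<le> (SUP v\<in>Vh_nonzero \<Omega> (\<T> h). ereal (- pairing \<Gamma> \<mu> v / H1_seminorm \<Omega> v))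
          + ereal (sqrt (stab \<Gamma> (\<E> h) Cs \<mu> \<mu>))" if "\<mu> \<in> Lh \<Gamma> (\<T> h)" for \<mu>
      using h that by (rule assms(9))
  qed (fact \<omega>(2,3) \<Omega> \<Gamma>(1,3) T(3) E(1) assms(7,8))+
  show "(\<forall>w\<in>Wh \<Omega> \<Gamma> (\<T> h).
              (SUP z\<in>Wh_nonzero \<Omega> \<Gamma> (\<T> h).
                 ereal (Bform \<Omega> \<Gamma> (\<E> h) Cs w z / Wh_norm \<omega> \<Omega> \<Gamma> (\<E> h) Cs \<beta> z))
              \<ge> ereal (1 / 6 * Wh_norm \<omega> \<Omega> \<Gamma> (\<E> h) Cs \<beta> w)) \<and>
           discrete_well_posed \<omega> \<Omega> \<Gamma> (\<T> h) (\<E> h) Cs \<beta>"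
    using inf_sup well_posed by blast
qed

end
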